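(* Let $f=\sum_{k=1}^3\sum_{j=0}^\infty c_{j,k}P_{j,k}$ be a nonzero entire analytic function on $SG$. Then the zero set $Z$ of $f$ is compact and nowhere dense in $SG$.
   Context: Sierpinski gasket: let $q_0=(\tfrac12,\tfrac{\sqrt3}{2})$, $q_1=(0,0)$, $q_2=(1,0)$, $V_0=\{q_0,q_1,q_2\}$, $F_i(x)=\tfrac12(x-q_i)+q_i$, and let $SG\subset\mathbb R^2$ be the unique nonempty compact set with $SG=\bigcup_{i=0}^2F_i(SG)$. For a word $w=(w_1,\dots,w_m)\in\{0,1,2\}^m$, $|w|=m$, put $F_w=F_{w_1}\circ\cdots\circ F_{w_m}$; $F_w(SG)$ is called an $m$-cell; $V_m=\bigcup_{|w|=m}F_w(V_0)$; distinct $x,y\in V_m$ satisfy $x\sim_m y$ if they lie in a common $m$-cell. $\mu$ is the self-similar Borel probability measure with $\mu(F_w(SG))=3^{-|w|}$. All functions are real-valued. Energy and Laplacian: $\mathscr E(u,v)=\lim_{m\to\infty}(3/5)^{-m}\sum_{x\sim_m y}(u(x)-u(y))(v(x)-v(y))$ (sum over unordered pairs), and $u\in\operatorname{dom}\mathscr E$ if $\mathscr E(u,u)$ exists and is finite. For $u\in\operatorname{dom}\mathscr E$ and $f$ continuous, $\Delta u=f$ means $\mathscr E(u,v)=-\int_{SG}fv\,d\mu$ for all $v\in\operatorname{dom}\mathscr E$ vanishing on $V_0$. Indices of $q_i$ are mod 3. Normal derivative: $\partial_nu(q_i)=\lim_m(5/3)^m(2u(q_i)-u(F_i^mq_{i+1})-u(F_i^mq_{i-1}))$.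 Tangential derivative: $\partial_Tu(q_i)=\lim_m5^m(u(F_i^mq_{i+1})-u(F_i^mq_{i-1}))$. Monomials: for $j\ge0$, $k\in\{1,2,3\}$, $P_{j,k}$ is the unique function with $\Delta^{j+1}P_{j,k}=0$ such that for all $0\le n\le j$: $\Delta^nP_{j,k}(q_0)=\delta_{nj}\delta_{k1}$, $\partial_n\Delta^nP_{j,k}(q_0)=\delta_{nj}\delta_{k2}$, $\partial_T\Delta^nP_{j,k}(q_0)=\delta_{nj}\delta_{k3}$. Entire analytic function: a function defined by a power series $\sum_{k=1}^3\sum_{j=0}^\infty c_{j,k}P_{j,k}(x)$ with real coefficients such that $|c_{j,k}|=O(R^j)$ as $j\to\infty$ for some $R<\lambda_2$, where $\lambda_2=135.572126995788\ldots$ is the second nonzero Neumann eigenvalue of $-\Delta$ (eigenvalues counted without multiplicity; Neumann means vanishing normal derivatives at $V_0$). *)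

theory Defs
  imports "HOL-Probability.Probability_Measure" "HOL-Analysis.Analysis" "HOL-Library.Landau_Symbols"
begin

section \<open>The gasket\<close>

text \<open>
  Indices range over the three-element type \<open>3\<close>, whose arithmetic is arithmetic mod 3, so that
  \<open>i + 1\<close> and \<open>i - 1\<close> are the neighbours of \<open>i\<close>.  Real functions on the gasket are rendered as
  functions on the plane whose values outside \<open>SG\<close> are irrelevant.
\<close>

definition vtx :: "3 \<Rightarrow> real ^ 2" where
  "vtx i = (if i = 0 then vector [1 / 2, sqrt 3 / 2]
            else if i = 1 then vector [0, 0] else vector [1, 0])"

definition contr :: "3 \<Rightarrow> real ^ 2 \<Rightarrow> real ^ 2" where
  "contr i x = (1 / 2) *\<^sub>R (x - vtx i) + vtx i"

primrec word_map :: "3 list \<Rightarrow> real ^ 2 \<Rightarrow> real ^ 2" where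
  "word_map [] = id"
| "word_map (i # w) = contr i \<circ> word_map w"

definition SG :: "(real ^ 2) set" where
  "SG = (THE K. compact K \<and> K \<noteq> {} \<and> K = (\<Union>i. contr i ` K))"

definition cell :: "3 list \<Rightarrow> (real ^ 2) set" where
  "cell w = word_map w ` SG"

definition V :: "nat \<Rightarrow> (real ^ 2) set" where
  "V m = (\<Union>w\<in>{w. length w = m}. word_map w ` range vtx)"

definition adj :: "nat \<Rightarrow> real ^ 2 \<Rightarrow> real ^ 2 \<Rightarrow> bool" where
  "adj m x y \<longleftrightarrow> x \<in> V m \<and> y \<in> V m \<and> x \<noteq> y \<and> (\<exists>w. length w = m \<and> x \<in> cell w \<and> y \<in> cell w)"

definition SG_measure :: "(real ^ 2) measure" where
  "SG_measure = (THE M. sets M = sets (restrict_space borel SG) \<and> prob_space M \<and>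
     (\<forall>A\<in>sets M. measure M A = (\<Sum>i\<in>UNIV. measure M (contr i -` A \<inter> SG)) / 3) \<and>
     (\<forall>w. measure M (cell w) = (1 / 3) ^ length w))"

section \<open>Energy and Laplacian\<close>

text \<open>The factor \<open>1 / 2\<close> turns the sum over ordered pairs into the sum over unordered ones.\<close>

definition graph_energy :: "nat \<Rightarrow> (real ^ 2 \<Rightarrow> real) \<Rightarrow> (real ^ 2 \<Rightarrow> real) \<Rightarrow> real" where
  "graph_energy m u v =
     (5 / 3) ^ m * ((\<Sum>(x, y)\<in>{(x, y). adj m x y}. (u x - u y) * (v x - v y)) / 2)"

definition energy :: "(real ^ 2 \<Rightarrow> real) \<Rightarrow> (real ^ 2 \<Rightarrow> real) \<Rightarrow> real" where
  "energy u v = lim (\<lambda>m. graph_energy m u v)"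

text \<open>
  The energy only sees the values on the countable set \<open>\<Union>m. V m\<close>, so continuity must be part of
  the domain: otherwise a test function could be changed arbitrarily off that set, and
  \<open>\<Delta> u = f\<close> would force \<open>f = 0\<close>.
\<close>

definition dom_energy :: "(real ^ 2 \<Rightarrow> real) set" where
  "dom_energy = {u. continuous_on SG u \<and> convergent (\<lambda>m. graph_energy m u u)}"

definition has_laplacian :: "(real ^ 2 \<Rightarrow> real) \<Rightarrow> (real ^ 2 \<Rightarrow> real) \<Rightarrow> bool" where
  "has_laplacian u f \<longleftrightarrow> u \<in> dom_energy \<and> continuous_on SG f \<and>
     (\<forall>v\<in>dom_energy. (\<forall>x\<in>V 0. v x = 0) \<longrightarrow> energy u v = - (LINT x|SG_measure. f x * v x))"

definition has_normal_deriv :: "(real ^ 2 \<Rightarrow> real) \<Rightarrow> real \<Rightarrow> 3 \<Rightarrow> bool" where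
  "has_normal_deriv u d i \<longleftrightarrow>
     (\<lambda>m. (5 / 3) ^ m * (2 * u (vtx i) - u ((contr i ^^ m) (vtx (i + 1)))
                                      - u ((contr i ^^ m) (vtx (i - 1))))) \<longlonglongrightarrow> d"

definition has_tangential_deriv :: "(real ^ 2 \<Rightarrow> real) \<Rightarrow> real \<Rightarrow> 3 \<Rightarrow> bool" where
  "has_tangential_deriv u d i \<longleftrightarrow>
     (\<lambda>m. 5 ^ m * (u ((contr i ^^ m) (vtx (i + 1))) - u ((contr i ^^ m) (vtx (i - 1))))) \<longlonglongrightarrow> d"

section \<open>Monomials and entire analytic functions\<close>

text \<open>
  \<open>(has_laplacian ^^ n) u g\<close> says \<open>\<Delta>\<^sup>n u = g\<close>.  Since \<open>g\<close> is determined only on \<open>SG\<close>, the monomial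
  is normalised to vanish outside \<open>SG\<close>, which makes it unique as a function on the plane.
\<close>

definition is_monomial :: "nat \<Rightarrow> nat \<Rightarrow> (real ^ 2 \<Rightarrow> real) \<Rightarrow> bool" where
  "is_monomial j k u \<longleftrightarrow>
     (has_laplacian ^^ (j + 1)) u (\<lambda>x. 0) \<and>
     (\<forall>n\<le>j. \<exists>g. (has_laplacian ^^ n) u g \<and>
        g (vtx 0) = of_bool (n = j \<and> k = 1) \<and>
        has_normal_deriv g (of_bool (n = j \<and> k = 2)) 0 \<and>
        has_tangential_deriv g (of_bool (n = j \<and> k = 3)) 0)"

definition monomial :: "nat \<Rightarrow> nat \<Rightarrow> real ^ 2 \<Rightarrow> real" where
  "monomial j k = (THE u. is_monomial j k u \<and> (\<forall>x. x \<notin> SG \<longrightarrow> u x = 0))"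

definition neumann_eigenvalue :: "real \<Rightarrow> bool" where
  "neumann_eigenvalue l \<longleftrightarrow> (\<exists>u. (\<exists>x\<in>SG. u x \<noteq> 0) \<and> has_laplacian u (\<lambda>x. - l * u x) \<and>
     (\<forall>i. has_normal_deriv u 0 i))"

text \<open>
  The second smallest nonzero Neumann eigenvalue of \<open>- \<Delta>\<close>, multiplicities disregarded; with the
  above normalisations of energy and measure its value is \<open>135.572126995788\<dots>\<close>.
\<close>

definition lambda2 :: real where
  "lambda2 = (THE l. neumann_eigenvalue l \<and> l \<noteq> 0 \<and>
     card {l'. neumann_eigenvalue l' \<and> l' \<noteq> 0 \<and> l' < l} = 1)"

text \<open>
  The growth condition makes the series converge, so the summability clause only expresses that the
  sums are genuine.  The radius \<open>R\<close> is taken positive because Landau's \<open>O\<close> only sees \<open>\<bar>R\<bar>\<close>.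
\<close>

definition entire_analytic_series :: "(nat \<Rightarrow> nat \<Rightarrow> real) \<Rightarrow> (real ^ 2 \<Rightarrow> real) \<Rightarrow> bool" where
  "entire_analytic_series c f \<longleftrightarrow>
     (\<exists>R. 0 < R \<and> R < lambda2 \<and> (\<forall>k\<in>{1..3}. (\<lambda>j. c j k) \<in> O(\<lambda>j. R ^ j))) \<and>
     (\<forall>x\<in>SG. (\<forall>k\<in>{1..3}. summable (\<lambda>j. c j k * monomial j k x)) \<and>
        f x = (\<Sum>k=1..3. \<Sum>j. c j k * monomial j k x))"

definition nowhere_dense_in :: "'a topology \<Rightarrow> 'a set \<Rightarrow> bool" where
  "nowhere_dense_in X S \<longleftrightarrow> S \<subseteq> topspace X \<and> X interior_of (X closure_of S) = {}"

end

theory Submission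
  imports Defs "HOL-Complex_Analysis.Great_Picard" "HOL-Probability.Stream_Space" "HOL-Probability.Probability_Mass_Function"
begin

text \<open>
  Let \<open>g\<^sub>n = \<Delta>\<^sup>n f\<close>.  The weak Laplacian is equivalent to matching conditions for normal derivatives at
  the junctions of all cells, so it localises: \<open>\<Delta> (u \<circ> F\<^sub>i) = (\<Delta> u \<circ> F\<^sub>i) / 5\<close>.  The key fact is that a chain
  \<open>\<Delta> u\<^sub>n\<^sub>+\<^sub>1 = u\<^sub>n\<close> with vanishing jets at \<open>q\<^sub>0\<close> decays like \<open>r\<^sup>n\<close> for every \<open>r > 1 / (5 p)\<close>, where \<open>p\<close> is the best
  constant in the Poincare inequality for functions that are odd under the reflection fixing \<open>q\<^sub>0\<close>.  On the cell
  at \<open>q\<^sub>0\<close> the chain is a rescaled chain, which gains a factor 5 in the rate; on the two other cells the even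
  part is governed by jets coming from that cell, and the odd parts solve Neumann and Dirichlet problems up to
  small errors, for which the Poincare inequality gives the rate \<open>1 / (5 p)\<close>.  A minimiser of the odd Rayleigh
  quotient is a Neumann eigenfunction for \<open>p\<close>, and a copy of it supported on the cells away from \<open>q\<^sub>0\<close> is one
  for \<open>5 p\<close>; hence \<open>\<lambda>\<^sub>2 \<le> 5 p\<close>.  So the monomials decay fast enough for \<open>|g\<^sub>n|\<close> to be of order \<open>R\<^sup>n\<close> with
  \<open>R < 5 p\<close>, and if \<open>f\<close> vanishes on a cell \<open>F\<^sub>i(SG)\<close>, then all jets of the \<open>g\<^sub>n\<close> at \<open>q\<^sub>i\<close> vanish and the decay
  forces \<open>f = 0\<close>.  Cells of higher level follow by induction, since restriction to a cell only decreases \<open>R\<close>.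
\<close>

text \<open>The obstacle is the tangential derivative. Values and normal derivatives are matched
  across a junction, but tangential derivatives are not, so a bound on the cell at
  \<open>vtx 0\<close> passes only two of the three jets to each neighbouring cell. For the even
  part of the restriction to that cell this suffices, since its tangential derivative is zero; the
  odd part is out of reach of jets and needs an energy argument, which is why the odd Poincare
  constant governs the rate. Estimating a solution by its jets costs a large constant per inversion
  of the Laplacian, so a direct induction works only for a huge rate. The sharp rate comes from a
  descent: a bound at rate \<open>5 * r\<close> on the gasket is a bound at rate \<open>r\<close> on
  a cell, because sources restricted to a cell carry a factor 1/5, and the energy argument returns
  it to the gasket as long as \<open>r\<close> exceeds \<open>1 / (5 * pcon)\<close>. Finitely many
  divisions by 5 reach every such \<open>r\<close>. Neither \<open>pcon\<close> nor
  \<open>lambda2\<close> is evaluated: two distinct nonzero Neumann eigenvalues, \<open>pcon\<close>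
  and \<open>5 * pcon\<close>, bound the second one from above.\<close>

lemma three_arith [simp]: "(3::3) = 0" "(- 1::3) = 2" "(- 2::3) = 1"
  by simp_all

lemma all_3: "(\<forall>i::3. P i) \<longleftrightarrow> P 0 \<and> P 1 \<and> P 2"
  using forall_3[of P] by auto

lemma exh_3: "i = 0 \<or> i = 1 \<or> i = (2::3)"
  using exhaust_3[of i] by auto

lemma sum_UNIV_3: "sum g (UNIV::3 set) = g 0 + g 1 + g 2"
  by (simp add: sum_3 ac_simps)

lemma sum_UNIV_shift: "sum g (UNIV::3 set) = g i + g (i + 1) + g (i - 1)"
  using exh_3[of i] by (auto simp: sum_UNIV_3 ac_simps)

section \<open>Geometry of the gasket\<close>

text \<open>Barycentric coordinates with respect to the three vertices. A contraction halves them
  and adds 1/2 to one of them (\<open>bary_contr\<close>), so incidence questions about cells turn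
  into inequalities between coordinates.\<close>

definition bary :: "3 \<Rightarrow> real ^ 2 \<Rightarrow> real" where
  "bary i x = (if i = 0 then 2 / sqrt 3 * x $ 2 else if i = 1 then 1 - x $ 1 - x $ 2 / sqrt 3
     else x $ 1 - x $ 2 / sqrt 3)"

lemma bary_vtx: "bary i (vtx j) = of_bool (i = j)"
  using exh_3[of i] exh_3[of j] by (auto simp: bary_def vtx_def)

lemma bary_sum: "bary 0 x + bary 1 x + bary 2 x = 1"
  by (simp add: bary_def field_simps)

lemma sum_bary: "(\<Sum>i\<in>UNIV. bary i x) = 1"
  by (simp add: sum_UNIV_3 bary_sum)

lemma bary_affine: "bary i (a *\<^sub>R x + (1 - a) *\<^sub>R y) = a * bary i x + (1 - a) * bary i y"
  by (simp add: bary_def field_simps)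

lemma contr_affine: "contr j x = (1 / 2) *\<^sub>R x + (1 - 1 / 2) *\<^sub>R vtx j"
  by (simp add: contr_def algebra_simps flip: scaleR_left.add)

lemma bary_contr: "bary i (contr j x) = (bary i x + of_bool (i = j)) / 2"
  unfolding contr_affine bary_affine by (simp add: bary_vtx)

lemma bary_eqI: "(\<And>i. bary i x = bary i y) \<Longrightarrow> x = y"
proof -
  assume a: "\<And>i. bary i x = bary i y"
  have "x $ 2 = y $ 2" using a[of 0] by (simp add: bary_def)
  moreover have "x $ 1 = y $ 1" using a[of 2] calculation by (simp add: bary_def)
  ultimately show "x = y" by (simp add: vec_eq_iff forall_2)
qed

lemma continuous_on_bary [continuous_intros]: "continuous_on A (bary i)"
  using exh_3[of i] by (auto simp: bary_def intro!: continuous_intros)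

lemma dist_contr: "dist (contr i x) (contr i y) = dist x y / 2"
proof -
  have "contr i x - contr i y = (1 / 2) *\<^sub>R (x - y)"
    by (simp add: contr_def algebra_simps)
  then show ?thesis by (simp add: dist_norm)
qed

lemma continuous_on_contr [continuous_intros]: "continuous_on A (contr i)"
  unfolding contr_def by (intro continuous_intros)

lemma inj_contr: "contr i x = contr i y \<longleftrightarrow> x = y"
  using dist_contr[of i x y] by auto

lemma contr_vtx [simp]: "contr i (vtx i) = vtx i"
  by (simp add: contr_def)

lemma contr_vtx_comm: "contr i (vtx j) = contr j (vtx i)"
  by (rule bary_eqI) (simp add: bary_contr bary_vtx)

lemma vtx_inj: "vtx i = vtx j \<longleftrightarrow> i = j"
  using bary_vtx[of i i] bary_vtx[of i j] by auto

section \<open>Existence and uniqueness of the attractor\<close>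

definition hutch :: "(real ^ 2) set \<Rightarrow> (real ^ 2) set" where
  "hutch K = (\<Union>i. contr i ` K)"

lemma hutch_mono: "A \<subseteq> B \<Longrightarrow> hutch A \<subseteq> hutch B"
  by (auto simp: hutch_def)

lemma compact_hutch: "compact K \<Longrightarrow> compact (hutch K)"
  unfolding hutch_def
  by (intro compact_UN) (auto intro!: compact_continuous_image continuous_intros)

text \<open>A point \<open>x\<close> of \<open>K\<close> farthest from \<open>L\<close> is the image
  of some \<open>y\<close> in \<open>K\<close>. Contracting a point of \<open>L\<close> nearest to
  \<open>y\<close> gives a point of \<open>L\<close> at half that distance, so the maximal distance
  is at most half of itself and hence zero.\<close>

lemma hutch_fixed_le:
  assumes K: "compact K" "K \<noteq> {}" "K = hutch K" and L: "compact L" "L \<noteq> {}" "L = hutch L"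
  shows "K \<subseteq> L"
proof -
  have "continuous_on K (\<lambda>x. infdist x L)" by (intro continuous_intros)
  then obtain x where x: "x \<in> K" "\<And>y. y \<in> K \<Longrightarrow> infdist y L \<le> infdist x L"
    using continuous_attains_sup[OF K(1,2)] by metis
  obtain i y where y: "y \<in> K" "x = contr i y" using x(1) K(3) unfolding hutch_def by blast
  obtain z where z: "z \<in> L" "infdist y L = dist y z"
    using infdist_attains_inf[of L y] compact_imp_closed[OF L(1)] L(2) by metis
  have "contr i z \<in> L" using z(1) L(3) unfolding hutch_def by blast
  then have "infdist x L \<le> dist (contr i y) (contr i z)" using y(2) by (simp add: infdist_le)
  also have "\<dots> \<le> infdist x L / 2" using x(2)[OF y(1)] z(2) by (simp add: dist_contr)
  finally have "infdist x L \<le> 0" by simp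
  then have "\<And>w. w \<in> K \<Longrightarrow> infdist w L = 0" using x(2) infdist_nonneg by (metis antisym order_trans)
  then show ?thesis using in_closed_iff_infdist_zero[OF compact_imp_closed[OF L(1)] L(2)] by blast
qed

lemma hutch_fixed_ex: "\<exists>K. compact K \<and> K \<noteq> {} \<and> K = hutch K"
proof -
  define T :: "(real ^ 2) set" where "T = {x. \<forall>i. bary i x \<ge> 0}"
  have bd: "norm x \<le> (\<Sum>i\<in>UNIV. norm (vtx i))" if "x \<in> T" for x
  proof -
    have "x = (\<Sum>i\<in>UNIV. bary i x *\<^sub>R vtx i)"
      by (simp add: sum_UNIV_3 bary_def vtx_def vec_eq_iff forall_2)
    then have "norm x \<le> (\<Sum>i\<in>UNIV. norm (bary i x *\<^sub>R vtx i))" by (metis norm_sum)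
    also have "\<dots> \<le> (\<Sum>i\<in>UNIV. norm (vtx i))"
    proof (rule sum_mono)
      fix i
      have "bary i x \<le> 1" "0 \<le> bary i x"
        using sum_bary[of x] that member_le_sum[of i UNIV "\<lambda>i. bary i x"] by (auto simp: T_def)
      then show "norm (bary i x *\<^sub>R vtx i) \<le> norm (vtx i)"
        by (simp add: mult_left_le_one_le)
    qed
    finally show ?thesis .
  qed
  have "closed T"
    unfolding T_def by (intro closed_Collect_all closed_Collect_le continuous_intros)
  moreover have "bounded T" using bd by (auto simp: bounded_iff)
  ultimately have cT: "compact T" by (simp add: compact_eq_bounded_closed)
  have hT: "hutch T \<subseteq> T" by (auto simp: hutch_def T_def bary_contr)
  define K where "K n = (hutch ^^ n) T" for n
  have cK: "compact (K n)" for n by (induction n) (auto simp: K_def cT compact_hutch)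
  have dec: "K (Suc n) \<subseteq> K n" for n
    by (induction n) (simp_all add: K_def hT hutch_mono)
  then have decm: "K n \<subseteq> K m" if "m \<le> n" for m n using lift_Suc_antimono_le[of K] that by blast
  have ne: "vtx 0 \<in> K n" for n
  proof (induction n)
    case 0 then show ?case by (simp add: K_def T_def bary_vtx)
  next
    case (Suc n) 
    then have "contr 0 (vtx 0) \<in> hutch (K n)" unfolding hutch_def by blast
    then show ?case by (simp add: K_def)
  qed
  define L where "L = (\<Inter>n. K n)"
  have "compact L" unfolding L_def using cK by (intro compact_Inter) auto
  moreover have "L \<noteq> {}" using ne unfolding L_def by auto
  moreover have "hutch L \<subseteq> L"
  proof -
    have "hutch L \<subseteq> K (Suc n)" for n
      using hutch_mono[of L "K n"] by (auto simp: L_def K_def)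
    then have "hutch L \<subseteq> K n" for n using dec by blast
    then show ?thesis unfolding L_def by blast
  qed
  moreover have "L \<subseteq> hutch L"
  proof
    fix x assume x: "x \<in> L"
    have "\<exists>i. x \<in> contr i ` K n" for n
    proof -
      have "x \<in> K (Suc n)" using x unfolding L_def by blast
      then show ?thesis by (auto simp: K_def hutch_def)
    qed
    \<comment> \<open>The cell that contains \<open>x\<close> may change with \<open>n\<close>. One
      index \<open>i\<close> occurs infinitely often, and since the sets \<open>K n\<close>
      decrease, the preimage of \<open>x\<close> under \<open>contr i\<close> then lies in all of
      them.\<close>
    then obtain s where s: "\<And>n. x \<in> contr (s n) ` K n" by metis
    obtain i where i: "infinite {n. s n = i}"
      using pigeonhole_infinite[of UNIV s] by auto
    have "{n. s n = i} \<noteq> {}" using i infinite_imp_nonempty by blast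
    then obtain n where "s n = i" by blast
    then obtain y where y: "contr i y = x" using s[of n] by blast
    have "y \<in> K m" for m
    proof -
      obtain n where "n \<ge> m" "s n = i" using i unfolding infinite_nat_iff_unbounded_le by auto
      then have "y \<in> K n" using s[of n] y by (auto simp: inj_contr)
      then show ?thesis using decm[OF \<open>n \<ge> m\<close>] by blast
    qed
    then show "x \<in> hutch L" using y unfolding L_def hutch_def by blast
  qed
  ultimately show ?thesis by blast
qed

lemma SG_fix: "compact SG \<and> SG \<noteq> {} \<and> SG = (\<Union>i. contr i ` SG)"
proof -
  obtain K where K: "compact K \<and> K \<noteq> {} \<and> K = hutch K" using hutch_fixed_ex by blast
  have "\<exists>!K. compact K \<and> K \<noteq> {} \<and> K = (\<Union>i. contr i ` K)"
    using K unfolding hutch_def[symmetric]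
    by (intro ex1I[of _ K]) (blast, metis hutch_fixed_le subset_antisym)
  from theI'[OF this] show ?thesis unfolding SG_def .
qed

lemma compact_SG: "compact SG" and SG_nonempty: "SG \<noteq> {}" and SG_eq: "SG = (\<Union>i. contr i ` SG)"
  using SG_fix by blast+

lemma closed_SG: "closed SG"
  using compact_SG by (rule compact_imp_closed)

lemma contr_SG [intro, simp]: "x \<in> SG \<Longrightarrow> contr i x \<in> SG"
  by (subst SG_eq) blast

lemma SG_cases:
  assumes "x \<in> SG" obtains i y where "y \<in> SG" "x = contr i y"
  using assms SG_eq by blast

lemma vtx_SG [intro, simp]: "vtx i \<in> SG"
proof -
  obtain x where x: "x \<in> SG" using SG_nonempty by auto
  have a: "(contr i ^^ n) x \<in> SG" for n by (induction n) (auto simp: x)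
  have b: "dist ((contr i ^^ n) x) (vtx i) = dist x (vtx i) * (1 / 2) ^ n" for n
  proof (induction n)
    case (Suc n)
    have "dist ((contr i ^^ Suc n) x) (vtx i) = dist (contr i ((contr i ^^ n) x)) (contr i (vtx i))"
      by simp
    then show ?case using Suc by (simp only: dist_contr) simp
  qed simp
  have "(\<lambda>n. dist x (vtx i) * (1 / 2) ^ n) \<longlonglongrightarrow> 0"
    by (intro tendsto_mult_right_zero LIMSEQ_power_zero) auto
  then have "(\<lambda>n. (contr i ^^ n) x) \<longlonglongrightarrow> vtx i"
    unfolding tendsto_dist_iff[of _ "vtx i"] b .
  then show ?thesis using closed_sequentially[OF closed_SG, of "\<lambda>n. (contr i ^^ n) x"] a by auto
qed

text \<open>A minimiser \<open>z\<close> of the coordinate has the form \<open>contr j y\<close>, so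
  its value is at least half the value at \<open>y\<close> and therefore at least half of
  itself.\<close>

lemma bary_nonneg: "x \<in> SG \<Longrightarrow> bary i x \<ge> 0"
proof -
  assume x: "x \<in> SG"
  obtain z where z: "z \<in> SG" "\<And>y. y \<in> SG \<Longrightarrow> bary i z \<le> bary i y"
    using continuous_attains_inf[OF compact_SG SG_nonempty, of "bary i"] continuous_on_bary by blast
  obtain j y where y: "y \<in> SG" "z = contr j y" using z(1) by (rule SG_cases)
  have "bary i y / 2 \<le> bary i z" unfolding y by (simp add: bary_contr)
  then have "bary i z \<ge> 0" using z(2)[OF y(1)] by simp
  then show ?thesis using z(2)[OF x] by simp
qed

lemma bary_le_1: "x \<in> SG \<Longrightarrow> bary i x \<le> 1"
  using sum_bary[of x] bary_nonneg[of x] member_le_sum[of i UNIV "\<lambda>i. bary i x"] by auto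

lemma bary_1_iff: "x \<in> SG \<Longrightarrow> bary i x = 1 \<Longrightarrow> x = vtx i"
proof (rule bary_eqI)
  fix j assume a: "x \<in> SG" "bary i x = 1"
  have "(\<Sum>k\<in>UNIV - {i}. bary k x) = 0"
    using sum_bary[of x] a(2) by (simp add: sum_diff1)
  then have "\<forall>k\<in>UNIV - {i}. bary k x = 0"
    by (subst (asm) sum_nonneg_eq_0_iff) (auto simp: bary_nonneg a)
  then show "bary j x = bary j (vtx i)" using a by (cases "i = j") (auto simp: bary_vtx)
qed

text \<open>On the cell \<open>i\<close> the coordinate \<open>bary i\<close> is at least 1/2. At a
  common point of two cells both coordinates are therefore exactly 1/2, which singles out the
  midpoint. This is what makes gluing well defined and keeps the edges of different cells
  apart.\<close>

lemma cells_meet: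
  assumes "x \<in> SG" "y \<in> SG" "i \<noteq> j" "contr i x = contr j y"
  shows "x = vtx j \<and> y = vtx i"
proof -
  have *: "x = vtx j" if "x \<in> SG" "y \<in> SG" "i \<noteq> j" "contr i x = contr j y" for x y i j
  proof -
    define z where "z = contr i x"
    have 1: "bary i z = (bary i x + 1) / 2" "bary j z = bary j x / 2"
      using that(3) by (auto simp: z_def bary_contr)
    have 2: "bary j z = (bary j y + 1) / 2" using that(4) by (simp add: z_def bary_contr)
    have "bary i z + bary j z = (\<Sum>k\<in>{i, j}. bary k z)" using that(3) by simp
    also have "\<dots> \<le> (\<Sum>k\<in>UNIV. bary k z)"
      using that(1) by (intro sum_mono2) (auto simp: z_def bary_nonneg)
    finally have "bary i z + bary j z \<le> 1" by (simp add: sum_bary)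
    moreover have "bary i x \<ge> 0" "bary j y \<ge> 0" "bary j x \<le> 1"
      using that by (auto simp: bary_nonneg bary_le_1)
    ultimately have "bary j x = bary j y + 1" using 1(2) 2 by simp
    then have "bary j x = 1" using bary_le_1[OF that(1), of j] \<open>bary j y \<ge> 0\<close> by linarith
    then show ?thesis using that bary_1_iff by blast
  qed
  show ?thesis using *[OF assms] *[of y x j i] assms by auto
qed

lemma contr_eq_vtx: "x \<in> SG \<Longrightarrow> contr i x = vtx j \<longleftrightarrow> i = j \<and> x = vtx j"
  using cells_meet[of x "vtx j" i j] inj_contr[of j x "vtx j"] vtx_inj[of i j] by auto

lemma contr_vtx_SG [simp]: "contr i (vtx j) \<in> SG" by auto

lemma word_map_replicate: "word_map (replicate m i) x = (contr i ^^ m) x"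
  by (induction m) auto

lemma word_map_SG [intro, simp]: "x \<in> SG \<Longrightarrow> word_map w x \<in> SG"
  by (induction w) auto

lemma funpow_contr_SG [intro, simp]: "x \<in> SG \<Longrightarrow> (contr i ^^ m) x \<in> SG"
  using word_map_SG[of x "replicate m i"] by (simp add: word_map_replicate)

lemma dist_word_map: "dist (word_map w x) (word_map w y) = dist x y / 2 ^ length w"
  by (induction w) (auto simp: dist_contr)

lemma continuous_on_word_map [continuous_intros]: "continuous_on A (word_map w)"
proof (induction w arbitrary: A)
  case (Cons i w)
  then show ?case using continuous_on_compose[OF Cons continuous_on_contr] by (simp add: comp_def)
qed (simp add: continuous_on_id)

lemma SG_word: "x \<in> SG \<Longrightarrow> \<exists>w y. length w = m \<and> y \<in> SG \<and> x = word_map w y"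
proof (induction m arbitrary: x)
  case 0 then show ?case by auto
next
  case (Suc m)
  then obtain i y where "y \<in> SG" "x = contr i y" by (auto elim: SG_cases)
  moreover obtain w z where "length w = m \<and> z \<in> SG \<and> y = word_map w z" using Suc.IH[OF \<open>y \<in> SG\<close>] by auto
  ultimately show ?case by (intro exI[of _ "i # w"] exI[of _ z]) auto
qed

lemma small_words:
  assumes "e > 0" shows "\<exists>m. \<forall>w x y. length w \<ge> m \<longrightarrow> x \<in> SG \<longrightarrow> y \<in> SG \<longrightarrow> dist (word_map w x) (word_map w y) < e"
proof -
  obtain B where B: "\<And>x y. x \<in> SG \<Longrightarrow> y \<in> SG \<Longrightarrow> dist x y \<le> B"
    using compact_imp_bounded[OF compact_SG] bounded_two_points by metis
  obtain m where m: "(1 / 2) ^ m * B < e"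
  proof -
    have "(\<lambda>m. (1 / 2) ^ m * B) \<longlonglongrightarrow> 0"
      by (intro tendsto_mult_left_zero LIMSEQ_power_zero) auto
    then have "eventually (\<lambda>m. (1 / 2) ^ m * B < e) sequentially"
      using assms by (intro order_tendstoD(2)[of _ 0]) auto
    then show ?thesis using that by (auto dest: eventually_happens)
  qed
  show ?thesis
  proof (intro exI[of _ m] allI impI)
    fix w x y assume a: "length (w :: 3 list) \<ge> m" "x \<in> SG" "y \<in> SG"
    have "B \<ge> 0" using B[of "vtx 0" "vtx 0"] by simp
    have "dist (word_map w x) (word_map w y) = (1 / 2) ^ length w * dist x y"
      by (simp add: dist_word_map field_simps)
    also have "\<dots> \<le> (1 / 2) ^ m * B"
      using a B[OF a(2,3)] \<open>B \<ge> 0\<close> by (intro mult_mono power_decreasing) auto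
    also note m
    finally show "dist (word_map w x) (word_map w y) < e" .
  qed
qed

lemma cell_in_ball:
  assumes "x \<in> SG" "e > 0" obtains w where "x \<in> cell w" "\<And>y. y \<in> cell w \<Longrightarrow> dist x y < e" "cell w \<subseteq> SG"
proof -
  obtain m where m: "\<forall>w x y. length w \<ge> m \<longrightarrow> x \<in> SG \<longrightarrow> y \<in> SG \<longrightarrow> dist (word_map w x) (word_map w y) < e"
    using small_words[OF assms(2)] by auto
  obtain w y where "length w = m" "y \<in> SG" "x = word_map w y" using SG_word[OF assms(1)] by metis
  then show ?thesis using m by (intro that[of w]) (auto simp: cell_def)
qed

text \<open>The points \<open>word_map w (vtx 0)\<close> are dense because every point lies in
  arbitrarily small cells. Through this lemma and \<open>eq_on_SG\<close>, statements about
  continuous functions reduce to inductions on words.\<close>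

lemma SG_subset_closed:
  assumes "closed A" "\<And>w. word_map w (vtx 0) \<in> A"
  shows "SG \<subseteq> A"
proof
  fix x assume x: "x \<in> SG"
  have "x \<in> closure A"
    unfolding closure_approachable
  proof (intro allI impI)
    fix e :: real assume "e > 0"
    then obtain w where w: "x \<in> cell w" "\<And>y. y \<in> cell w \<Longrightarrow> dist x y < e" using cell_in_ball[OF x] by metis
    have "word_map w (vtx 0) \<in> cell w" by (auto simp: cell_def)
    then show "\<exists>y\<in>A. dist y x < e" using w assms(2) by (auto simp: dist_commute)
  qed
  then show "x \<in> A" using assms(1) by simp
qed

lemma eq_on_SG:
  assumes "continuous_on SG u" "continuous_on SG v"
    and "\<And>w. u (word_map w (vtx 0)) = v (word_map w (vtx 0) :: real ^ 2)"
    and "x \<in> SG"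
  shows "u x = (v x :: real)"
proof -
  have "closed {x \<in> SG. u x - v x = 0}"
    using closed_SG assms(1,2) by (intro continuous_closed_preimage_constant continuous_intros)
  then have "SG \<subseteq> {x \<in> SG. u x - v x = 0}" using assms(3) by (intro SG_subset_closed) auto
  then show ?thesis using assms(4) by auto
qed

lemma V_0: "V 0 = range vtx" by (auto simp: V_def)

lemma V_Suc: "V (Suc m) = (\<Union>i. contr i ` V m)"
proof -
  have "{w::3 list. length w = Suc m} = (\<Union>i. (\<lambda>w. i # w) ` {w. length w = m})"
    by (auto simp: length_Suc_conv)
  then show ?thesis by (auto simp: V_def image_image)
qed

lemma finite_V: "finite (V m)"
  by (induction m) (auto simp: V_0 V_Suc)

lemma V_SG: "V m \<subseteq> SG"
  by (induction m) (auto simp: V_0 V_Suc)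

lemma vtx_V: "vtx i \<in> V m"
proof (induction m)
  case (Suc m)
  then have "contr i (vtx i) \<in> V (Suc m)" unfolding V_Suc by blast
  then show ?case by simp
qed (simp add: V_0)

subsection \<open>Gluing\<close>

definition unc :: "3 \<Rightarrow> real ^ 2 \<Rightarrow> real ^ 2" where
  "unc i x = 2 *\<^sub>R x - vtx i"

lemma unc_contr [simp]: "unc i (contr i x) = x"
  by (simp add: unc_def contr_def scaleR_add_right scaleR_2)

text \<open>At a junction the first case that applies decides; \<open>glue_contr\<close> shows that
  the choice is immaterial once the pieces agree there.\<close>

definition glue :: "(3 \<Rightarrow> real ^ 2 \<Rightarrow> real) \<Rightarrow> real ^ 2 \<Rightarrow> real" where
  "glue g x = (if x \<in> contr 0 ` SG then g 0 (unc 0 x) else if x \<in> contr 1 ` SG then g 1 (unc 1 x)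
     else g 2 (unc 2 x))"

lemma glue_contr:
  assumes "\<And>i j. i \<noteq> j \<Longrightarrow> g i (vtx j) = g j (vtx i)" "x \<in> SG"
  shows "glue g (contr i x) = g i x"
proof -
  have *: "g j (unc j (contr i x)) = g i x" if m: "contr i x \<in> contr j ` SG" for j
  proof (cases "i = j")
    case False
    obtain y where y: "y \<in> SG" "contr i x = contr j y" using m by (rule imageE)
    show ?thesis using cells_meet[OF assms(2) y(1) False y(2)] assms(1)[OF False] unfolding y(2) by simp
  qed simp
  have "contr i x \<in> contr i ` SG" using assms by auto
  then show ?thesis using exh_3[of i] * unfolding glue_def by auto
qed

lemma continuous_on_pieces:
  assumes "\<And>i. continuous_on SG (\<lambda>x. g (contr i x))"
  shows "continuous_on SG (g :: real ^ 2 \<Rightarrow> real)"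
proof -
  have "continuous_on (\<Union>i. contr i ` SG) g"
  proof (rule continuous_on_closed_Union)
    show "closed (contr i ` SG)" for i
      by (intro compact_imp_closed compact_continuous_image continuous_intros compact_SG)
    show "continuous_on (contr i ` SG) g" for i
    proof -
      have "continuous_on (contr i ` SG) (\<lambda>x. g (contr i (unc i x)))"
      proof (rule continuous_on_compose2[OF assms])
        show "continuous_on (contr i ` SG) (unc i)" unfolding unc_def by (intro continuous_intros)
      qed auto
      then show ?thesis by (rule continuous_on_eq) auto
    qed
  qed auto
  then show ?thesis by (simp flip: SG_eq)
qed

lemma continuous_on_glue:
  assumes "\<And>i j. i \<noteq> j \<Longrightarrow> g i (vtx j) = g j (vtx i)" "\<And>i. continuous_on SG (g i)"
  shows "continuous_on SG (glue g)"
proof (rule continuous_on_pieces)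
  fix i show "continuous_on SG (\<lambda>x. glue g (contr i x))"
    using assms(2)[of i] by (rule continuous_on_eq) (auto simp: glue_contr assms(1))
qed

lemma continuous_on_SG_contr:
  "continuous_on SG u \<Longrightarrow> continuous_on SG (\<lambda>x. u (contr i x) :: real)"
  by (rule continuous_on_compose2[of SG u]) (auto intro!: continuous_intros)

lemma continuous_on_SG_word_map:
  "continuous_on SG u \<Longrightarrow> continuous_on SG (\<lambda>x. u (word_map w x) :: real)"
  by (rule continuous_on_compose2[of SG u]) (auto intro!: continuous_intros)

lemma bounded_on_SG:
  assumes "continuous_on SG (u :: real ^ 2 \<Rightarrow> real)"
  obtains B where "B \<ge> 0" "\<And>x. x \<in> SG \<Longrightarrow> \<bar>u x\<bar> \<le> B"
proof -
  have "bounded (u ` SG)" using compact_continuous_image[OF assms compact_SG] by (rule compact_imp_bounded)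
  then obtain B where "\<forall>x\<in>SG. \<bar>u x\<bar> \<le> B" by (auto simp: bounded_iff)
  moreover have "B \<ge> 0" using calculation vtx_SG[of 0] by (meson abs_ge_zero order_trans)
  ultimately show ?thesis using that by blast
qed

subsection \<open>Reflections\<close>

text \<open>The reflection permuting the vertices by the transposition \<open>j \<mapsto> c - j\<close> of \<open>\<int>/3\<close>.\<close>

definition reflect :: "3 \<Rightarrow> real ^ 2 \<Rightarrow> real ^ 2" where
  "reflect c x = (\<Sum>j\<in>UNIV. bary j x *\<^sub>R vtx (c - j))"

lemma bary_combination:
  assumes "(\<Sum>j\<in>UNIV. a j) = (1::real)"
  shows "bary i (\<Sum>j\<in>UNIV. a j *\<^sub>R vtx j) = a i"
proof -
  have "a 0 + a 1 + a 2 = 1" using assms by (simp add: sum_UNIV_3)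
  then show ?thesis using exh_3[of i]
    by (elim disjE) (simp_all add: bary_def sum_UNIV_3 vtx_def algebra_simps)
qed

lemma sum_reflect: "(\<Sum>j\<in>UNIV. g (c - j)) = (\<Sum>j\<in>UNIV. g (j::3))"
  by (rule sum.reindex_bij_witness[of _ "\<lambda>j. c - j" "\<lambda>j. c - j"]) auto

lemma UN_reflect: "(\<Union>i::3. g (c - i)) = (\<Union>i. g i)"
proof (intro subset_antisym UN_least)
  fix i show "g i \<subseteq> (\<Union>i. g (c - i))" using UN_upper[of "c - i" UNIV "\<lambda>i. g (c - i)"] by simp
qed auto

lemma minus_index_eq_iff: "(c::3) - j = i \<longleftrightarrow> j = c - i"
  by (auto simp: diff_eq_eq eq_diff_eq add.commute)

lemma bary_reflect: "bary i (reflect c x) = bary (c - i) x"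
proof -
  have "reflect c x = (\<Sum>j\<in>UNIV. bary (c - j) x *\<^sub>R vtx j)"
    unfolding reflect_def
    using sum_reflect[of "\<lambda>j. bary j x *\<^sub>R vtx (c - j)" c] by simp
  moreover have "(\<Sum>j\<in>UNIV. bary (c - j) x) = 1" using sum_reflect[of "\<lambda>j. bary j x" c] by (simp add: sum_bary)
  ultimately show ?thesis using bary_combination[of "\<lambda>j. bary (c - j) x"] by simp
qed

lemma reflect_reflect [simp]: "reflect c (reflect c x) = x"
  by (rule bary_eqI) (simp add: bary_reflect)

lemma reflect_vtx [simp]: "reflect c (vtx i) = vtx (c - i)"
proof (rule bary_eqI)
  fix j show "bary j (reflect c (vtx i)) = bary j (vtx (c - i))"
    unfolding bary_reflect bary_vtx by (simp add: minus_index_eq_iff)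
qed

lemma reflect_contr: "reflect c (contr i x) = contr (c - i) (reflect c x)"
proof (rule bary_eqI)
  fix j show "bary j (reflect c (contr i x)) = bary j (contr (c - i) (reflect c x))"
    unfolding bary_reflect bary_contr by (simp add: minus_index_eq_iff)
qed

lemma continuous_on_reflect [continuous_intros]: "continuous_on A (reflect c)"
  unfolding reflect_def by (intro continuous_intros)

text \<open>A reflection permutes the contractions, so the reflected gasket is again a nonempty
  compact fixed set of \<open>hutch\<close>, and the comparison of fixed sets applies.\<close>

lemma reflect_SG [simp, intro]:
  assumes "x \<in> SG" shows "reflect c x \<in> SG"
proof -
  have "reflect c ` SG = hutch (reflect c ` SG)"
  proof -
    have "reflect c ` SG = reflect c ` (\<Union>i. contr i ` SG)" by (simp flip: SG_eq)
    also have "\<dots> = (\<Union>i. contr (c - i) ` reflect c ` SG)" by (auto simp: reflect_contr image_UN image_image)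
    also have "\<dots> = hutch (reflect c ` SG)" 
      unfolding hutch_def by (rule UN_reflect[of "\<lambda>i. contr i ` reflect c ` SG"])
    finally show ?thesis .
  qed
  moreover have "compact (reflect c ` SG)" by (intro compact_continuous_image continuous_intros compact_SG)
  moreover have "SG = hutch SG" unfolding hutch_def by (rule SG_eq)
  ultimately have "reflect c ` SG \<subseteq> SG" using compact_SG SG_nonempty by (intro hutch_fixed_le) auto
  then show ?thesis using assms by auto
qed

lemma continuous_on_SG_reflect:
  "continuous_on SG u \<Longrightarrow> continuous_on SG (\<lambda>x. u (reflect c x) :: real)"
  by (rule continuous_on_compose2[of SG u]) (auto intro!: continuous_intros)

section \<open>The self-similar measure\<close>

text \<open>Independent uniform digits. The self-similar measure is obtained as the law of the point
  with these digits as its address (\<open>code\<close>); splitting off the first digit gives the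
  self-similarity.\<close>

definition digits :: "3 stream measure" where
  "digits = stream_space (measure_pmf (pmf_of_set UNIV))"

definition code :: "3 stream \<Rightarrow> real ^ 2" where
  "code s = (\<Sum>k. (1 / 2) ^ Suc k *\<^sub>R vtx (s !! k))"

definition code_measure :: "(real ^ 2) measure" where
  "code_measure = distr digits (restrict_space borel SG) code"

lemma summable_code: "summable (\<lambda>k. (1 / 2) ^ Suc k *\<^sub>R vtx (s k))"
proof (rule summable_comparison_test)
  define B where "B = Max (range (\<lambda>i. norm (vtx i)))"
  have B: "norm (vtx i) \<le> B" for i by (simp add: B_def)
  show "\<exists>N. \<forall>n\<ge>N. norm ((1 / 2) ^ Suc n *\<^sub>R vtx (s n)) \<le> (1 / 2) ^ n * B"
  proof (intro exI allI impI)
    fix n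
    have "norm ((1 / 2) ^ Suc n *\<^sub>R vtx (s n)) \<le> (1 / 2) ^ n * norm (vtx (s n))" by simp
    also have "\<dots> \<le> (1 / 2) ^ n * B" using B by (intro mult_left_mono) auto
    finally show "norm ((1 / 2) ^ Suc n *\<^sub>R vtx (s n)) \<le> (1 / 2) ^ n * B" .
  qed
  show "summable (\<lambda>n. (1 / 2) ^ n * B)" by (intro summable_mult2 summable_geometric) simp
qed

lemma code_Stream: "code (i ## s) = contr i (code s)"
proof -
  have "code (i ## s) = (1 / 2) *\<^sub>R vtx i + (\<Sum>k. (1 / 2) ^ Suc (Suc k) *\<^sub>R vtx (s !! k))"
    using suminf_split_head[OF summable_code[of "snth (i ## s)"]] by (simp add: code_def)
  also have "(\<Sum>k. (1 / 2) ^ Suc (Suc k) *\<^sub>R vtx (s !! k)) = (1 / 2) *\<^sub>R code s"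
    using suminf_scaleR_right[OF summable_code, of "1 / 2" "snth s"]
    by (simp only: code_def power_Suc scaleR_scaleR mult.assoc)
  finally show ?thesis by (simp add: contr_affine)
qed

lemma code_shift: "code (w @- s) = word_map w (code s)"
  by (induction w) (auto simp: code_Stream)

lemma code_SG: "code s \<in> SG"
proof -
  define B where "B = Max (range (\<lambda>i. norm (vtx i)))"
  have B: "norm (vtx i) \<le> B" for i by (simp add: B_def)
  have bd: "norm (code s) \<le> B" for s
  proof -
    have "norm (code s) \<le> (\<Sum>k. (1 / 2) ^ Suc k * B)"
      unfolding code_def
    proof (rule norm_suminf_le)
      fix n
      show "norm ((1 / 2) ^ Suc n *\<^sub>R vtx (s !! n)) \<le> (1 / 2) ^ Suc n * B"
        using B by (simp add: mult_left_mono divide_right_mono)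
      show "summable (\<lambda>k. (1 / 2) ^ Suc k * B)"
        by (intro summable_mult2 sums_summable[OF power_half_series])
    qed
    also have "\<dots> = B"
      using sums_mult2[OF power_half_series, of B] by (simp add: sums_iff)
    finally show ?thesis .
  qed
  have d: "dist (word_map (stake n s) (vtx 0)) (code s) \<le> 2 * B * (1 / 2) ^ n" for n
  proof -
    have "dist (word_map (stake n s) (vtx 0)) (code s)
        = dist (word_map (stake n s) (vtx 0)) (word_map (stake n s) (code (sdrop n s)))"
      using code_shift[of "stake n s" "sdrop n s"] by (simp add: stake_sdrop)
    also have "\<dots> = dist (vtx 0) (code (sdrop n s)) * (1 / 2) ^ n"
      by (simp add: dist_word_map power_divide)
    also have "dist (vtx 0) (code (sdrop n s)) \<le> 2 * B"
      using norm_triangle_ineq4[of "vtx 0" "code (sdrop n s)"] B[of 0] bd[of "sdrop n s"]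
      by (simp add: dist_norm)
    finally show ?thesis by simp
  qed
  have "(\<lambda>n. 2 * B * (1 / 2) ^ n) \<longlonglongrightarrow> 0"
    by (intro tendsto_mult_right_zero LIMSEQ_power_zero) auto
  then have "(\<lambda>n. word_map (stake n s) (vtx 0)) \<longlonglongrightarrow> code s"
    unfolding tendsto_dist_iff[of _ "code s"]
    by (rule tendsto_sandwich[OF _ _ tendsto_const, rotated -1]) (auto intro: always_eventually d)
  then show ?thesis
    using closed_sequentially[OF closed_SG, of "\<lambda>n. word_map (stake n s) (vtx 0)"] by auto
qed

lemma prob_space_digits: "prob_space digits"
  unfolding digits_def by (rule prob_space.prob_space_stream_space) (rule prob_space_measure_pmf)

lemma measurable_code [measurable]: "code \<in> measurable digits (restrict_space borel SG)"
proof (rule measurable_restrict_space2)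
  show "code \<in> space digits \<rightarrow> SG" using code_SG by auto
  have [measurable]: "(\<lambda>s. s !! n) \<in> measurable digits (count_space UNIV)" for n
    unfolding digits_def by (rule measurable_compose[OF measurable_snth]) simp
  show "code \<in> borel_measurable digits"
    unfolding code_def by measurable
qed

lemma sets_code_measure: "sets code_measure = sets (restrict_space borel SG)"
  by (simp add: code_measure_def)

lemma space_code_measure: "space code_measure = SG"
  by (simp add: code_measure_def space_restrict_space)

lemma prob_space_code_measure: "prob_space code_measure"
  unfolding code_measure_def using prob_space_digits measurable_code by (rule prob_space.prob_space_distr)

lemma measurable_contr_SG [measurable]:
  "contr i \<in> measurable (restrict_space borel SG) (restrict_space borel SG)"
  by (rule measurable_restrict_space3) (auto intro!: borel_measurable_continuous_onI continuous_on_contr)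

lemma nn_integral_code_measure:
  assumes [measurable]: "g \<in> borel_measurable (restrict_space borel SG)"
  shows "(\<integral>\<^sup>+x. g x \<partial>code_measure) = (\<Sum>i\<in>UNIV. (\<integral>\<^sup>+x. g (contr i x) \<partial>code_measure)) / 3"
proof -
  have "(\<integral>\<^sup>+x. g x \<partial>code_measure) = (\<integral>\<^sup>+s. g (code s) \<partial>digits)"
    unfolding code_measure_def by (rule nn_integral_distr) measurable
  also have "\<dots> = (\<integral>\<^sup>+i. (\<integral>\<^sup>+s. g (code (i ## s)) \<partial>digits) \<partial>measure_pmf (pmf_of_set UNIV))"
    unfolding digits_def
    by (rule prob_space.nn_integral_stream_space[OF prob_space_measure_pmf])
      (rule measurable_compose[OF measurable_code[unfolded digits_def] assms])
  also have "\<dots> = (\<integral>\<^sup>+i. (\<integral>\<^sup>+x. g (contr i x) \<partial>code_measure) \<partial>measure_pmf (pmf_of_set UNIV))"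
    unfolding code_measure_def code_Stream by (subst nn_integral_distr) measurable
  also have "\<dots> = (\<Sum>i\<in>UNIV. (\<integral>\<^sup>+x. g (contr i x) \<partial>code_measure)) / 3"
    by (subst nn_integral_pmf_of_set) auto
  finally show ?thesis .
qed

lemma measure_code_measure:
  assumes A: "A \<in> sets (restrict_space borel SG)"
  shows "measure code_measure A = (\<Sum>i\<in>UNIV. measure code_measure (contr i -` A \<inter> SG)) / 3"
proof -
  interpret prob_space code_measure by (rule prob_space_code_measure)
  have pre: "contr i -` A \<inter> SG \<in> sets (restrict_space borel SG)" for i
    using measurable_sets[OF measurable_contr_SG[of i] A] by (simp add: space_restrict_space)
  have ind: "(\<integral>\<^sup>+x. indicator A (contr i x) \<partial>code_measure) = emeasure code_measure (contr i -` A \<inter> SG)" for i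
  proof -
    have "(\<integral>\<^sup>+x. indicator A (contr i x) \<partial>code_measure) = (\<integral>\<^sup>+x. indicator (contr i -` A \<inter> SG) x \<partial>code_measure)"
      by (rule nn_integral_cong) (auto simp: space_code_measure indicator_def)
    then show ?thesis using pre by (simp add: sets_code_measure)
  qed
  have "emeasure code_measure A = (\<integral>\<^sup>+x. indicator A x \<partial>code_measure)"
    using A by (subst nn_integral_indicator) (simp_all add: sets_code_measure)
  also have "\<dots> = (\<Sum>i\<in>UNIV. (\<integral>\<^sup>+x. indicator A (contr i x) \<partial>code_measure)) / 3"
    using A by (intro nn_integral_code_measure) auto
  also have "\<dots> = (\<Sum>i\<in>UNIV. emeasure code_measure (contr i -` A \<inter> SG)) / 3" by (simp add: ind)
  finally have "ennreal (measure code_measure A) = ennreal ((\<Sum>i\<in>UNIV. measure code_measure (contr i -` A \<inter> SG)) / 3)"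
    unfolding emeasure_eq_measure
    by (simp add: sum_nonneg divide_ennreal flip: ennreal_numeral)
  then show ?thesis by (simp add: sum_nonneg)
qed

lemma SG_subset_sets: "closed A \<Longrightarrow> A \<subseteq> SG \<Longrightarrow> A \<in> sets (restrict_space borel SG)"
  using closed_SG by (auto simp: sets_restrict_space_iff borel_closed)

lemma closed_cell: "closed (cell w)"
  unfolding cell_def by (intro compact_imp_closed compact_continuous_image continuous_intros compact_SG)

lemma cell_SG: "cell w \<subseteq> SG"
  by (auto simp: cell_def)

lemma cell_Cons: "cell (i # w) = contr i ` cell w"
  by (auto simp: cell_def)

lemma cell_sets: "cell w \<in> sets (restrict_space borel SG)"
  by (rule SG_subset_sets[OF closed_cell cell_SG])

text \<open>Only the contraction \<open>i\<close> reaches \<open>vtx i\<close>, and it fixes it, so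
  self-similarity makes the mass of this point a third of itself.\<close>

lemma code_measure_vtx: "measure code_measure {vtx i} = 0"
proof -
  interpret prob_space code_measure by (rule prob_space_code_measure)
  have "contr j -` {vtx i} \<inter> SG = (if j = i then {vtx i} else {})" for j
    by (auto simp: contr_eq_vtx)
  then have "measure code_measure {vtx i} = (\<Sum>j\<in>UNIV. measure code_measure (if j = i then {vtx i} else {})) / 3"
    using measure_code_measure[OF SG_subset_sets[of "{vtx i}"]] by simp
  also have "\<dots> = measure code_measure {vtx i} / 3"
    by (simp add: if_distrib cong: if_cong)
  finally show ?thesis by simp
qed

lemma code_measure_cell: "measure code_measure (cell w) = (1 / 3) ^ length w"
proof (induction w)
  case Nil
  then show ?case using prob_space.prob_space[OF prob_space_code_measure]
    by (simp add: space_code_measure cell_def)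
next
  case (Cons i w)
  interpret prob_space code_measure by (rule prob_space_code_measure)
  have "measure code_measure (contr j -` cell (i # w) \<inter> SG) = (if j = i then (1 / 3) ^ length w else 0)" for j
  proof (cases "j = i")
    case True
    have "contr i -` cell (i # w) \<inter> SG = cell w"
      using cell_SG[of w] by (auto simp: cell_Cons inj_contr)
    then show ?thesis using True Cons by simp
  next
    case False
    have "contr j -` cell (i # w) \<inter> SG \<subseteq> {vtx i}"
      using cells_meet[of _ _ j i] False cell_SG[of w] by (auto simp: cell_Cons)
    then have "measure code_measure (contr j -` cell (i # w) \<inter> SG) \<le> measure code_measure {vtx i}"
      using SG_subset_sets[of "{vtx i}"] by (intro finite_measure_mono) (auto simp: sets_code_measure)
    then show ?thesis using code_measure_vtx[of i] measure_nonneg[of code_measure] False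
      by (simp add: order_antisym)
  qed
  then show ?case using measure_code_measure[OF cell_sets] by simp
qed

text \<open>Cells that are not nested share at most one point. Adding the singletons and the empty
  set thus turns the cells into a generator closed under intersection, as the uniqueness theorem for
  measures requires.\<close>

lemma cell_Int: "cell v \<inter> cell w = {} \<or> (\<exists>x\<in>SG. cell v \<inter> cell w = {x}) \<or> (\<exists>u. cell v \<inter> cell w = cell u)"
proof (induction v arbitrary: w)
  case Nil
  then show ?case using cell_SG[of w] by (auto simp: cell_def)
next
  case (Cons i v)
  show ?case
  proof (cases w)
    case Nil
    then have "cell (i # v) \<inter> cell w = cell (i # v)" using cell_SG[of "i # v"] by (auto simp: cell_def)
    then show ?thesis by blast
  next
    case w: (Cons j w')
    show ?thesis
    proof (cases "i = j")
      case True
      have *: "cell (i # v) \<inter> cell w = contr i ` (cell v \<inter> cell w')"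
        unfolding w cell_Cons True by (auto simp: inj_contr)
      show ?thesis
        using Cons[of w'] unfolding * cell_Cons[symmetric]
      proof (elim disjE bexE exE)
        fix x assume "x \<in> SG" "cell v \<inter> cell w' = {x}"
        then show "contr i ` (cell v \<inter> cell w') = {} \<or> (\<exists>x\<in>SG. contr i ` (cell v \<inter> cell w') = {x}) \<or> (\<exists>u. contr i ` (cell v \<inter> cell w') = cell u)"
          by auto
      next
        fix u assume "cell v \<inter> cell w' = cell u"
        then have "contr i ` (cell v \<inter> cell w') = cell (i # u)" by (simp add: cell_Cons)
        then show "contr i ` (cell v \<inter> cell w') = {} \<or> (\<exists>x\<in>SG. contr i ` (cell v \<inter> cell w') = {x}) \<or> (\<exists>u. contr i ` (cell v \<inter> cell w') = cell u)"
          by blast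
      qed auto
    next
      case False
      have "cell (i # v) \<inter> cell w \<subseteq> {contr i (vtx j)}"
        unfolding w cell_Cons using cells_meet[of _ _ i j] False cell_SG by blast
      then have "cell (i # v) \<inter> cell w = {} \<or> cell (i # v) \<inter> cell w = {contr i (vtx j)}" by blast
      then show ?thesis using contr_vtx_SG by blast
    qed
  qed
qed

section \<open>Uniqueness of the self-similar measure\<close>

definition SG_gen :: "(real ^ 2) set set" where
  "SG_gen = range cell \<union> (\<lambda>x. {x}) ` SG \<union> {{}}"

lemma sets_SG_gen: "sets (restrict_space borel SG) = sigma_sets SG SG_gen"
proof (rule subset_antisym)
  have "SG_gen \<subseteq> sets (restrict_space borel SG)"
    using cell_sets SG_subset_sets by (auto simp: SG_gen_def)
  then show "sigma_sets SG SG_gen \<subseteq> sets (restrict_space borel SG)"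
    using sets.sigma_sets_subset[of SG_gen "restrict_space borel SG"] by (simp add: space_restrict_space)
  have "SG \<inter> U \<in> sigma_sets SG SG_gen" if U: "open U" for U
  proof -
    have "SG \<inter> U = (\<Union>w\<in>{w. cell w \<subseteq> U}. cell w)"
    proof (intro subset_antisym subsetI)
      fix x assume x: "x \<in> SG \<inter> U"
      then obtain e where e: "e > 0" "ball x e \<subseteq> U" using U by (meson IntD2 openE)
      obtain w where w: "x \<in> cell w" "\<And>y. y \<in> cell w \<Longrightarrow> dist x y < e"
        using cell_in_ball[OF IntD1[OF x] e(1)] by metis
      have "cell w \<subseteq> ball x e" using w(2) by auto
      then have "cell w \<subseteq> U" using e(2) by (rule subset_trans)
      with w(1) show "x \<in> (\<Union>w\<in>{w. cell w \<subseteq> U}. cell w)" by blast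
    qed (use cell_SG in blast)
    also have "\<dots> \<in> sigma_sets SG SG_gen"
      by (intro sigma_sets_UNION) (auto simp: SG_gen_def)
    finally show ?thesis .
  qed
  then have *: "(\<inter>) SG ` {U. open U} \<subseteq> sigma_sets SG SG_gen" by auto
  have "SG \<in> sigma_sets UNIV {U. open U}" using borel_closed[OF closed_SG] by (simp only: sets_borel)
  then have "sets (restrict_space borel SG) = sigma_sets SG ((\<inter>) SG ` {U. open U})"
    unfolding sets_restrict_space sets_borel by (rule sigma_sets_Int) simp
  then show "sets (restrict_space borel SG) \<subseteq> sigma_sets SG SG_gen"
    using sigma_sets_mono[OF *] by (simp only:)
qed

lemma Int_stable_SG_gen: "Int_stable SG_gen"
proof (rule Int_stableI)
  fix a b assume "a \<in> SG_gen" "b \<in> SG_gen"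
  then show "a \<inter> b \<in> SG_gen"
    unfolding SG_gen_def
  proof (elim UnE imageE)
    fix v w assume "a = cell v" "b = cell w"
    then show "a \<inter> b \<in> range cell \<union> (\<lambda>x. {x}) ` SG \<union> {{}}" using cell_Int[of v w] by (elim disjE bexE exE) auto
  qed (auto simp: Int_insert_left Int_insert_right)
qed

definition SG_measure_spec :: "(real ^ 2) measure \<Rightarrow> bool" where
  "SG_measure_spec M \<longleftrightarrow> sets M = sets (restrict_space borel SG) \<and> prob_space M \<and>
     (\<forall>A\<in>sets M. measure M A = (\<Sum>i\<in>UNIV. measure M (contr i -` A \<inter> SG)) / 3) \<and>
     (\<forall>w. measure M (cell w) = (1 / 3) ^ length w)"

text \<open>Every point lies in cells of mass \<open>(1 / 3) ^ n\<close> for all \<open>n\<close>.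
  Singletons belong to the generator \<open>SG_gen\<close>, so two candidate measures have to be
  compared on them as well.\<close>

lemma SG_measure_spec_point:
  assumes "SG_measure_spec M" "x \<in> SG"
  shows "measure M {x} = 0"
proof -
  interpret prob_space M using assms(1) by (simp add: SG_measure_spec_def)
  have "measure M {x} \<le> (1 / 3) ^ n" for n
  proof -
    obtain w y where w: "length w = n" "y \<in> SG" "x = word_map w y" using SG_word[OF assms(2)] by metis
    then have "{x} \<subseteq> cell w" by (auto simp: cell_def)
    then have "measure M {x} \<le> measure M (cell w)"
      using assms(1) cell_sets by (intro finite_measure_mono) (auto simp: SG_measure_spec_def)
    then show ?thesis using assms(1) w by (simp add: SG_measure_spec_def)
  qed
  moreover have "(\<lambda>n. (1 / 3 :: real) ^ n) \<longlonglongrightarrow> 0" by (rule LIMSEQ_power_zero) simp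
  ultimately have "measure M {x} \<le> 0" by (intro LIMSEQ_le_const[of "\<lambda>n. (1 / 3) ^ n"]) auto
  then show ?thesis using measure_nonneg[of M "{x}"] by linarith
qed

lemma SG_measure_spec_unique:
  assumes "SG_measure_spec M" "SG_measure_spec N"
  shows "M = N"
proof (rule measure_eqI_generator_eq[OF Int_stable_SG_gen])
  interpret M: prob_space M using assms(1) by (simp add: SG_measure_spec_def)
  interpret N: prob_space N using assms(2) by (simp add: SG_measure_spec_def)
  show "SG_gen \<subseteq> Pow SG" using cell_SG by (auto simp: SG_gen_def)
  show "sets M = sigma_sets SG SG_gen" "sets N = sigma_sets SG SG_gen"
    using assms by (simp_all add: SG_measure_spec_def flip: sets_SG_gen)
  show "emeasure M X = emeasure N X" if "X \<in> SG_gen" for X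
    using that assms SG_measure_spec_point[OF assms(1)] SG_measure_spec_point[OF assms(2)]
    unfolding M.emeasure_eq_measure N.emeasure_eq_measure
    by (auto simp: SG_gen_def SG_measure_spec_def)
  show "range (\<lambda>n::nat. SG) \<subseteq> SG_gen"
  proof -
    have "SG = cell []" by (simp add: cell_def)
    then show ?thesis unfolding SG_gen_def by blast
  qed
  show "(\<Union>n::nat. SG) = SG" by simp
  show "emeasure M SG \<noteq> \<infinity>" by simp
qed

lemma SG_measure_eq: "SG_measure = code_measure"
proof -
  have "SG_measure_spec code_measure"
    using sets_code_measure prob_space_code_measure measure_code_measure code_measure_cell
    by (simp add: SG_measure_spec_def)
  then show ?thesis
    using SG_measure_spec_unique unfolding SG_measure_def SG_measure_spec_def[symmetric]
    by (intro the_equality) auto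
qed

lemma prob_space_SG_measure: "prob_space SG_measure"
  using prob_space_code_measure by (simp add: SG_measure_eq)

lemma space_SG_measure: "space SG_measure = SG"
  by (simp add: SG_measure_eq space_code_measure)

section \<open>Integration over the gasket\<close>

definition sgi :: "(real ^ 2 \<Rightarrow> real) \<Rightarrow> real" where
  "sgi g = (LINT x|SG_measure. g x)"

lemma measurable_cont_SG:
  assumes "continuous_on SG (g :: real ^ 2 \<Rightarrow> real)"
  shows "g \<in> borel_measurable (restrict_space borel SG)"
  using assms by (rule borel_measurable_continuous_on_restrict)

lemma integrable_cont:
  assumes "continuous_on SG (g :: real ^ 2 \<Rightarrow> real)"
  shows "integrable SG_measure g"
proof -
  interpret prob_space SG_measure by (rule prob_space_SG_measure)
  obtain B where "\<And>x. x \<in> SG \<Longrightarrow> \<bar>g x\<bar> \<le> B" using bounded_on_SG[OF assms] by blast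
  moreover have "g \<in> borel_measurable SG_measure"
    using measurable_cont_SG[OF assms] by (simp add: SG_measure_eq sets_code_measure cong: measurable_cong_sets)
  ultimately show ?thesis
    by (intro integrable_const_bound[of _ B]) (auto simp: space_SG_measure)
qed

lemma sgi_cong: "(\<And>x. x \<in> SG \<Longrightarrow> f x = g x) \<Longrightarrow> sgi f = sgi g"
  unfolding sgi_def by (rule Bochner_Integration.integral_cong) (auto simp: space_SG_measure)

lemma sgi_add: "continuous_on SG f \<Longrightarrow> continuous_on SG g \<Longrightarrow> sgi (\<lambda>x. f x + g x) = sgi f + sgi g"
  unfolding sgi_def by (intro Bochner_Integration.integral_add integrable_cont)

lemma sgi_diff: "continuous_on SG f \<Longrightarrow> continuous_on SG g \<Longrightarrow> sgi (\<lambda>x. f x - g x) = sgi f - sgi g"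
  unfolding sgi_def by (intro Bochner_Integration.integral_diff integrable_cont)

lemma sgi_mult: "sgi (\<lambda>x. c * f x) = c * sgi f"
  unfolding sgi_def by (rule integral_mult_right_zero)

lemma sgi_const: "sgi (\<lambda>x. c) = c"
proof -
  interpret prob_space SG_measure by (rule prob_space_SG_measure)
  show ?thesis by (simp add: sgi_def prob_space)
qed

lemma sgi_mono:
  assumes "continuous_on SG f" "continuous_on SG g" "\<And>x. x \<in> SG \<Longrightarrow> f x \<le> g x"
  shows "sgi f \<le> sgi g"
  unfolding sgi_def using assms by (intro integral_mono integrable_cont) (auto simp: space_SG_measure)

lemma sgi_bound:
  assumes "continuous_on SG f" "\<And>x. x \<in> SG \<Longrightarrow> \<bar>f x\<bar> \<le> B"
  shows "\<bar>sgi f\<bar> \<le> B"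
proof -
  have "sgi f \<le> sgi (\<lambda>x. B)" "sgi (\<lambda>x. - B) \<le> sgi f"
    using assms by (auto intro!: sgi_mono simp: abs_le_iff minus_le_iff)
  then show ?thesis by (simp add: sgi_const)
qed

lemma sgi_self_similar:
  assumes "continuous_on SG g"
  shows "sgi g = (\<Sum>i\<in>UNIV. sgi (\<lambda>x. g (contr i x))) / 3"
proof -
  interpret prob_space SG_measure by (rule prob_space_SG_measure)
  obtain B where B: "\<And>x. x \<in> SG \<Longrightarrow> \<bar>g x\<bar> \<le> B" using bounded_on_SG[OF assms] by blast
  \<comment> \<open>The shift by \<open>B\<close> makes the integrand nonnegative, so that the
    identity for nonnegative integrals applies; the constant cancels at the end.\<close>
  define h where "h x = g x + B" for x
  have ch: "continuous_on SG h" unfolding h_def by (intro continuous_intros assms)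
  have h0: "h x \<ge> 0" if "x \<in> SG" for x using B[OF that] by (simp add: h_def)
  have nn: "(\<integral>\<^sup>+x. ennreal (k x) \<partial>SG_measure) = ennreal (sgi k)"
    if "continuous_on SG k" "\<And>x. x \<in> SG \<Longrightarrow> k x \<ge> 0" for k
    unfolding sgi_def using that
    by (intro nn_integral_eq_integral integrable_cont) (auto simp: space_SG_measure)
  have s0: "sgi k \<ge> 0" if "continuous_on SG k" "\<And>x. x \<in> SG \<Longrightarrow> k x \<ge> 0" for k
    using sgi_mono[of "\<lambda>x. 0" k] that by (simp add: sgi_const)
  note cc = continuous_on_SG_contr[OF ch]
  have "ennreal (sgi h) = (\<integral>\<^sup>+x. ennreal (h x) \<partial>SG_measure)" using nn ch h0 by simp
  also have "\<dots> = (\<Sum>i\<in>UNIV. (\<integral>\<^sup>+x. ennreal (h (contr i x)) \<partial>SG_measure)) / 3"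
    unfolding SG_measure_eq using measurable_cont_SG[OF ch] by (intro nn_integral_code_measure) simp
  also have "\<dots> = (\<Sum>i\<in>UNIV. ennreal (sgi (\<lambda>x. h (contr i x)))) / 3"
    using cc h0 by (simp add: nn)
  also have "\<dots> = ennreal ((\<Sum>i\<in>UNIV. sgi (\<lambda>x. h (contr i x))) / 3)"
    using cc h0 s0 by (simp add: sum_nonneg divide_ennreal flip: ennreal_numeral)
  finally have "sgi h = (\<Sum>i\<in>UNIV. sgi (\<lambda>x. h (contr i x))) / 3"
    using cc h0 s0 ch by (subst (asm) ennreal_inj) (auto intro!: sum_nonneg divide_nonneg_nonneg)
  then show ?thesis
    unfolding h_def using assms continuous_on_SG_contr[OF assms]
    by (simp add: sgi_add sgi_const sum.distrib add_divide_distrib)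
qed

text \<open>By continuity the integrand stays above \<open>g x / 2\<close> on a small cell around
  \<open>x\<close>, and by self-similarity the integral is at least the contribution of that
  cell.\<close>

lemma sgi_pos:
  assumes "continuous_on SG g" "\<And>x. x \<in> SG \<Longrightarrow> g x \<ge> 0" "x \<in> SG" "g x > 0"
  shows "sgi g > 0"
proof -
  have ge: "sgi g \<ge> sgi (\<lambda>x. g (word_map w x)) / 3 ^ length w"
    if "continuous_on SG g" "\<And>x. x \<in> SG \<Longrightarrow> g x \<ge> 0" for g w
    using that
  proof (induction w arbitrary: g)
    case (Cons i w)
    have n: "sgi (\<lambda>x. g (contr j x)) \<ge> 0" for j
      using sgi_mono[of "\<lambda>x. 0" "\<lambda>x. g (contr j x)"] Cons.prems by (auto simp: sgi_const continuous_on_SG_contr)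
    have "sgi (\<lambda>x. g (contr i x)) \<le> (\<Sum>i\<in>UNIV. sgi (\<lambda>x. g (contr i x)))"
      using n by (intro member_le_sum) auto
    then have 1: "sgi (\<lambda>x. g (contr i x)) / 3 \<le> sgi g"
      using sgi_self_similar[OF Cons.prems(1)] by simp
    have "sgi (\<lambda>x. g (contr i (word_map w x))) / 3 ^ length w \<le> sgi (\<lambda>x. g (contr i x))"
      using Cons.IH[of "\<lambda>x. g (contr i x)"] Cons.prems by (auto simp: continuous_on_SG_contr)
    from divide_right_mono[OF this, of 3] 1
    have "sgi (\<lambda>x. g (contr i (word_map w x))) / 3 ^ length w / 3 \<le> sgi g" by simp
    then show ?case by (simp add: mult.commute)
  qed simp
  obtain e where e: "e > 0" "\<And>y. y \<in> SG \<Longrightarrow> dist y x < e \<Longrightarrow> dist (g y) (g x) < g x / 2"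
    using assms(1)[unfolded continuous_on_iff, rule_format, OF assms(3), of "g x / 2"] assms(4)
    by (metis half_gt_zero)
  obtain w where w: "\<And>y. y \<in> cell w \<Longrightarrow> dist x y < e" using cell_in_ball[OF assms(3) e(1)] by metis
  have "g (word_map w y) \<ge> g x / 2" if "y \<in> SG" for y
  proof -
    have "dist (g (word_map w y)) (g x) < g x / 2"
      using w[of "word_map w y"] that by (intro e(2)) (auto simp: cell_def dist_commute)
    then show ?thesis unfolding dist_real_def by linarith
  qed
  then have "sgi (\<lambda>x. g (word_map w x)) \<ge> sgi (\<lambda>_. g x / 2)"
    by (intro sgi_mono continuous_on_const) (auto intro: continuous_on_SG_word_map[OF assms(1)])
  then have "sgi (\<lambda>x. g (word_map w x)) > 0" using assms(4) by (simp add: sgi_const)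
  then have "0 < sgi (\<lambda>x. g (word_map w x)) / 3 ^ length w" by simp
  also have "\<dots> \<le> sgi g" by (rule ge[OF assms(1,2)])
  finally show ?thesis .
qed

text \<open>Besides the two Cauchy-Schwarz inequalities this serves the variational argument for the
  odd minimiser, where \<open>a = 0\<close> forces \<open>b = 0\<close>. The choice
  \<open>s = c\<close>, \<open>t = - b\<close> settles positive \<open>c\<close>; for
  \<open>c = 0\<close> a nonzero \<open>b\<close> would make the form equal to -1 somewhere.\<close>

lemma discriminant_le:
  assumes "\<And>s t. 0 \<le> s\<^sup>2 * a + 2 * s * t * b + t\<^sup>2 * (c::real)"
  shows "b\<^sup>2 \<le> a * c"
proof -
  have "0 \<le> c * (a * c - b\<^sup>2)" using assms[of c "- b"] by (simp add: power2_eq_square algebra_simps)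
  moreover have "c \<ge> 0" using assms[of 0 1] by simp
  moreover have "b = 0" if "c = 0"
  proof (rule ccontr)
    assume "b \<noteq> 0"
    have "0 \<le> a + 2 * (- (a + 1) / (2 * b)) * b" using assms[of 1 "- (a + 1) / (2 * b)"] that by simp
    then show False using \<open>b \<noteq> 0\<close> by (simp add: field_simps)
  qed
  ultimately show ?thesis by (cases "c = 0") (auto simp: zero_le_mult_iff)
qed

lemma sgi_Cauchy_Schwarz:
  assumes "continuous_on SG f" "continuous_on SG g"
  shows "(sgi (\<lambda>x. f x * g x))\<^sup>2 \<le> sgi (\<lambda>x. f x ^ 2) * sgi (\<lambda>x. g x ^ 2)"
proof -
  define a b c where "a = sgi (\<lambda>x. f x ^ 2)" and "b = sgi (\<lambda>x. f x * g x)" and "c = sgi (\<lambda>x. g x ^ 2)"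
  have q: "0 \<le> s\<^sup>2 * a + 2 * s * t * b + t\<^sup>2 * c" for s t
  proof -
    have "0 \<le> sgi (\<lambda>x. (s * f x + t * g x)\<^sup>2)"
    proof -
      have "continuous_on SG (\<lambda>x. (s * f x + t * g x)\<^sup>2)" by (intro continuous_intros assms)
      then show ?thesis using sgi_mono[of "\<lambda>x. 0" "\<lambda>x. (s * f x + t * g x)\<^sup>2"] by (simp add: sgi_const)
    qed
    also have "(\<lambda>x. (s * f x + t * g x)\<^sup>2) = (\<lambda>x. s\<^sup>2 * f x ^ 2 + ((2 * s * t) * (f x * g x) + t\<^sup>2 * g x ^ 2))"
      by (simp add: power2_eq_square algebra_simps)
    also have "sgi \<dots> = sgi (\<lambda>x. s\<^sup>2 * f x ^ 2) + sgi (\<lambda>x. (2 * s * t) * (f x * g x) + t\<^sup>2 * g x ^ 2)"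
      by (intro sgi_add continuous_intros assms)
    also have "sgi (\<lambda>x. (2 * s * t) * (f x * g x) + t\<^sup>2 * g x ^ 2) = sgi (\<lambda>x. (2 * s * t) * (f x * g x)) + sgi (\<lambda>x. t\<^sup>2 * g x ^ 2)"
      by (intro sgi_add continuous_intros assms)
    also have "sgi (\<lambda>x. s\<^sup>2 * f x ^ 2) + (sgi (\<lambda>x. (2 * s * t) * (f x * g x)) + sgi (\<lambda>x. t\<^sup>2 * g x ^ 2))
        = s\<^sup>2 * a + (2 * s * t * b + t\<^sup>2 * c)"
      unfolding a_def b_def c_def sgi_mult ..
    finally show ?thesis by simp
  qed
  have "b\<^sup>2 \<le> a * c" by (rule discriminant_le) (rule q)
  then show ?thesis by (simp add: a_def b_def c_def)
qed

section \<open>The energy\<close>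

definition sub :: "3 \<Rightarrow> (real ^ 2 \<Rightarrow> real) \<Rightarrow> real ^ 2 \<Rightarrow> real" where
  "sub i u = (\<lambda>x. u (contr i x))"

definition subw :: "3 list \<Rightarrow> (real ^ 2 \<Rightarrow> real) \<Rightarrow> real ^ 2 \<Rightarrow> real" where
  "subw w u = (\<lambda>x. u (word_map w x))"

lemma sub_apply: "sub i u x = u (contr i x)" by (simp add: sub_def)

lemma subw_apply: "subw w u x = u (word_map w x)" by (simp add: subw_def)

lemma subw_Nil [simp]: "subw [] u = u" by (simp add: subw_def)

lemma subw_Cons [simp]: "subw (i # w) u = subw w (sub i u)" by (simp add: subw_def sub_def)

lemma continuous_on_sub [continuous_intros]: "continuous_on SG u \<Longrightarrow> continuous_on SG (sub i u)"
  unfolding sub_def by (rule continuous_on_SG_contr)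

lemma sgi_sub: "continuous_on SG g \<Longrightarrow> sgi g = (\<Sum>i\<in>UNIV. sgi (sub i g)) / 3"
  unfolding sub_def by (rule sgi_self_similar)

text \<open>Each edge of the triangle is indexed by the vertex opposite to it.\<close>

definition E0 :: "(real ^ 2 \<Rightarrow> real) \<Rightarrow> (real ^ 2 \<Rightarrow> real) \<Rightarrow> real" where
  "E0 u v = (\<Sum>i\<in>UNIV. (u (vtx (i + 1)) - u (vtx (i - 1))) * (v (vtx (i + 1)) - v (vtx (i - 1))))"

lemma E0_eq: "E0 u v = (u (vtx 1) - u (vtx 2)) * (v (vtx 1) - v (vtx 2))
    + (u (vtx 2) - u (vtx 0)) * (v (vtx 2) - v (vtx 0)) + (u (vtx 0) - u (vtx 1)) * (v (vtx 0) - v (vtx 1))"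
  by (simp add: E0_def sum_UNIV_3)

text \<open>The renormalised graph energy, organised by the cells of level one instead of by
  adjacency, so that inductions on the level follow the self-similar structure;
  \<open>graph_energy_eq\<close> identifies the two.\<close>

primrec GE :: "nat \<Rightarrow> (real ^ 2 \<Rightarrow> real) \<Rightarrow> (real ^ 2 \<Rightarrow> real) \<Rightarrow> real" where
  "GE 0 u v = E0 u v"
| "GE (Suc m) u v = 5 / 3 * (\<Sum>i\<in>UNIV. GE m (sub i u) (sub i v))"

lemma adj_0: "adj 0 x y \<longleftrightarrow> x \<in> range vtx \<and> y \<in> range vtx \<and> x \<noteq> y"
  by (auto simp: adj_def V_0 cell_def)

lemma adj_Suc: "adj (Suc m) x y \<longleftrightarrow> (\<exists>i x' y'. adj m x' y' \<and> x = contr i x' \<and> y = contr i y')"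
proof
  have desc: "x' \<in> V m" if "contr i x' \<in> V (Suc m)" "x' \<in> SG" for i x'
  proof -
    obtain j z where z: "z \<in> V m" "contr i x' = contr j z" using \<open>contr i x' \<in> V (Suc m)\<close> by (auto simp: V_Suc)
    show ?thesis
    proof (cases "i = j")
      case True then show ?thesis using z by (simp add: inj_contr)
    next
      case False
      then show ?thesis using cells_meet[OF that(2) _ False z(2)] z(1) V_SG vtx_V by auto
    qed
  qed
  assume a: "adj (Suc m) x y"
  then obtain w where w: "length w = Suc m" "x \<in> cell w" "y \<in> cell w" by (auto simp: adj_def)
  then obtain i v where v: "w = i # v" "length v = m" by (auto simp: length_Suc_conv)
  obtain x' where x': "x' \<in> cell v" "x = contr i x'" using w v by (auto simp: cell_Cons)
  obtain y' where y': "y' \<in> cell v" "y = contr i y'" using w v by (auto simp: cell_Cons)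
  have "adj m x' y'"
    using a desc[of i x'] desc[of i y'] x' y' v(2) cell_SG[of v] by (auto simp: adj_def)
  then show "\<exists>i x' y'. adj m x' y' \<and> x = contr i x' \<and> y = contr i y'" using x' y' by blast
next
  assume "\<exists>i x' y'. adj m x' y' \<and> x = contr i x' \<and> y = contr i y'"
  then obtain i x' y' where a: "adj m x' y'" "x = contr i x'" "y = contr i y'" by blast
  then obtain w where "length w = m" "x' \<in> cell w" "y' \<in> cell w" by (auto simp: adj_def)
  then have "length (i # w) = Suc m \<and> x \<in> cell (i # w) \<and> y \<in> cell (i # w)" using a by (auto simp: cell_Cons)
  then have "\<exists>w. length w = Suc m \<and> x \<in> cell w \<and> y \<in> cell w" by blast
  then show "adj (Suc m) x y" using a unfolding adj_def V_Suc by (auto simp: inj_contr)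
qed

lemma adj_SG: "adj m x y \<Longrightarrow> x \<in> SG \<and> y \<in> SG \<and> x \<noteq> y"
  using V_SG by (auto simp: adj_def)

lemma finite_adj: "finite {(x, y). adj m x y}"
  by (rule finite_subset[of _ "V m \<times> V m"]) (auto simp: adj_def finite_V)

text \<open>The factor 2 counts ordered pairs. The edges of level \<open>Suc m\<close> split
  according to the cell of level one that contains them: two cells share a single point, so no edge
  lies in both.\<close>

lemma adj_sum: "(\<Sum>(x, y)\<in>{(x, y). adj m x y}. (u x - u y) * (v x - v y)) = 2 * ((3 / 5) ^ m * GE m u v)"
proof (induction m arbitrary: u v)
  case 0
  have "(\<Sum>(x, y)\<in>{(x, y). adj 0 x y}. (u x - u y) * (v x - v y))
      = (\<Sum>(x, y)\<in>range vtx \<times> range vtx. (u x - u y) * (v x - v y))"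
    by (rule sum.mono_neutral_left) (auto simp: adj_0)
  also have "\<dots> = (\<Sum>i\<in>UNIV. \<Sum>j\<in>UNIV. (u (vtx i) - u (vtx j)) * (v (vtx i) - v (vtx j)))"
    using vtx_inj by (simp add: sum.cartesian_product[symmetric] sum.reindex inj_def)
  finally show ?case by (simp add: sum_UNIV_3 E0_eq algebra_simps)
next
  case (Suc m)
  let ?A = "\<lambda>i. (\<lambda>(x, y). (contr i x, contr i y)) ` {(x, y). adj m x y}"
  have "{(x, y). adj (Suc m) x y} = (\<Union>i\<in>UNIV. ?A i)"
    by (auto simp: adj_Suc image_iff)
  then have "(\<Sum>(x, y)\<in>{(x, y). adj (Suc m) x y}. (u x - u y) * (v x - v y))
      = (\<Sum>(x, y)\<in>(\<Union>i\<in>UNIV. ?A i). (u x - u y) * (v x - v y))" by simp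
  also have "\<dots> = (\<Sum>i\<in>UNIV. \<Sum>(x, y)\<in>?A i. (u x - u y) * (v x - v y))"
  proof (rule sum.UNION_disjoint)
    show "\<forall>i\<in>UNIV. finite (?A i)" using finite_adj by blast
    have False if "i \<noteq> j" "adj m x y" "adj m x' y'" "contr i x = contr j x'" "contr i y = contr j y'" for i j x y x' y'
      using cells_meet[OF _ _ that(1,4)] cells_meet[OF _ _ that(1,5)] adj_SG[OF that(2)] adj_SG[OF that(3)] by auto
    then show "\<forall>i\<in>UNIV. \<forall>j\<in>UNIV. i \<noteq> j \<longrightarrow> ?A i \<inter> ?A j = {}"
      by (intro ballI impI equals0I) (auto simp: image_iff)
  qed simp
  also have "\<dots> = (\<Sum>i\<in>UNIV. \<Sum>(x, y)\<in>{(x, y). adj m x y}. (sub i u x - sub i u y) * (sub i v x - sub i v y))"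
  proof (rule sum.cong[OF refl])
    fix i
    have "inj_on (\<lambda>(x, y). (contr i x, contr i y)) {(x, y). adj m x y}"
      by (auto simp: inj_on_def inj_contr)
    then show "(\<Sum>(x, y)\<in>?A i. (u x - u y) * (v x - v y)) = (\<Sum>(x, y)\<in>{(x, y). adj m x y}. (sub i u x - sub i u y) * (sub i v x - sub i v y))"
      by (subst sum.reindex) (auto simp: sub_apply intro!: sum.cong)
  qed
  also have "\<dots> = (\<Sum>i\<in>UNIV. 2 * ((3 / 5) ^ m * GE m (sub i u) (sub i v)))" by (simp only: Suc)
  also have "\<dots> = 2 * ((3 / 5) ^ Suc m * GE (Suc m) u v)" by (simp add: sum_distrib_left mult_ac)
  finally show ?case .
qed

lemma graph_energy_eq: "graph_energy m u v = GE m u v"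
proof -
  have "(5 / 3) ^ m * (3 / 5) ^ m = (1::real)" by (simp flip: power_mult_distrib)
  then show ?thesis unfolding graph_energy_def adj_sum
    by (simp add: mult.assoc[symmetric])
qed

lemma GE_cong:
  assumes "\<And>x. x \<in> SG \<Longrightarrow> u x = u' x" "\<And>x. x \<in> SG \<Longrightarrow> v x = v' x"
  shows "GE m u v = GE m u' v'"
  using assms
proof (induction m arbitrary: u v u' v')
  case (Suc m)
  have "GE m (sub i u) (sub i v) = GE m (sub i u') (sub i v')" for i
    by (rule Suc.IH) (use Suc.prems in \<open>auto simp: sub_apply\<close>)
  then show ?case by simp
qed (simp add: E0_def)

lemma GE_sym: "GE m u v = GE m v u"
  by (induction m arbitrary: u v) (auto simp: E0_def mult.commute)

lemma GE_add: "GE m (\<lambda>x. u x + u' x) v = GE m u v + GE m u' v"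
proof (induction m arbitrary: u u' v)
  case (Suc m)
  have "GE m (sub i (\<lambda>x. u x + u' x)) (sub i v) = GE m (sub i u) (sub i v) + GE m (sub i u') (sub i v)" for i
    using Suc.IH[of "sub i u" "sub i u'" "sub i v"] by (simp add: sub_def)
  then show ?case by (simp add: sum.distrib distrib_left)
qed (simp add: E0_eq algebra_simps)

lemma GE_mult: "GE m (\<lambda>x. c * u x) v = c * GE m u v"
proof (induction m arbitrary: u v)
  case (Suc m)
  have "GE m (sub i (\<lambda>x. c * u x)) (sub i v) = c * GE m (sub i u) (sub i v)" for i
    using Suc.IH[of "sub i u" "sub i v"] by (simp add: sub_def)
  then show ?case by (simp add: sum_distrib_left algebra_simps)
qed (simp add: E0_eq algebra_simps)

lemma GE_add2: "GE m v (\<lambda>x. u x + u' x) = GE m v u + GE m v u'"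
  unfolding GE_sym[of m v] by (rule GE_add)

lemma GE_mult2: "GE m v (\<lambda>x. c * u x) = c * GE m v u"
  unfolding GE_sym[of m v] by (rule GE_mult)

lemma GE_nonneg: "GE m u u \<ge> 0"
  by (induction m arbitrary: u) (auto simp: E0_def intro!: sum_nonneg)

text \<open>The minimum of the right-hand side over the three midpoint values is attained at the
  harmonic extension, which makes the difference a sum of squares.\<close>

lemma E0_le: "E0 u u \<le> 5 / 3 * (\<Sum>i\<in>UNIV. E0 (sub i u) (sub i u))"
proof -
  define a b c where "a = u (vtx 0)" and "b = u (vtx 1)" and "c = u (vtx 2)"
  define x y z where "x = u (contr 1 (vtx 2))" and "y = u (contr 2 (vtx 0))" and "z = u (contr 0 (vtx 1))"
  have v: "contr 2 (vtx 1) = contr 1 (vtx 2)" "contr 0 (vtx 2) = contr 2 (vtx 0)" "contr 1 (vtx 0) = contr 0 (vtx 1)"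
    by (simp_all add: contr_vtx_comm)
  define X Y Z where "X = x - (a + 2 * b + 2 * c) / 5" and "Y = y - (2 * a + b + 2 * c) / 5" and "Z = z - (2 * a + 2 * b + c) / 5"
  have "5 / 3 * (\<Sum>i\<in>UNIV. E0 (sub i u) (sub i u)) - E0 u u
     = 5 / 3 * ((X - Y)\<^sup>2 + (Y - Z)\<^sup>2 + (Z - X)\<^sup>2 + 2 * (X\<^sup>2 + Y\<^sup>2 + Z\<^sup>2))"
    unfolding E0_eq sum_UNIV_3 sub_apply contr_vtx v a_def[symmetric] b_def[symmetric] c_def[symmetric]
      x_def[symmetric] y_def[symmetric] z_def[symmetric] X_def Y_def Z_def
    by (simp add: power2_eq_square field_simps)
  moreover have "0 \<le> 5 / 3 * ((X - Y)\<^sup>2 + (Y - Z)\<^sup>2 + (Z - X)\<^sup>2 + 2 * (X\<^sup>2 + Y\<^sup>2 + Z\<^sup>2))" by simp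
  ultimately show ?thesis by linarith
qed

lemma GE_mono: "GE m u u \<le> GE (Suc m) u u"
proof (induction m arbitrary: u)
  case 0 then show ?case using E0_le by simp
next
  case (Suc m)
  have "(\<Sum>i\<in>UNIV. GE m (sub i u) (sub i u)) \<le> (\<Sum>i\<in>UNIV. GE (Suc m) (sub i u) (sub i u))"
    by (rule sum_mono) (rule Suc)
  then have "5 / 3 * (\<Sum>i\<in>UNIV. GE m (sub i u) (sub i u)) \<le> 5 / 3 * (\<Sum>i\<in>UNIV. GE (Suc m) (sub i u) (sub i u))"
    by (intro mult_left_mono) auto
  then show ?case by (simp only: GE.simps)
qed

lemma incseq_GE: "incseq (\<lambda>m. GE m u u)"
  using GE_mono by (rule incseq_SucI)

lemma dom_energy_iff: "u \<in> dom_energy \<longleftrightarrow> continuous_on SG u \<and> convergent (\<lambda>m. GE m u u)"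
  by (simp add: dom_energy_def graph_energy_eq)

lemma dom_energyI:
  assumes "continuous_on SG u" "\<And>m. GE m u u \<le> B"
  shows "u \<in> dom_energy"
proof -
  have "Bseq (\<lambda>m. GE m u u)" using assms(2) GE_nonneg[of _ u] by (intro BseqI'[of _ B]) auto
  then show ?thesis
    using Bseq_monoseq_convergent[of "\<lambda>m. GE m u u"] incseq_GE[of u] assms(1)
    by (auto simp: dom_energy_iff monoseq_iff)
qed

lemma dom_cont: "u \<in> dom_energy \<Longrightarrow> continuous_on SG u"
  by (simp add: dom_energy_iff)

lemma energy_self_tendsto: "u \<in> dom_energy \<Longrightarrow> (\<lambda>m. GE m u u) \<longlonglongrightarrow> energy u u"
  by (simp add: dom_energy_iff energy_def graph_energy_eq convergent_LIMSEQ_iff)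

lemma GE_le_energy: "u \<in> dom_energy \<Longrightarrow> GE m u u \<le> energy u u"
  by (rule incseq_le[OF incseq_GE energy_self_tendsto])

lemma energy_nonneg: "u \<in> dom_energy \<Longrightarrow> energy u u \<ge> 0"
  using GE_le_energy[of u 0] GE_nonneg[of 0 u] by linarith

lemma energy_leI: "u \<in> dom_energy \<Longrightarrow> (\<And>m. GE m u u \<le> B) \<Longrightarrow> energy u u \<le> B"
  by (rule LIMSEQ_le_const2[OF energy_self_tendsto]) auto

lemma GE_expand: "GE m (\<lambda>x. a * u x + b * v x) (\<lambda>x. a * u x + b * v x)
    = a\<^sup>2 * GE m u u + 2 * a * b * GE m u v + b\<^sup>2 * GE m v v"
  unfolding GE_add GE_add2 GE_mult GE_mult2 GE_sym[of m v u] by (simp add: power2_eq_square algebra_simps)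

lemma dom_lin:
  assumes "u \<in> dom_energy" "v \<in> dom_energy"
  shows "(\<lambda>x. a * u x + b * v x) \<in> dom_energy"
proof (rule dom_energyI)
  show "continuous_on SG (\<lambda>x. a * u x + b * v x)" using assms by (intro continuous_intros dom_cont)
  fix m
  have "2 * (a * b * GE m u v) \<le> a\<^sup>2 * GE m u u + b\<^sup>2 * GE m v v"
    using GE_nonneg[of m "\<lambda>x. a * u x + (- b) * v x"] unfolding GE_expand by simp
  then have "GE m (\<lambda>x. a * u x + b * v x) (\<lambda>x. a * u x + b * v x) \<le> 2 * (a\<^sup>2 * GE m u u + b\<^sup>2 * GE m v v)"
    unfolding GE_expand by (simp add: algebra_simps)
  also have "\<dots> \<le> 2 * (a\<^sup>2 * energy u u + b\<^sup>2 * energy v v)"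
    using assms by (intro mult_left_mono add_mono GE_le_energy) auto
  finally show "GE m (\<lambda>x. a * u x + b * v x) (\<lambda>x. a * u x + b * v x) \<le> 2 * (a\<^sup>2 * energy u u + b\<^sup>2 * energy v v)" .
qed

lemma dom_add: "u \<in> dom_energy \<Longrightarrow> v \<in> dom_energy \<Longrightarrow> (\<lambda>x. u x + v x) \<in> dom_energy"
  using dom_lin[of u v 1 1] by simp

lemma dom_mult: "u \<in> dom_energy \<Longrightarrow> (\<lambda>x. c * u x) \<in> dom_energy"
  using dom_lin[of u u c 0] by simp

lemma energy_tendsto:
  assumes "u \<in> dom_energy" "v \<in> dom_energy"
  shows "(\<lambda>m. GE m u v) \<longlonglongrightarrow> energy u v"
proof -
  have e: "GE m u v = (GE m (\<lambda>x. u x + v x) (\<lambda>x. u x + v x) - GE m u u - GE m v v) / 2" for m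
    using GE_expand[of m 1 u 1 v] by simp
  have "convergent (\<lambda>m. GE m u v)"
    unfolding e using energy_self_tendsto[OF assms(1)] energy_self_tendsto[OF assms(2)]
      energy_self_tendsto[OF dom_add[OF assms]]
    by (intro convergentI[of _ "(energy (\<lambda>x. u x + v x) (\<lambda>x. u x + v x) - energy u u - energy v v) / 2"] tendsto_intros) auto
  then show ?thesis by (simp add: energy_def graph_energy_eq convergent_LIMSEQ_iff)
qed

lemma energy_eqI: "(\<lambda>m. GE m u v) \<longlonglongrightarrow> L \<Longrightarrow> energy u v = L"
  by (simp add: energy_def graph_energy_eq limI)

lemma energy_sym: "energy u v = energy v u"
  by (simp add: energy_def graph_energy_eq GE_sym)

lemma energy_cong:
  assumes "\<And>x. x \<in> SG \<Longrightarrow> u x = u' x" "\<And>x. x \<in> SG \<Longrightarrow> v x = v' x"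
  shows "energy u v = energy u' v'"
  unfolding energy_def graph_energy_eq using GE_cong[OF assms] by simp

lemma dom_cong:
  assumes "\<And>x. x \<in> SG \<Longrightarrow> u x = u' x"
  shows "u \<in> dom_energy \<longleftrightarrow> u' \<in> dom_energy"
  unfolding dom_energy_iff using GE_cong[OF assms assms] assms by (simp cong: continuous_on_cong)

lemma energy_add:
  "u \<in> dom_energy \<Longrightarrow> u' \<in> dom_energy \<Longrightarrow> v \<in> dom_energy \<Longrightarrow> energy (\<lambda>x. u x + u' x) v = energy u v + energy u' v"
  by (rule energy_eqI) (auto simp: GE_add intro!: tendsto_intros energy_tendsto)

lemma energy_mult:
  "u \<in> dom_energy \<Longrightarrow> v \<in> dom_energy \<Longrightarrow> energy (\<lambda>x. c * u x) v = c * energy u v"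
  by (rule energy_eqI) (auto simp: GE_mult intro!: tendsto_intros energy_tendsto)

lemma energy_add2:
  "u \<in> dom_energy \<Longrightarrow> u' \<in> dom_energy \<Longrightarrow> v \<in> dom_energy \<Longrightarrow> energy v (\<lambda>x. u x + u' x) = energy v u + energy v u'"
  unfolding energy_sym[of v] by (rule energy_add)

lemma energy_mult2:
  "u \<in> dom_energy \<Longrightarrow> v \<in> dom_energy \<Longrightarrow> energy v (\<lambda>x. c * u x) = c * energy v u"
  unfolding energy_sym[of v] by (rule energy_mult)

lemma energy_expand:
  assumes "u \<in> dom_energy" "v \<in> dom_energy"
  shows "energy (\<lambda>x. a * u x + b * v x) (\<lambda>x. a * u x + b * v x)
    = a\<^sup>2 * energy u u + 2 * a * b * energy u v + b\<^sup>2 * energy v v"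
  by (rule energy_eqI) (auto simp: GE_expand intro!: tendsto_intros energy_tendsto assms)

lemma energy_Cauchy_Schwarz:
  assumes "u \<in> dom_energy" "v \<in> dom_energy"
  shows "(energy u v)\<^sup>2 \<le> energy u u * energy v v"
  using energy_nonneg[OF dom_lin[OF assms]] by (intro discriminant_le) (simp add: energy_expand[OF assms])

definition enorm :: "(real ^ 2 \<Rightarrow> real) \<Rightarrow> real" where
  "enorm u = sqrt (energy u u)"

lemma enorm_nonneg: "u \<in> dom_energy \<Longrightarrow> enorm u \<ge> 0"
  by (simp add: enorm_def energy_nonneg)

lemma enorm_sq: "u \<in> dom_energy \<Longrightarrow> (enorm u)\<^sup>2 = energy u u"
  by (simp add: enorm_def energy_nonneg)

lemma enorm_add:
  assumes "u \<in> dom_energy" "v \<in> dom_energy"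
  shows "enorm (\<lambda>x. u x + v x) \<le> enorm u + enorm v"
proof -
  have "\<bar>energy u v\<bar> \<le> enorm u * enorm v"
    using energy_Cauchy_Schwarz[OF assms] unfolding enorm_def real_sqrt_mult[symmetric]
    by (simp add: real_le_rsqrt)
  then have "energy (\<lambda>x. u x + v x) (\<lambda>x. u x + v x) \<le> (enorm u + enorm v)\<^sup>2"
    using energy_expand[OF assms, of 1 1] enorm_sq[OF assms(1)] enorm_sq[OF assms(2)]
    by (simp add: power2_sum)
  then show ?thesis using enorm_nonneg[OF assms(1)] enorm_nonneg[OF assms(2)]
    unfolding enorm_def[of "\<lambda>x. u x + v x"] by (simp add: real_le_lsqrt)
qed

lemma enorm_mult: "u \<in> dom_energy \<Longrightarrow> enorm (\<lambda>x. c * u x) = \<bar>c\<bar> * enorm u"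
  unfolding enorm_def using energy_mult energy_mult2 dom_mult
  by (simp add: real_sqrt_mult flip: power2_eq_square mult.assoc)

lemma dom_sub: assumes "u \<in> dom_energy" shows "sub i u \<in> dom_energy"
proof (rule dom_energyI)
  show "continuous_on SG (sub i u)" using assms by (intro continuous_intros dom_cont)
  fix m
  have "GE m (sub i u) (sub i u) \<le> (\<Sum>i\<in>UNIV. GE m (sub i u) (sub i u))"
    by (rule member_le_sum) (auto simp: GE_nonneg)
  also have "\<dots> = 3 / 5 * GE (Suc m) u u" by simp
  also have "\<dots> \<le> 3 / 5 * energy u u" by (rule mult_left_mono[OF GE_le_energy[OF assms]]) simp
  finally show "GE m (sub i u) (sub i u) \<le> 3 / 5 * energy u u" .
qed

lemma energy_self_similar:
  assumes "u \<in> dom_energy" "v \<in> dom_energy"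
  shows "energy u v = 5 / 3 * (\<Sum>i\<in>UNIV. energy (sub i u) (sub i v))"
proof -
  have "(\<lambda>m. GE (Suc m) u v) \<longlonglongrightarrow> 5 / 3 * (\<Sum>i\<in>UNIV. energy (sub i u) (sub i v))"
    unfolding GE.simps using assms by (intro tendsto_intros energy_tendsto dom_sub)
  moreover have "(\<lambda>m. GE (Suc m) u v) \<longlonglongrightarrow> energy u v"
    using energy_tendsto[OF assms] by (rule LIMSEQ_Suc)
  ultimately show ?thesis using LIMSEQ_unique by blast
qed

lemma dom_pieces:
  assumes "continuous_on SG u" "\<And>i. sub i u \<in> dom_energy"
  shows "u \<in> dom_energy"
proof -
  have "(\<lambda>m. GE (Suc m) u u) \<longlonglongrightarrow> 5 / 3 * (\<Sum>i\<in>UNIV. energy (sub i u) (sub i u))"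
    unfolding GE.simps using assms by (intro tendsto_intros energy_tendsto)
  then have "convergent (\<lambda>m. GE m u u)" by (intro convergentI) (rule LIMSEQ_imp_Suc)
  then show ?thesis using assms by (simp add: dom_energy_iff)
qed

lemma enorm_sub_le: assumes "u \<in> dom_energy" shows "energy (sub i u) (sub i u) \<le> 3 / 5 * energy u u"
proof -
  have "energy (sub i u) (sub i u) \<le> (\<Sum>i\<in>UNIV. energy (sub i u) (sub i u))"
    using dom_sub[OF assms] by (intro member_le_sum) (auto simp: energy_nonneg)
  then show ?thesis using energy_self_similar[OF assms assms] by simp
qed

lemma dom_subw: "u \<in> dom_energy \<Longrightarrow> subw w u \<in> dom_energy"
  by (induction w arbitrary: u) (auto simp: dom_sub)

lemma energy_subw_le:
  "u \<in> dom_energy \<Longrightarrow> energy (subw w u) (subw w u) \<le> (3 / 5) ^ length w * energy u u"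
proof (induction w arbitrary: u)
  case (Cons i w)
  have "energy (subw (i # w) u) (subw (i # w) u) \<le> (3 / 5) ^ length w * energy (sub i u) (sub i u)"
    unfolding subw_Cons by (rule Cons.IH[OF dom_sub[OF Cons.prems]])
  also have "\<dots> \<le> (3 / 5) ^ length w * (3 / 5 * energy u u)"
    using enorm_sub_le[OF Cons.prems] by (intro mult_left_mono) auto
  finally show ?case by (simp add: mult_ac)
qed simp

lemma energy_osc_vtx:
  assumes "u \<in> dom_energy" shows "\<bar>u (vtx i) - u (vtx j)\<bar> \<le> enorm u"
proof -
  have "(u (vtx i) - u (vtx j))\<^sup>2 \<le> E0 u u"
    using exh_3[of i] exh_3[of j]
    by (elim disjE) (simp_all add: E0_eq power2_commute[of "u (vtx 1)" "u (vtx 0)"] power2_commute[of "u (vtx 2)" "u (vtx 1)"]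
      power2_commute[of "u (vtx 0)" "u (vtx 2)"] flip: power2_eq_square)
  also have "\<dots> \<le> energy u u" using GE_le_energy[OF assms, of 0] by simp
  finally show ?thesis unfolding enorm_def by (intro real_le_rsqrt) simp
qed

text \<open>Passing to a subcell costs a vertex difference of at most \<open>enorm u\<close> and
  shrinks the energy norm by the factor \<open>sqrt (3 / 5)\<close>, which is below 4/5. The
  resulting geometric series is the source of the constant 5.\<close>

lemma energy_osc:
  assumes "u \<in> dom_energy" "x \<in> SG" shows "\<bar>u x - u (vtx i)\<bar> \<le> 5 * enorm u"
proof -
  have v: "\<bar>u (word_map w (vtx 0)) - u (vtx i)\<bar> \<le> 5 * enorm u" if "u \<in> dom_energy" for w i u
    using that
  proof (induction w arbitrary: u i)
    case Nil
    then show ?case using energy_osc_vtx[OF Nil, of 0 i] enorm_nonneg[OF Nil] by simp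
  next
    case (Cons k w)
    have "\<bar>sub k u (word_map w (vtx 0)) - sub k u (vtx k)\<bar> \<le> 5 * enorm (sub k u)"
      by (rule Cons.IH[OF dom_sub[OF Cons.prems]])
    moreover have "enorm (sub k u) \<le> 4 / 5 * enorm u"
    proof -
      have "energy (sub k u) (sub k u) \<le> (4 / 5)\<^sup>2 * energy u u"
        using enorm_sub_le[OF Cons.prems, of k] energy_nonneg[OF Cons.prems] by (simp add: power2_eq_square)
      then have "sqrt (energy (sub k u) (sub k u)) \<le> sqrt ((4 / 5)\<^sup>2 * energy u u)" by simp
      then show ?thesis by (simp add: enorm_def real_sqrt_mult)
    qed
    moreover have "\<bar>u (vtx k) - u (vtx i)\<bar> \<le> enorm u" by (rule energy_osc_vtx[OF Cons.prems])
    ultimately show ?case by (simp add: sub_apply abs_le_iff)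
  qed
  have "closed (SG \<inter> (\<lambda>x. \<bar>u x - u (vtx i)\<bar>) -` {..5 * enorm u})"
    by (intro continuous_closed_preimage continuous_intros dom_cont assms(1) closed_SG)
  then have "SG \<subseteq> SG \<inter> (\<lambda>x. \<bar>u x - u (vtx i)\<bar>) -` {..5 * enorm u}" using v[OF assms(1)] by (intro SG_subset_closed) auto
  then show ?thesis using assms(2) by auto
qed

text \<open>Both points are compared with the image of \<open>vtx 0\<close>, which doubles the 5 of
  \<open>energy_osc\<close>; the power of \<open>sqrt (3 / 5)\<close> is the decay of the energy
  norm on the cell. All later equicontinuity rests on this estimate.\<close>

lemma energy_osc_cell:
  assumes "u \<in> dom_energy" "x \<in> SG" "y \<in> SG"
  shows "\<bar>u (word_map w x) - u (word_map w y)\<bar> \<le> 10 * sqrt (3 / 5) ^ length w * enorm u"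
proof -
  have d: "subw w u \<in> dom_energy" by (rule dom_subw[OF assms(1)])
  have "\<bar>subw w u x - subw w u y\<bar> \<le> 10 * enorm (subw w u)"
    using energy_osc[OF d assms(2), of 0] energy_osc[OF d assms(3), of 0] by linarith
  also have "enorm (subw w u) \<le> sqrt (3 / 5) ^ length w * enorm u"
    unfolding enorm_def real_sqrt_power[symmetric] real_sqrt_mult[symmetric]
    using energy_subw_le[OF assms(1)] by simp
  finally show ?thesis by (simp add: subw_apply)
qed

section \<open>Harmonic functions and the Dirichlet problem\<close>

lemma bary_average_bound:
  assumes "x \<in> SG" "\<And>j. \<bar>a j\<bar> \<le> C"
  shows "\<bar>\<Sum>j\<in>UNIV. a j * bary j x\<bar> \<le> C"
proof -
  have "\<bar>\<Sum>j\<in>UNIV. a j * bary j x\<bar> \<le> (\<Sum>j\<in>UNIV. \<bar>a j * bary j x\<bar>)" by (rule sum_abs)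
  also have "\<dots> \<le> (\<Sum>j\<in>UNIV. C * bary j x)"
    using assms bary_nonneg[OF assms(1)] by (intro sum_mono) (simp add: abs_mult mult_right_mono)
  also have "\<dots> = C" by (simp add: sum_distrib_left[symmetric] sum_bary)
  finally show ?thesis .
qed

text \<open>Vertex values that are prescribed by a contracting refinement rule extend to continuous
  functions: the piecewise affine interpolants, built by gluing, converge uniformly.\<close>

lemma refinement_limit:
  fixes b :: "'s \<Rightarrow> 3 \<Rightarrow> real" and nxt :: "'s \<Rightarrow> 3 \<Rightarrow> 's" and C :: "'s \<Rightarrow> real"
  assumes ok: "\<And>s i. ok s \<Longrightarrow> ok (nxt s i)"
    and diag: "\<And>s i. ok s \<Longrightarrow> b (nxt s i) i = b s i"
    and compat: "\<And>s i j. ok s \<Longrightarrow> b (nxt s i) j = b (nxt s j) i"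
    and close: "\<And>s i j k. ok s \<Longrightarrow> \<bar>b (nxt s i) j - b s k\<bar> \<le> C s"
    and dec: "\<And>s i. ok s \<Longrightarrow> C (nxt s i) \<le> r * C s" and r: "0 \<le> r" "r < 1"
  shows "\<exists>U. \<forall>s. ok s \<longrightarrow> continuous_on SG (U s) \<and> (\<forall>i. U s (vtx i) = b s i)
    \<and> (\<forall>i. \<forall>x\<in>SG. U s (contr i x) = U (nxt s i) x)"
proof -
  define A where "A = rec_nat (\<lambda>s x. \<Sum>i\<in>UNIV. b s i * bary i x) (\<lambda>n a s. glue (\<lambda>i. a (nxt s i)))"
  have A0: "A 0 s x = (\<Sum>i\<in>UNIV. b s i * bary i x)" for s x by (simp add: A_def)
  have AS: "A (Suc n) s = glue (\<lambda>i. A n (nxt s i))" for n s by (simp add: A_def)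
  have Av: "A n s (vtx i) = b s i" if "ok s" for n s i
    using that
  proof (induction n arbitrary: s i)
    case 0 then show ?case using exh_3[of i] by (auto simp: A0 bary_vtx sum_UNIV_3)
  next
    case (Suc n)
    have "A (Suc n) s (contr i (vtx i)) = A n (nxt s i) (vtx i)"
      unfolding AS by (rule glue_contr) (use Suc ok compat in auto)
    then show ?case using Suc.IH[OF ok[OF Suc.prems]] diag[OF Suc.prems] by simp
  qed
  have Ac: "A (Suc n) s (contr i x) = A n (nxt s i) x" if "ok s" "x \<in> SG" for n s i x
    unfolding AS by (rule glue_contr) (use that Av ok compat in auto)
  have cont: "continuous_on SG (A n s)" if "ok s" for n s
    using that
  proof (induction n arbitrary: s)
    case 0
    have "continuous_on SG (\<lambda>x. \<Sum>i\<in>UNIV. b s i * bary i x)" by (intro continuous_intros)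
    then show ?case by (simp add: A0[abs_def])
  next
    case (Suc n)
    show ?case unfolding AS by (rule continuous_on_glue) (use Suc Av ok compat in auto)
  qed
  have C0: "C s \<ge> 0" if "ok s" for s using close[OF that, of 0 0 0] by linarith
  have step: "\<bar>A (Suc n) s x - A n s x\<bar> \<le> r ^ n * C s" if "ok s" "x \<in> SG" for n s x
    using that
  proof (induction n arbitrary: s x)
    case 0
    obtain i y where y: "y \<in> SG" "x = contr i y" using \<open>x \<in> SG\<close> by (rule SG_cases)
    have 1: "\<bar>b (nxt s i) j - A 0 s x\<bar> \<le> C s" for j
    proof -
      have "b (nxt s i) j - A 0 s x = (\<Sum>k\<in>UNIV. (b (nxt s i) j - b s k) * bary k x)"
        by (simp add: A0 left_diff_distrib sum_subtractf sum_distrib_left[symmetric] sum_bary)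
      then show ?thesis using close[OF \<open>ok s\<close>] bary_average_bound[OF \<open>x \<in> SG\<close>] by simp
    qed
    have "A (Suc 0) s x - A 0 s x = A 0 (nxt s i) y - A 0 s x" using Ac[OF \<open>ok s\<close> y(1)] y(2) by simp
    also have "\<dots> = (\<Sum>j\<in>UNIV. (b (nxt s i) j - A 0 s x) * bary j y)"
      by (simp add: A0[of _ y] left_diff_distrib sum_subtractf sum_distrib_left[symmetric] sum_bary)
    finally show ?case using bary_average_bound[OF y(1), of "\<lambda>j. b (nxt s i) j - A 0 s x" "C s"] 1 by simp
  next
    case (Suc n)
    obtain i y where y: "y \<in> SG" "x = contr i y" using \<open>x \<in> SG\<close> by (rule SG_cases)
    have "\<bar>A (Suc (Suc n)) s x - A (Suc n) s x\<bar> = \<bar>A (Suc n) (nxt s i) y - A n (nxt s i) y\<bar>"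
      unfolding y(2) Ac[OF \<open>ok s\<close> y(1)] ..
    also have "\<dots> \<le> r ^ n * C (nxt s i)" by (rule Suc.IH[OF ok[OF \<open>ok s\<close>] y(1)])
    also have "\<dots> \<le> r ^ n * (r * C s)" using dec[OF \<open>ok s\<close>] r by (intro mult_left_mono) auto
    finally show ?case by (simp add: mult_ac)
  qed
  define U where "U s x = A 0 s x + (\<Sum>n. A (Suc n) s x - A n s x)" for s x
  have lim: "uniform_limit SG (\<lambda>n. A n s) (U s) sequentially" if "ok s" for s
  proof -
    have "uniform_limit SG (\<lambda>n x. \<Sum>i<n. A (Suc i) s x - A i s x) (\<lambda>x. \<Sum>n. A (Suc n) s x - A n s x) sequentially"
      using step[OF that] r by (intro Weierstrass_m_test[of _ _ "\<lambda>n. r ^ n * C s"] summable_mult2 summable_geometric) auto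
    then have "uniform_limit SG (\<lambda>n x. A 0 s x + (\<Sum>i<n. A (Suc i) s x - A i s x)) (U s) sequentially"
      unfolding U_def by (intro uniform_limit_intros)
    moreover have "(\<lambda>n x. A 0 s x + (\<Sum>i<n. A (Suc i) s x - A i s x)) = (\<lambda>n. A n s)"
    proof (intro ext)
      fix n x show "A 0 s x + (\<Sum>i<n. A (Suc i) s x - A i s x) = A n s x"
        using sum_lessThan_telescope[of "\<lambda>i. A i s x" n] by simp
    qed
    ultimately show ?thesis by simp
  qed
  have tend: "(\<lambda>n. A n s x) \<longlonglongrightarrow> U s x" if "ok s" "x \<in> SG" for s x
    using tendsto_uniform_limitI[OF lim[OF that(1)] that(2)] .
  show ?thesis
  proof (intro exI[of _ U] allI impI conjI ballI)
    show "continuous_on SG (U s)" if "ok s" for s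
      using lim[OF that] cont[OF that] by (intro uniform_limit_theorem[OF _ lim[OF that]]) auto
    show "U s (vtx i) = b s i" if "ok s" for s i
      using tend[OF that, of "vtx i"] by (simp add: Av[OF that] LIMSEQ_const_iff)
    show "U s (contr i x) = U (nxt s i) x" if "ok s" "x \<in> SG" for s i x
      using LIMSEQ_Suc[OF tend[OF that(1), of "contr i x"]] tend[OF ok[OF that(1)] that(2), of i] that
      unfolding Ac[OF that] by (intro LIMSEQ_unique[of "\<lambda>n. A n (nxt s i) x"]) auto
  qed
qed

definition snorm :: "(real ^ 2 \<Rightarrow> real) \<Rightarrow> real" where
  "snorm f = (SUP x\<in>SG. \<bar>f x\<bar>)"

lemma snorm_upper: "continuous_on SG f \<Longrightarrow> x \<in> SG \<Longrightarrow> \<bar>f x\<bar> \<le> snorm f"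
proof -
  assume a: "continuous_on SG f" "x \<in> SG"
  obtain B where "\<And>x. x \<in> SG \<Longrightarrow> \<bar>f x\<bar> \<le> B" using bounded_on_SG[OF a(1)] by blast
  then show "\<bar>f x\<bar> \<le> snorm f" unfolding snorm_def using a(2) by (intro cSUP_upper bdd_aboveI2[of _ _ B])
qed

lemma snorm_least: "(\<And>x. x \<in> SG \<Longrightarrow> \<bar>f x\<bar> \<le> B) \<Longrightarrow> snorm f \<le> B"
  unfolding snorm_def using SG_nonempty by (intro cSUP_least) auto

lemma snorm_nonneg: "continuous_on SG f \<Longrightarrow> snorm f \<ge> 0"
  using snorm_upper[of f "vtx 0"] abs_ge_zero[of "f (vtx 0)"] by (meson order_trans vtx_SG)

text \<open>The source rescaled so that \<open>\<Delta> u = f\<close> becomes \<open>\<Delta> (sub i u) = ssub i f\<close>.\<close>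

definition ssub :: "3 \<Rightarrow> (real ^ 2 \<Rightarrow> real) \<Rightarrow> real ^ 2 \<Rightarrow> real" where
  "ssub i f = (\<lambda>x. f (contr i x) / 5)"

lemma ssub_apply: "ssub i f x = f (contr i x) / 5" by (simp add: ssub_def)

lemma continuous_on_ssub [continuous_intros]: "continuous_on SG f \<Longrightarrow> continuous_on SG (ssub i f)"
  unfolding ssub_def by (intro continuous_intros continuous_on_SG_contr) auto

lemma snorm_ssub: "continuous_on SG f \<Longrightarrow> snorm (ssub i f) \<le> snorm f / 5"
  by (rule snorm_least) (auto simp: ssub_apply intro!: divide_right_mono snorm_upper)

definition vosc :: "(3 \<Rightarrow> real) \<Rightarrow> real" where
  "vosc b = Max (range (\<lambda>(i, j). \<bar>b i - b j\<bar>))"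

lemma vosc_upper: "\<bar>b i - b j\<bar> \<le> vosc b"
proof -
  have "\<bar>b i - b j\<bar> \<in> range (\<lambda>(i, j). \<bar>b i - b j\<bar>)" by (auto intro!: rev_image_eqI[of "(i, j)"])
  then show ?thesis unfolding vosc_def by (intro Max_ge) auto
qed

lemma vosc_least: "(\<And>i j. \<bar>b i - b j\<bar> \<le> B) \<Longrightarrow> vosc b \<le> B"
  unfolding vosc_def by (subst Max_le_iff) auto

text \<open>The midpoint values forced by the boundary values \<open>b\<close> and by the source terms \<open>J i j\<close> at
  the junction of the cells \<open>i\<close> and \<open>j\<close>.\<close>

definition hnxt :: "(3 \<Rightarrow> 3 \<Rightarrow> real) \<Rightarrow> (3 \<Rightarrow> real) \<Rightarrow> 3 \<Rightarrow> 3 \<Rightarrow> real" where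
  "hnxt J b i j = (if i = j then b i else
     (b i + b j + (b 0 + b 1 + b 2) - J i j) / 5 - (J 0 1 + J 1 2 + J 2 0) / 10)"

text \<open>The off-diagonal values are the harmonic extension rule with weights 2/5, 2/5, 1/5.
  Differences between the corners of a subcell are then combinations of the old differences with
  total size at most 3/5.\<close>

lemma harmonic_contraction:
  fixes b :: "3 \<Rightarrow> real"
  assumes "\<bar>b 0 - b 1\<bar> \<le> M" "\<bar>b 1 - b 2\<bar> \<le> M" "\<bar>b 2 - b 0\<bar> \<le> M"
    and v: "\<And>j. v j = (if i = j then b i else (b i + b j + (b 0 + b 1 + b 2)) / 5)"
  shows "\<bar>v j - v k\<bar> \<le> 3 / 5 * M"
proof -
  have "\<bar>v 0 - v 1\<bar> \<le> 3 / 5 * M" "\<bar>v 1 - v 2\<bar> \<le> 3 / 5 * M" "\<bar>v 2 - v 0\<bar> \<le> 3 / 5 * M"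
    using assms(1-3) exh_3[of i] unfolding v abs_le_iff by (auto simp: field_simps)
  moreover have "M \<ge> 0" using assms(1) by linarith
  ultimately show ?thesis using exh_3[of j] exh_3[of k] by (auto simp: abs_minus_commute)
qed

text \<open>A state consists of boundary values and a source, measured by
  \<open>vosc b + snorm f\<close>. One refinement step turns \<open>vosc b\<close> into at most
  \<open>3 / 5 * vosc b + 2 / 5 * snorm f\<close> and \<open>snorm f\<close> into at most a fifth,
  so the sum contracts by 3/5. The junction terms \<open>J\<close> are left open because the true
  ones are integrals against harmonic functions: the case \<open>J = 0\<close> constructs these, and
  only then can the case \<open>J = src\<close> be stated.\<close>

lemma source_refinement:
  assumes J_sym: "\<And>f i j. continuous_on SG f \<Longrightarrow> J f i j = J f j i"
    and J_bound: "\<And>f i j. continuous_on SG f \<Longrightarrow> \<bar>J f i j\<bar> \<le> 2 / 5 * snorm f"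
  shows "\<exists>U. \<forall>b f. continuous_on SG f \<longrightarrow> continuous_on SG (U b f) \<and> (\<forall>i. U b f (vtx i) = b i)
    \<and> (\<forall>i. \<forall>x\<in>SG. U b f (contr i x) = U (hnxt (J f) b i) (ssub i f) x)"
proof -
  have bds: "\<bar>J f i j / 5 + (J f 0 1 + J f 1 2 + J f 2 0) / 10\<bar> \<le> snorm f / 5"
    if "continuous_on SG f" for f i j
    using J_bound[OF that, of i j] J_bound[OF that, of 0 1] J_bound[OF that, of 1 2] J_bound[OF that, of 2 0]
    unfolding abs_le_iff add_divide_distrib diff_divide_distrib by linarith
  have near: "\<bar>hnxt (J f) b i j - b k\<bar> \<le> vosc b + snorm f / 5" if "continuous_on SG f" for f b i j k
  proof (cases "i = j")
    case True
    then show ?thesis using vosc_upper[of b i k] snorm_nonneg[OF that] by (simp add: hnxt_def)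
  next
    case False
    have "hnxt (J f) b i j - b k = ((b i - b k) + (b j - b k) + (b 0 - b k) + (b 1 - b k) + (b 2 - b k)) / 5
        - (J f i j / 5 + (J f 0 1 + J f 1 2 + J f 2 0) / 10)"
      using False by (simp add: hnxt_def field_simps)
    then show ?thesis
      using bds[OF that, of i j] vosc_upper[of b i k] vosc_upper[of b j k] vosc_upper[of b 0 k] vosc_upper[of b 1 k] vosc_upper[of b 2 k]
      unfolding abs_le_iff add_divide_distrib diff_divide_distrib by linarith
  qed
  have osc: "vosc (hnxt (J f) b i) \<le> 3 / 5 * vosc b + 2 / 5 * snorm f" if f: "continuous_on SG f" for f b i
  proof (rule vosc_least)
    fix j k
    have *: "\<bar>hnxt (\<lambda>_ _. 0) b i j - hnxt (\<lambda>_ _. 0) b i k\<bar> \<le> 3 / 5 * vosc b"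
      by (rule harmonic_contraction[OF vosc_upper vosc_upper vosc_upper, where b = b and v = "hnxt (\<lambda>_ _. 0) b i" and i = i])
        (simp add: hnxt_def)
    have e: "\<bar>hnxt (J f) b i l - hnxt (\<lambda>_ _. 0) b i l\<bar> \<le> snorm f / 5" for l
    proof (cases "i = l")
      case False
      then have "hnxt (J f) b i l - hnxt (\<lambda>_ _. 0) b i l = - (J f i l / 5 + (J f 0 1 + J f 1 2 + J f 2 0) / 10)"
        by (simp add: hnxt_def field_simps)
      then show ?thesis using bds[OF f, of i l] by (simp only: abs_minus_cancel)
    qed (use snorm_nonneg[OF f] in \<open>simp add: hnxt_def\<close>)
    show "\<bar>hnxt (J f) b i j - hnxt (J f) b i k\<bar> \<le> 3 / 5 * vosc b + 2 / 5 * snorm f"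
      using * e[of j] e[of k] unfolding abs_le_iff by linarith
  qed
  have "\<exists>U. \<forall>s. continuous_on SG (snd s) \<longrightarrow> continuous_on SG (U s) \<and> (\<forall>i. U s (vtx i) = fst s i)
    \<and> (\<forall>i. \<forall>x\<in>SG. U s (contr i x) = U (hnxt (J (snd s)) (fst s) i, ssub i (snd s)) x)"
  proof (rule refinement_limit[of "\<lambda>s. continuous_on SG (snd s)" "\<lambda>s i. (hnxt (J (snd s)) (fst s) i, ssub i (snd s))"
        fst "\<lambda>s. vosc (fst s) + snorm (snd s)" "3 / 5"], goal_cases)
    case (4 s i j k)
    then show ?case using near[of "snd s" "fst s" i j k] snorm_nonneg[OF 4] by simp
  next
    case (5 s i)
    then show ?case using osc[OF 5, of "fst s" i] snorm_ssub[OF 5, of i] by simp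
  qed (auto simp: hnxt_def J_sym intro: continuous_on_ssub)
  then obtain U where U: "\<And>s. continuous_on SG (snd s) \<Longrightarrow> continuous_on SG (U s) \<and> (\<forall>i. U s (vtx i) = fst s i)
    \<and> (\<forall>i. \<forall>x\<in>SG. U s (contr i x) = U (hnxt (J (snd s)) (fst s) i, ssub i (snd s)) x)" by blast
  show ?thesis
  proof (intro exI[of _ "\<lambda>b f. U (b, f)"] allI impI)
    fix b :: "3 \<Rightarrow> real" and f :: "real ^ 2 \<Rightarrow> real" assume "continuous_on SG f"
    then show "continuous_on SG (U (b, f)) \<and> (\<forall>i. U (b, f) (vtx i) = b i)
      \<and> (\<forall>i. \<forall>x\<in>SG. U (b, f) (contr i x) = U (hnxt (J f) b i, ssub i f) x)"
      using U[of "(b, f)"] by simp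
  qed
qed

abbreviation zero_fun :: "real ^ 2 \<Rightarrow> real" where "zero_fun \<equiv> (\<lambda>x. 0)"

lemma harm_ex: "\<exists>U. (\<forall>b. continuous_on SG (U b)) \<and> (\<forall>b i. U b (vtx i) = b i)
    \<and> (\<forall>b i. \<forall>x\<in>SG. U b (contr i x) = U (hnxt (\<lambda>_ _. 0) b i) x)"
proof -
  have "\<exists>U. \<forall>b f. continuous_on SG f \<longrightarrow> continuous_on SG (U b f) \<and> (\<forall>i. U b f (vtx i) = b i)
    \<and> (\<forall>i. \<forall>x\<in>SG. U b f (contr i x) = U (hnxt (\<lambda>_ _. 0) b i) (ssub i f) x)"
    using source_refinement[of "\<lambda>_ _ _. 0"] snorm_nonneg by simp
  then obtain U where U: "\<And>b f. continuous_on SG f \<Longrightarrow> continuous_on SG (U b f) \<and> (\<forall>i. U b f (vtx i) = b i)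
    \<and> (\<forall>i. \<forall>x\<in>SG. U b f (contr i x) = U (hnxt (\<lambda>_ _. 0) b i) (ssub i f) x)" by blast
  have z: "ssub i zero_fun = zero_fun" for i by (simp add: ssub_def)
  show ?thesis
    using U[of zero_fun] by (intro exI[of _ "\<lambda>b. U b zero_fun"]) (simp add: z)
qed

definition harm :: "(3 \<Rightarrow> real) \<Rightarrow> real ^ 2 \<Rightarrow> real" where
  "harm = (SOME U. (\<forall>b. continuous_on SG (U b)) \<and> (\<forall>b i. U b (vtx i) = b i)
    \<and> (\<forall>b i. \<forall>x\<in>SG. U b (contr i x) = U (hnxt (\<lambda>_ _. 0) b i) x))"

lemma harm_props: "(\<forall>b. continuous_on SG (harm b)) \<and> (\<forall>b i. harm b (vtx i) = b i)
    \<and> (\<forall>b i. \<forall>x\<in>SG. harm b (contr i x) = harm (hnxt (\<lambda>_ _. 0) b i) x)"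
  unfolding harm_def by (rule someI_ex[OF harm_ex])

lemma continuous_on_harm [continuous_intros]: "continuous_on SG (harm b)"
  and harm_vtx [simp]: "harm b (vtx i) = b i"
  and harm_contr: "x \<in> SG \<Longrightarrow> harm b (contr i x) = harm (hnxt (\<lambda>_ _. 0) b i) x"
  using harm_props by simp_all

definition hb :: "3 \<Rightarrow> real ^ 2 \<Rightarrow> real" where
  "hb i = harm (\<lambda>j. of_bool (j = i))"

lemma continuous_on_hb [continuous_intros]: "continuous_on SG (hb i)"
  unfolding hb_def by (rule continuous_on_harm)

lemma hb_vtx [simp]: "hb i (vtx j) = of_bool (j = i)" by (simp add: hb_def)

lemma harm_linear:
  assumes "x \<in> SG" shows "harm b x = b 0 * hb 0 x + b 1 * hb 1 x + b 2 * hb 2 x"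
proof (rule eq_on_SG[OF _ _ _ assms])
  fix w
  show "harm b (word_map w (vtx 0)) = b 0 * hb 0 (word_map w (vtx 0)) + b 1 * hb 1 (word_map w (vtx 0)) + b 2 * hb 2 (word_map w (vtx 0))"
  proof (induction w arbitrary: b)
    case (Cons i w)
    let ?n = "\<lambda>b. hnxt (\<lambda>_ _. 0) b i"
    let ?x = "word_map w (vtx 0)"
    have *: "harm b (contr i ?x) = ?n b 0 * hb 0 ?x + ?n b 1 * hb 1 ?x + ?n b 2 * hb 2 ?x" for b
      by (simp add: harm_contr Cons.IH)
    have **: "?n b l = b 0 * ?n (\<lambda>j. of_bool (j = 0)) l + b 1 * ?n (\<lambda>j. of_bool (j = 1)) l + b 2 * ?n (\<lambda>j. of_bool (j = 2)) l" for b l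
      using exh_3[of i] exh_3[of l] by (elim disjE) (simp_all add: hnxt_def)
    have hbc: "hb k (contr i ?x) = ?n (\<lambda>j. of_bool (j = k)) 0 * hb 0 ?x + ?n (\<lambda>j. of_bool (j = k)) 1 * hb 1 ?x
        + ?n (\<lambda>j. of_bool (j = k)) 2 * hb 2 ?x" for k
      unfolding hb_def[of k] by (rule *)
    show ?case
      unfolding word_map.simps comp_apply hbc * **[of b 0] **[of b 1] **[of b 2] by (simp only: algebra_simps)
  qed (simp)
qed (intro continuous_intros)+

lemma hb_sum: "x \<in> SG \<Longrightarrow> hb 0 x + hb 1 x + hb 2 x = 1"
proof -
  assume x: "x \<in> SG"
  have "harm (\<lambda>_. 1) x = 1"
  proof (rule eq_on_SG[OF _ _ _ x])
    fix w show "harm (\<lambda>_. 1) (word_map w (vtx 0)) = 1"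
    proof (induction w)
      case (Cons i w)
      have "hnxt (\<lambda>_ _. 0) (\<lambda>_. 1) i = (\<lambda>_. 1)" by (simp add: hnxt_def fun_eq_iff)
      then show ?case using Cons by (simp add: harm_contr)
    qed simp
  qed (intro continuous_intros)+
  then show ?thesis using harm_linear[OF x, of "\<lambda>_. 1"] by simp
qed

lemma harm_nonneg:
  assumes "\<And>i. b i \<ge> 0" "x \<in> SG" shows "harm b x \<ge> 0"
proof -
  have "harm b (word_map w (vtx 0)) \<ge> 0" for w
    using assms(1)
  proof (induction w arbitrary: b)
    case (Cons i w)
    have "hnxt (\<lambda>_ _. 0) b i j \<ge> 0" for j using Cons.prems by (simp add: hnxt_def)
    then show ?case using Cons.IH by (simp add: harm_contr)
  qed simp
  moreover have "closed (SG \<inter> harm b -` {0..})"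
    by (intro continuous_closed_preimage continuous_on_harm closed_SG closed_atLeast)
  ultimately have "SG \<subseteq> SG \<inter> harm b -` {0..}" by (intro SG_subset_closed) auto
  then show ?thesis using assms(2) by auto
qed

lemma hb_nonneg: "x \<in> SG \<Longrightarrow> hb i x \<ge> 0"
  unfolding hb_def by (rule harm_nonneg) auto

lemma hb_le_1: "x \<in> SG \<Longrightarrow> hb i x \<le> 1"
  using hb_sum[of x] hb_nonneg[of x 0] hb_nonneg[of x 1] hb_nonneg[of x 2] exh_3[of i] by auto

lemma hb_contr:
  assumes "x \<in> SG"
  shows "hb i (contr i x) = hb i x + 2 / 5 * hb (i + 1) x + 2 / 5 * hb (i - 1) x"
    "hb i (contr (i + 1) x) = 2 / 5 * hb i x + 1 / 5 * hb (i - 1) x"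
    "hb i (contr (i - 1) x) = 2 / 5 * hb i x + 1 / 5 * hb (i + 1) x"
proof -
  have *: "hb i (contr j x) = hnxt (\<lambda>_ _. 0) (\<lambda>j. of_bool (j = i)) j 0 * hb 0 x
    + hnxt (\<lambda>_ _. 0) (\<lambda>j. of_bool (j = i)) j 1 * hb 1 x + hnxt (\<lambda>_ _. 0) (\<lambda>j. of_bool (j = i)) j 2 * hb 2 x" for i j
    unfolding hb_def[of i] harm_contr[OF assms] by (rule harm_linear[OF assms])
  show "hb i (contr i x) = hb i x + 2 / 5 * hb (i + 1) x + 2 / 5 * hb (i - 1) x"
    "hb i (contr (i + 1) x) = 2 / 5 * hb i x + 1 / 5 * hb (i - 1) x"
    "hb i (contr (i - 1) x) = 2 / 5 * hb i x + 1 / 5 * hb (i + 1) x"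
    using exh_3[of i] by (elim disjE; simp add: * hnxt_def)+
qed

text \<open>The moment of a source against the harmonic function that is 1 at vertex
  \<open>i\<close> and 0 at the other two. It is the correction that makes a finite difference at a
  vertex equal to the exact normal derivative.\<close>

definition H :: "3 \<Rightarrow> (real ^ 2 \<Rightarrow> real) \<Rightarrow> real" where
  "H i f = sgi (\<lambda>x. f x * hb i x)"

lemma H_cong: "(\<And>x. x \<in> SG \<Longrightarrow> f x = g x) \<Longrightarrow> H i f = H i g"
  unfolding H_def by (rule sgi_cong) simp

lemma H_lin:
  assumes "continuous_on SG f" "continuous_on SG g"
  shows "H i (\<lambda>x. a * f x + b * g x) = a * H i f + b * H i g"
proof -
  have "H i (\<lambda>x. a * f x + b * g x) = sgi (\<lambda>x. a * (f x * hb i x) + b * (g x * hb i x))"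
    unfolding H_def by (rule sgi_cong) (simp add: algebra_simps)
  also have "\<dots> = sgi (\<lambda>x. a * (f x * hb i x)) + sgi (\<lambda>x. b * (g x * hb i x))"
    by (intro sgi_add continuous_intros assms)
  finally show ?thesis by (simp only: sgi_mult H_def)
qed

lemma H_ssub: "H i (ssub j f) = H i (sub j f) / 5"
  using sgi_mult[of "1 / 5" "\<lambda>x. sub j f x * hb i x"] by (simp add: H_def ssub_def sub_apply)

lemma H_bound: "continuous_on SG f \<Longrightarrow> \<bar>H i f\<bar> \<le> snorm f"
  unfolding H_def
proof (rule sgi_bound)
  fix x assume a: "continuous_on SG f" "x \<in> SG"
  have "\<bar>f x * hb i x\<bar> \<le> snorm f * 1"
    unfolding abs_mult using snorm_upper[OF a] hb_nonneg[OF a(2), of i] hb_le_1[OF a(2), of i] snorm_nonneg[OF a(1)]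
    by (intro mult_mono) auto
  then show "\<bar>f x * hb i x\<bar> \<le> snorm f" by simp
qed (intro continuous_intros)

lemma H_comb:
  assumes "continuous_on SG f"
  shows "sgi (\<lambda>x. f x * (a * hb i x + b * hb j x + c * hb k x)) = a * H i f + b * H j f + c * H k f"
proof -
  have "sgi (\<lambda>x. f x * (a * hb i x + b * hb j x + c * hb k x))
      = sgi (\<lambda>x. (a * (f x * hb i x) + b * (f x * hb j x)) + c * (f x * hb k x))"
    by (rule sgi_cong) (simp add: algebra_simps)
  also have "\<dots> = sgi (\<lambda>x. a * (f x * hb i x) + b * (f x * hb j x)) + sgi (\<lambda>x. c * (f x * hb k x))"
    by (intro sgi_add continuous_intros assms)
  also have "sgi (\<lambda>x. a * (f x * hb i x) + b * (f x * hb j x)) = sgi (\<lambda>x. a * (f x * hb i x)) + sgi (\<lambda>x. b * (f x * hb j x))"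
    by (intro sgi_add continuous_intros assms)
  finally show ?thesis by (simp only: sgi_mult H_def)
qed

text \<open>Self-similarity of the integral combined with the extension rule for \<open>hb i\<close>
  on the three cells. It supplies the source terms in the recursion for normal derivatives.\<close>

lemma H_rec:
  assumes f: "continuous_on SG f"
  shows "3 * H i f = (H i (sub i f) + 2 / 5 * H (i + 1) (sub i f) + 2 / 5 * H (i - 1) (sub i f))
    + (2 / 5 * H i (sub (i + 1) f) + 1 / 5 * H (i - 1) (sub (i + 1) f))
    + (2 / 5 * H i (sub (i - 1) f) + 1 / 5 * H (i + 1) (sub (i - 1) f))"
proof -
  note c = continuous_on_sub[OF f]
  have "3 * H i f = (\<Sum>j\<in>UNIV. sgi (\<lambda>x. sub j f x * hb i (contr j x)))"
  proof -
    have "continuous_on SG (\<lambda>x. f x * hb i x)" by (intro continuous_intros f)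
    then show ?thesis unfolding H_def using sgi_self_similar[of "\<lambda>x. f x * hb i x"] by (simp add: sub_apply)
  qed
  also have "\<dots> = sgi (\<lambda>x. sub i f x * hb i (contr i x)) + sgi (\<lambda>x. sub (i + 1) f x * hb i (contr (i + 1) x))
      + sgi (\<lambda>x. sub (i - 1) f x * hb i (contr (i - 1) x))"
    by (rule sum_UNIV_shift)
  also have "sgi (\<lambda>x. sub i f x * hb i (contr i x))
     = sgi (\<lambda>x. sub i f x * (1 * hb i x + 2 / 5 * hb (i + 1) x + 2 / 5 * hb (i - 1) x))"
    by (rule sgi_cong) (simp only: hb_contr mult_1)
  also have "sgi (\<lambda>x. sub (i + 1) f x * hb i (contr (i + 1) x))
     = sgi (\<lambda>x. sub (i + 1) f x * (2 / 5 * hb i x + 1 / 5 * hb (i - 1) x + 0 * hb i x))"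
    by (rule sgi_cong) (simp add: hb_contr)
  also have "sgi (\<lambda>x. sub (i - 1) f x * hb i (contr (i - 1) x))
     = sgi (\<lambda>x. sub (i - 1) f x * (2 / 5 * hb i x + 1 / 5 * hb (i + 1) x + 0 * hb i x))"
    by (rule sgi_cong) (simp add: hb_contr)
  finally show ?thesis unfolding H_comb[OF c] by simp
qed

section \<open>The Laplacian as a system of matching conditions\<close>

text \<open>\<open>nder i u f\<close> is the normal derivative at the vertex \<open>i\<close> of a solution \<open>u\<close> of \<open>\<Delta> u = f\<close>, and
  \<open>matched\<close> says that normal derivatives cancel at the three junctions of level one.\<close>

definition nder :: "3 \<Rightarrow> (real ^ 2 \<Rightarrow> real) \<Rightarrow> (real ^ 2 \<Rightarrow> real) \<Rightarrow> real" where
  "nder i u f = 2 * u (vtx i) - u (vtx (i + 1)) - u (vtx (i - 1)) + H i f"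

definition matched :: "(real ^ 2 \<Rightarrow> real) \<Rightarrow> (real ^ 2 \<Rightarrow> real) \<Rightarrow> bool" where
  "matched u f \<longleftrightarrow> (\<forall>i j. i \<noteq> j \<longrightarrow> nder j (sub i u) (ssub i f) + nder i (sub j u) (ssub j f) = 0)"

definition ssubw :: "3 list \<Rightarrow> (real ^ 2 \<Rightarrow> real) \<Rightarrow> real ^ 2 \<Rightarrow> real" where
  "ssubw w f = (\<lambda>x. f (word_map w x) / 5 ^ length w)"

lemma ssubw_Nil [simp]: "ssubw [] f = f" by (simp add: ssubw_def)

lemma ssubw_Cons [simp]: "ssubw (i # w) f = ssubw w (ssub i f)"
  by (simp add: ssubw_def ssub_def mult.commute)

text \<open>A form of \<open>\<Delta> u = f\<close> without test functions: the normal derivatives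
  cancel at every junction inside every cell. In this form the equation restricts to cells, can be
  assembled from cells and survives uniform limits.\<close>

definition solves :: "(real ^ 2 \<Rightarrow> real) \<Rightarrow> (real ^ 2 \<Rightarrow> real) \<Rightarrow> bool" where
  "solves u f \<longleftrightarrow> continuous_on SG u \<and> continuous_on SG f \<and> (\<forall>w. matched (subw w u) (ssubw w f))"

lemma all_words: "(\<forall>w::3 list. P w) \<longleftrightarrow> P [] \<and> (\<forall>i w. P (i # w))"
  by (metis list.exhaust)

lemma solves_iff:
  "solves u f \<longleftrightarrow> continuous_on SG u \<and> continuous_on SG f \<and> matched u f \<and> (\<forall>i. solves (sub i u) (ssub i f))"
  unfolding solves_def by (subst all_words) (auto intro: continuous_on_sub continuous_on_ssub)

lemma solves_cont: "solves u f \<Longrightarrow> continuous_on SG u" "solves u f \<Longrightarrow> continuous_on SG f"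
  by (auto simp: solves_def)

lemma solves_sub: "solves u f \<Longrightarrow> solves (sub i u) (ssub i f)"
  using solves_iff by blast

lemma nder_cong:
  assumes "\<And>x. x \<in> SG \<Longrightarrow> u x = u' x" "\<And>x. x \<in> SG \<Longrightarrow> f x = f' x"
  shows "nder i u f = nder i u' f'"
  using H_cong[OF assms(2)] assms(1) by (simp add: nder_def)

lemma matched_cong:
  assumes "\<And>x. x \<in> SG \<Longrightarrow> u x = u' x" "\<And>x. x \<in> SG \<Longrightarrow> f x = f' x"
  shows "matched u f \<longleftrightarrow> matched u' f'"
proof -
  have "nder j (sub i u) (ssub i f) = nder j (sub i u') (ssub i f')" for i j
    by (rule nder_cong) (auto simp: assms ssub_apply sub_apply)
  then show ?thesis by (simp add: matched_def)
qed

lemma solves_cong: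
  assumes "\<And>x. x \<in> SG \<Longrightarrow> u x = u' x" "\<And>x. x \<in> SG \<Longrightarrow> f x = f' x"
  shows "solves u f \<longleftrightarrow> solves u' f'"
proof -
  have "matched (subw w u) (ssubw w f) \<longleftrightarrow> matched (subw w u') (ssubw w f')" for w
    by (rule matched_cong) (auto simp: assms subw_def ssubw_def)
  then show ?thesis using assms by (simp add: solves_def cong: continuous_on_cong)
qed

lemma nder_lin:
  assumes "continuous_on SG f" "continuous_on SG f'"
  shows "nder i (\<lambda>x. a * u x + b * u' x) (\<lambda>x. a * f x + b * f' x) = a * nder i u f + b * nder i u' f'"
  unfolding nder_def H_lin[OF assms] by (simp add: algebra_simps)

lemma matched_lin:
  assumes "continuous_on SG f" "continuous_on SG f'" "matched u f" "matched u' f'"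
  shows "matched (\<lambda>x. a * u x + b * u' x) (\<lambda>x. a * f x + b * f' x)"
proof -
  have 1: "sub i (\<lambda>x. a * u x + b * u' x) = (\<lambda>x. a * sub i u x + b * sub i u' x)" for i by (simp add: sub_def)
  have 2: "ssub i (\<lambda>x. a * f x + b * f' x) = (\<lambda>x. a * ssub i f x + b * ssub i f' x)" for i
    by (simp add: ssub_def add_divide_distrib)
  show ?thesis
    unfolding matched_def
  proof (intro allI impI)
    fix i j :: 3 assume "i \<noteq> j"
    then have "nder j (sub i u) (ssub i f) + nder i (sub j u) (ssub j f) = 0"
      "nder j (sub i u') (ssub i f') + nder i (sub j u') (ssub j f') = 0"
      using assms(3,4) by (auto simp: matched_def)
    then have "a * (nder j (sub i u) (ssub i f) + nder i (sub j u) (ssub j f))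
      + b * (nder j (sub i u') (ssub i f') + nder i (sub j u') (ssub j f')) = 0" by simp
    then show "nder j (sub i (\<lambda>x. a * u x + b * u' x)) (ssub i (\<lambda>x. a * f x + b * f' x))
      + nder i (sub j (\<lambda>x. a * u x + b * u' x)) (ssub j (\<lambda>x. a * f x + b * f' x)) = 0"
      unfolding 1 2 nder_lin[OF continuous_on_ssub[OF assms(1)] continuous_on_ssub[OF assms(2)]]
      by (simp only: algebra_simps)
  qed
qed

lemma continuous_on_ssubw [continuous_intros]: "continuous_on SG f \<Longrightarrow> continuous_on SG (ssubw w f)"
  by (induction w arbitrary: f) (auto intro: continuous_on_ssub)

lemma solves_lin:
  assumes "solves u f" "solves u' f'"
  shows "solves (\<lambda>x. a * u x + b * u' x) (\<lambda>x. a * f x + b * f' x)"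
  unfolding solves_def
proof (intro conjI allI)
  show "continuous_on SG (\<lambda>x. a * u x + b * u' x)" "continuous_on SG (\<lambda>x. a * f x + b * f' x)"
    using assms by (intro continuous_intros; simp add: solves_cont)+
  fix w
  have "subw w (\<lambda>x. a * u x + b * u' x) = (\<lambda>x. a * subw w u x + b * subw w u' x)"
    "ssubw w (\<lambda>x. a * f x + b * f' x) = (\<lambda>x. a * ssubw w f x + b * ssubw w f' x)"
    by (auto simp: subw_def ssubw_def add_divide_distrib)
  moreover have "matched (\<lambda>x. a * subw w u x + b * subw w u' x) (\<lambda>x. a * ssubw w f x + b * ssubw w f' x)"
    using assms by (intro matched_lin continuous_on_ssubw) (auto simp: solves_def)
  ultimately show "matched (subw w (\<lambda>x. a * u x + b * u' x)) (ssubw w (\<lambda>x. a * f x + b * f' x))" by simp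
qed

definition src :: "(real ^ 2 \<Rightarrow> real) \<Rightarrow> 3 \<Rightarrow> 3 \<Rightarrow> real" where
  "src f i j = H j (ssub i f) + H i (ssub j f)"

lemma src_sym: "src f i j = src f j i" by (simp add: src_def)

lemma src_bound: assumes "continuous_on SG f" shows "\<bar>src f i j\<bar> \<le> 2 / 5 * snorm f"
proof -
  have "\<bar>H j (ssub i f)\<bar> \<le> snorm f / 5" for i j
    using H_bound[OF continuous_on_ssub[OF assms], of j i] snorm_ssub[OF assms, of i] by linarith
  from this[of j i] this[of i j] show ?thesis unfolding src_def by linarith
qed

lemma junctions: "contr 2 (vtx 1) = contr 1 (vtx 2)" "contr 0 (vtx 2) = contr 2 (vtx 0)" "contr 1 (vtx 0) = contr 0 (vtx 1)"
  by (rule contr_vtx_comm)+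

text \<open>The three matching conditions are a nonsingular linear system for the three midpoint
  values, and \<open>hnxt\<close> is its solution; this is the origin of the coefficients 1/5 and
  1/10 there.\<close>

lemma matched_values:
  "matched u f \<longleftrightarrow> (\<forall>i j. i \<noteq> j \<longrightarrow> u (contr i (vtx j)) = hnxt (src f) (\<lambda>i. u (vtx i)) i j)"
proof -
  define a b c where "a = u (vtx 0)" and "b = u (vtx 1)" and "c = u (vtx 2)"
  define x y z where "x = u (contr 1 (vtx 2))" and "y = u (contr 2 (vtx 0))" and "z = u (contr 0 (vtx 1))"
  have s: "src f 2 1 = src f 1 2" "src f 1 0 = src f 0 1" "src f 0 2 = src f 2 0" by (rule src_sym)+
  have "matched u f \<longleftrightarrow> 4 * x - y - z - b - c + src f 1 2 = 0 \<and> 4 * y - z - x - c - a + src f 2 0 = 0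
      \<and> 4 * z - x - y - a - b + src f 0 1 = 0"
    unfolding matched_def all_3 nder_def sub_apply
    by (auto simp: junctions x_def y_def z_def a_def b_def c_def src_def)
  moreover have "(\<forall>i j. i \<noteq> j \<longrightarrow> u (contr i (vtx j)) = hnxt (src f) (\<lambda>i. u (vtx i)) i j)
     \<longleftrightarrow> x = (b + c + (a + b + c) - src f 1 2) / 5 - (src f 0 1 + src f 1 2 + src f 2 0) / 10
      \<and> y = (c + a + (a + b + c) - src f 2 0) / 5 - (src f 0 1 + src f 1 2 + src f 2 0) / 10
      \<and> z = (a + b + (a + b + c) - src f 0 1) / 5 - (src f 0 1 + src f 1 2 + src f 2 0) / 10"
    unfolding all_3 hnxt_def
    by (simp add: junctions s flip: x_def y_def z_def a_def b_def c_def) (auto simp: ac_simps)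
  moreover have "p = q / 5 - r / 10 \<longleftrightarrow> 10 * p = 2 * q - r" for p q r :: real by auto
  moreover have "4 * x - y - z - b - c + p = 0 \<and> 4 * y - z - x - c - a + q = 0 \<and> 4 * z - x - y - a - b + r = 0
    \<longleftrightarrow> 10 * x = 2 * (b + c + (a + b + c) - p) - (r + p + q) \<and> 10 * y = 2 * (c + a + (a + b + c) - q) - (r + p + q)
      \<and> 10 * z = 2 * (a + b + (a + b + c) - r) - (r + p + q)" for p q r
    by (rule iffI; elim conjE; intro conjI; argo)
  ultimately show ?thesis by (simp only:)
qed

text \<open>The midpoint values forced by matching and the recursion \<open>H_rec\<close> for the
  moments fit together exactly. The normal derivative at a vertex can thus be read off on
  arbitrarily small cells, with the factor 5/3 of the energy renormalisation.\<close>

lemma nder_rec: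
  assumes "continuous_on SG f" "matched u f"
  shows "nder i u f = 5 / 3 * nder i (sub i u) (ssub i f)"
proof -
  have v: "u (contr i (vtx (i + 1))) = hnxt (src f) (\<lambda>i. u (vtx i)) i (i + 1)"
    "u (contr i (vtx (i - 1))) = hnxt (src f) (\<lambda>i. u (vtx i)) i (i - 1)"
    using assms(2) unfolding matched_values by simp_all
  have "2 * u (vtx i) - u (vtx (i + 1)) - u (vtx (i - 1)) + H i f
      = 5 / 3 * (2 * u (vtx i) - hnxt (src f) (\<lambda>i. u (vtx i)) i (i + 1) - hnxt (src f) (\<lambda>i. u (vtx i)) i (i - 1) + H i (ssub i f))"
    using H_rec[OF assms(1), of i] exh_3[of i]
    by (elim disjE) (simp_all add: hnxt_def src_def H_ssub field_simps)
  then show ?thesis unfolding nder_def sub_apply contr_vtx v .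
qed

text \<open>This is the integral of \<open>f\<close> times the function that interpolates
  \<open>v\<close> harmonically on every cell of level \<open>m\<close>.\<close>

primrec Rsum :: "nat \<Rightarrow> (real ^ 2 \<Rightarrow> real) \<Rightarrow> (real ^ 2 \<Rightarrow> real) \<Rightarrow> real" where
  "Rsum 0 f v = (\<Sum>i\<in>UNIV. v (vtx i) * H i f)"
| "Rsum (Suc m) f v = (\<Sum>i\<in>UNIV. Rsum m (sub i f) (sub i v)) / 3"

lemma Rsum_scale: "Rsum m (\<lambda>x. c * f x) v = c * Rsum m f v"
proof (induction m arbitrary: f v)
  case 0
  have "H i (\<lambda>x. c * f x) = c * H i f" for i
    using sgi_mult[of c "\<lambda>x. f x * hb i x"] by (simp add: H_def mult.assoc)
  then show ?case by (simp add: sum_UNIV_3 algebra_simps)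
next
  case (Suc m)
  have "Rsum m (sub i (\<lambda>x. c * f x)) (sub i v) = c * Rsum m (sub i f) (sub i v)" for i
    using Suc.IH[of "sub i f" "sub i v"] by (simp add: sub_def)
  then show ?case by (simp add: sum_distrib_left)
qed

lemma Rsum_ssub: "Rsum m (ssub i f) v = Rsum m (sub i f) v / 5"
  using Rsum_scale[of m "1 / 5" "sub i f" v] by (simp add: ssub_def sub_def)

text \<open>In the sum over the three cells the boundary terms at the junctions cancel by matching,
  and those at the outer vertices combine through \<open>nder_rec\<close>.\<close>

lemma discrete_Gauss_Green:
  assumes "solves u f"
  shows "GE m u v = (\<Sum>i\<in>UNIV. nder i u f * v (vtx i)) - Rsum m f v"
  using assms
proof (induction m arbitrary: u f v)
  case 0
  show ?case by (simp add: sum_UNIV_3 E0_eq nder_def algebra_simps)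
next
  case (Suc m)
  have sv: "sub i v (vtx j) = v (contr i (vtx j))" for i j by (rule sub_apply)
  have m: "matched u f" and c: "continuous_on SG f" using Suc.prems solves_iff by blast+
  have "GE (Suc m) u v = 5 / 3 * (\<Sum>i\<in>UNIV. (\<Sum>j\<in>UNIV. nder j (sub i u) (ssub i f) * v (contr i (vtx j))))
      - 5 / 3 * (\<Sum>i\<in>UNIV. Rsum m (ssub i f) (sub i v))"
    using Suc.IH[OF solves_sub[OF Suc.prems]] by (simp add: sv sum_subtractf right_diff_distrib)
  also have "5 / 3 * (\<Sum>i\<in>UNIV. Rsum m (ssub i f) (sub i v)) = Rsum (Suc m) f v"
    by (simp add: Rsum_ssub sum_distrib_left sum_divide_distrib)
  also have "5 / 3 * (\<Sum>i\<in>UNIV. (\<Sum>j\<in>UNIV. nder j (sub i u) (ssub i f) * v (contr i (vtx j))))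
     = (\<Sum>i\<in>UNIV. nder i u f * v (vtx i))"
  proof -
    have n: "nder 2 (sub 1 u) (ssub 1 f) = - nder 1 (sub 2 u) (ssub 2 f)"
      "nder 0 (sub 2 u) (ssub 2 f) = - nder 2 (sub 0 u) (ssub 0 f)"
      "nder 1 (sub 0 u) (ssub 0 f) = - nder 0 (sub 1 u) (ssub 1 f)"
      using m unfolding matched_def by (simp_all add: eq_neg_iff_add_eq_0)
    show ?thesis
      unfolding sum_UNIV_3 nder_rec[OF c m] by (simp add: n junctions algebra_simps)
  qed
  finally show ?case .
qed

definition osc_le :: "nat \<Rightarrow> (real ^ 2 \<Rightarrow> real) \<Rightarrow> real \<Rightarrow> bool" where
  "osc_le m v e \<longleftrightarrow> (\<forall>w x y. length w = m \<longrightarrow> x \<in> SG \<longrightarrow> y \<in> SG \<longrightarrow> \<bar>v (word_map w x) - v (word_map w y)\<bar> \<le> e)"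

lemma osc_le_sub: "osc_le (Suc m) v e \<Longrightarrow> osc_le m (sub i v) e"
  unfolding osc_le_def
proof (intro allI impI)
  fix w :: "3 list" and x y
  assume a: "\<forall>w x y. length w = Suc m \<longrightarrow> x \<in> SG \<longrightarrow> y \<in> SG \<longrightarrow> \<bar>v (word_map w x) - v (word_map w y)\<bar> \<le> e"
    and "length w = m" "x \<in> SG" "y \<in> SG"
  then show "\<bar>sub i v (word_map w x) - sub i v (word_map w y)\<bar> \<le> e"
    using a[rule_format, of "i # w" x y] by (simp add: sub_def)
qed

lemma osc_le_eventually:
  assumes "continuous_on SG v" "e > 0" shows "\<exists>M. \<forall>m\<ge>M. osc_le m v e"
proof -
  have "uniformly_continuous_on SG v" using compact_uniformly_continuous[OF assms(1) compact_SG] .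
  then obtain d where d: "d > 0" "\<And>x y. x \<in> SG \<Longrightarrow> y \<in> SG \<Longrightarrow> dist y x < d \<Longrightarrow> dist (v y) (v x) < e"
    using assms(2) unfolding uniformly_continuous_on_def by metis
  obtain M where M: "\<forall>w x y. length w \<ge> M \<longrightarrow> x \<in> SG \<longrightarrow> y \<in> SG \<longrightarrow> dist (word_map w x) (word_map w y) < d"
    using small_words[OF d(1)] by blast
  have "osc_le m v e" if "m \<ge> M" for m
    unfolding osc_le_def
  proof (intro allI impI)
    fix w :: "3 list" and x y assume "length w = m" "x \<in> SG" "y \<in> SG"
    then have "dist (v (word_map w x)) (v (word_map w y)) < e" using M that by (intro d(2)) auto
    then show "\<bar>v (word_map w x) - v (word_map w y)\<bar> \<le> e" by (simp add: dist_real_def)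
  qed
  then show ?thesis by blast
qed

text \<open>The harmonic functions \<open>hb i\<close> are nonnegative with sum 1, so on each cell
  the interpolant is an average of vertex values of \<open>v\<close> and differs from
  \<open>v\<close> by no more than the oscillation on that cell.\<close>

lemma Rsum_error:
  assumes "continuous_on SG f" "continuous_on SG v" "\<And>x. x \<in> SG \<Longrightarrow> \<bar>f x\<bar> \<le> F" "osc_le m v e"
  shows "\<bar>Rsum m f v - sgi (\<lambda>x. f x * v x)\<bar> \<le> F * e"
  using assms
proof (induction m arbitrary: f v)
  case 0
  let ?h = "\<lambda>x. v (vtx 0) * hb 0 x + v (vtx 1) * hb 1 x + v (vtx 2) * hb 2 x"
  have "Rsum 0 f v = sgi (\<lambda>x. f x * ?h x)"
    unfolding H_comb[OF 0(1)] by (simp add: sum_UNIV_3)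
  then have "Rsum 0 f v - sgi (\<lambda>x. f x * v x) = sgi (\<lambda>x. f x * ?h x - f x * v x)"
    using 0 by (subst sgi_diff) (auto intro!: continuous_intros)
  also have "\<bar>\<dots>\<bar> \<le> F * e"
  proof (rule sgi_bound)
    fix x assume x: "x \<in> SG"
    have o: "\<bar>v (vtx i) - v x\<bar> \<le> e" for i using 0(4) x unfolding osc_le_def by (metis list.size(3) id_apply vtx_SG word_map.simps(1))
    have "?h x - v x = (v (vtx 0) - v x) * hb 0 x + (v (vtx 1) - v x) * hb 1 x + (v (vtx 2) - v x) * hb 2 x"
      using arg_cong[OF hb_sum[OF x], of "\<lambda>s. v x * s"] by (simp add: algebra_simps)
    also have "\<bar>\<dots>\<bar> \<le> \<bar>v (vtx 0) - v x\<bar> * hb 0 x + \<bar>v (vtx 1) - v x\<bar> * hb 1 x + \<bar>v (vtx 2) - v x\<bar> * hb 2 x"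
      using hb_nonneg[OF x] abs_triangle_ineq by (simp add: abs_mult order_trans[OF abs_triangle_ineq] add_mono)
    also have "\<dots> \<le> e * hb 0 x + e * hb 1 x + e * hb 2 x"
      using hb_nonneg[OF x] o by (intro add_mono mult_right_mono)
    also have "\<dots> = e" using hb_sum[OF x] by (simp flip: distrib_left)
    finally have "\<bar>?h x - v x\<bar> \<le> e" .
    then have "\<bar>f x\<bar> * \<bar>?h x - v x\<bar> \<le> F * e"
      using 0(3)[OF x] by (intro mult_mono) auto
    then show "\<bar>f x * ?h x - f x * v x\<bar> \<le> F * e" by (simp add: abs_mult flip: right_diff_distrib)
  qed (use 0 in \<open>auto intro!: continuous_intros\<close>)
  finally show ?case .
next
  case (Suc m)
  have IH: "\<bar>Rsum m (sub i f) (sub i v) - sgi (\<lambda>x. sub i f x * sub i v x)\<bar> \<le> F * e" for i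
  proof (rule Suc.IH)
    show "\<bar>sub i f x\<bar> \<le> F" if "x \<in> SG" for x using Suc.prems(3)[of "contr i x"] that by (simp add: sub_apply)
  qed (use Suc.prems in \<open>auto intro: continuous_on_sub osc_le_sub\<close>)
  have "sgi (\<lambda>x. f x * v x) = (\<Sum>i\<in>UNIV. sgi (\<lambda>x. sub i f x * sub i v x)) / 3"
    using sgi_self_similar[of "\<lambda>x. f x * v x"] Suc.prems by (simp add: sub_def continuous_on_mult)
  then have "Rsum (Suc m) f v - sgi (\<lambda>x. f x * v x) = (\<Sum>i\<in>UNIV. Rsum m (sub i f) (sub i v) - sgi (\<lambda>x. sub i f x * sub i v x)) / 3"
    by (simp add: sum_subtractf diff_divide_distrib)
  also have "\<bar>\<dots>\<bar> \<le> F * e"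
    using IH[of 0] IH[of 1] IH[of 2] by (simp add: sum_UNIV_3)
  finally show ?case .
qed

lemma Rsum_tendsto:
  assumes "continuous_on SG f" "continuous_on SG v"
  shows "(\<lambda>m. Rsum m f v) \<longlonglongrightarrow> sgi (\<lambda>x. f x * v x)"
proof (rule LIMSEQ_I)
  fix r :: real assume r: "r > 0"
  obtain F where F: "F \<ge> 0" "\<And>x. x \<in> SG \<Longrightarrow> \<bar>f x\<bar> \<le> F" using bounded_on_SG[OF assms(1)] by metis
  have "r / (2 * (F + 1)) > 0" using r F by (intro divide_pos_pos) auto
  then obtain M where M: "\<And>m. m \<ge> M \<Longrightarrow> osc_le m v (r / (2 * (F + 1)))" using osc_le_eventually[OF assms(2)] by metis
  have "F * (r / (2 * (F + 1))) < r"
    using r F(1) mult_nonneg_nonneg[of F r] by (simp add: field_simps add_nonneg_pos)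
  then show "\<exists>no. \<forall>n\<ge>no. norm (Rsum n f v - sgi (\<lambda>x. f x * v x)) < r"
    using Rsum_error[OF assms F(2) M] by (intro exI[of _ M]) fastforce
qed

lemma Gauss_Green_tendsto:
  assumes "solves u f" "continuous_on SG v"
  shows "(\<lambda>m. GE m u v) \<longlonglongrightarrow> (\<Sum>i\<in>UNIV. nder i u f * v (vtx i)) - sgi (\<lambda>x. f x * v x)"
  unfolding discrete_Gauss_Green[OF assms(1)]
  by (intro tendsto_intros Rsum_tendsto solves_cont(2)[OF assms(1)] assms(2))

lemma Gauss_Green:
  assumes "solves u f" "continuous_on SG v"
  shows "energy u v = (\<Sum>i\<in>UNIV. nder i u f * v (vtx i)) - sgi (\<lambda>x. f x * v x)"
  by (rule energy_eqI[OF Gauss_Green_tendsto[OF assms]])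

lemma solves_dom: assumes "solves u f" shows "u \<in> dom_energy"
  unfolding dom_energy_iff
  using Gauss_Green_tendsto[OF assms solves_cont(1)[OF assms]] solves_cont(1)[OF assms] by (auto intro: convergentI)

lemma solves_has_laplacian: assumes "solves u f" shows "has_laplacian u f"
  unfolding has_laplacian_def
proof (intro conjI ballI impI)
  fix v assume v: "v \<in> dom_energy" "\<forall>x\<in>V 0. v x = 0"
  then have "v (vtx i) = 0" for i by (auto simp: V_0)
  then show "energy u v = - (LINT x|SG_measure. f x * v x)"
    using Gauss_Green[OF assms dom_cont[OF v(1)]] by (simp add: sgi_def)
qed (use assms solves_dom solves_cont in auto)

subsection \<open>The Dirichlet problem\<close>

lemma dirichlet_ex:
  assumes "continuous_on SG f" shows "\<exists>u. solves u f \<and> (\<forall>i. u (vtx i) = b i)"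
proof -
  have "\<exists>U. \<forall>b f. continuous_on SG f \<longrightarrow> continuous_on SG (U b f) \<and> (\<forall>i. U b f (vtx i) = b i)
    \<and> (\<forall>i. \<forall>x\<in>SG. U b f (contr i x) = U (hnxt (src f) b i) (ssub i f) x)"
    by (rule source_refinement[of src, OF src_sym src_bound])
  then obtain U where U: "\<And>b f. continuous_on SG f \<Longrightarrow> continuous_on SG (U b f)"
    "\<And>b f i. continuous_on SG f \<Longrightarrow> U b f (vtx i) = b i"
    "\<And>b f i x. continuous_on SG f \<Longrightarrow> x \<in> SG \<Longrightarrow> U b f (contr i x) = U (hnxt (src f) b i) (ssub i f) x"
    by metis
  have "matched (subw w (U b f)) (ssubw w f)" if "continuous_on SG f" for w b f
    using that
  proof (induction w arbitrary: b f)
    case Nil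
    then show ?case by (simp add: matched_values U continuous_on_ssub)
  next
    case (Cons i w)
    have "matched (subw w (sub i (U b f))) (ssubw w (ssub i f)) \<longleftrightarrow>
        matched (subw w (U (hnxt (src f) b i) (ssub i f))) (ssubw w (ssub i f))"
      by (rule matched_cong) (auto simp: subw_def sub_def U Cons.prems)
    then show ?case using Cons.IH[OF continuous_on_ssub[OF Cons.prems]] by simp
  qed
  then have "solves (U b f) f" using assms U by (simp add: solves_def)
  then show ?thesis using U(2)[OF assms] by blast
qed

lemma sgi_zero [simp]: "sgi zero_fun = 0" by (rule sgi_const)

lemma H_zero [simp]: "H i zero_fun = 0" by (simp add: H_def)

lemma ssub_zero [simp]: "ssub i zero_fun = zero_fun" by (simp add: ssub_def)

lemma ssubw_zero [simp]: "ssubw w zero_fun = zero_fun" by (simp add: ssubw_def)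

lemma src_zero [simp]: "src zero_fun i j = 0" by (simp add: src_def)

lemma solves_harm: "solves (harm b) zero_fun"
proof -
  have "matched (subw w (harm b)) zero_fun" for w
  proof (induction w arbitrary: b)
    case Nil
    have "src zero_fun = (\<lambda>_ _. 0)" by (simp add: fun_eq_iff)
    then show ?case by (simp add: matched_values harm_contr)
  next
    case (Cons i w)
    have "matched (subw w (sub i (harm b))) zero_fun \<longleftrightarrow> matched (subw w (harm (hnxt (\<lambda>_ _. 0) b i))) zero_fun"
      by (rule matched_cong) (auto simp: subw_def sub_def harm_contr)
    then show ?case using Cons.IH by simp
  qed
  then show ?thesis by (simp add: solves_def continuous_on_harm)
qed

lemma solves_hb: "solves (hb i) zero_fun"
  unfolding hb_def by (rule solves_harm)

lemma harm_dom: "harm b \<in> dom_energy" and hb_dom: "hb i \<in> dom_energy"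
  using solves_dom solves_harm solves_hb by blast+

lemma solves_zero_boundary:
  assumes "solves u zero_fun" "\<And>i. u (vtx i) = 0" "x \<in> SG"
  shows "u x = 0"
proof (rule eq_on_SG[OF _ continuous_on_const _ assms(3)])
  show "continuous_on SG u" using assms(1) solves_cont by blast
  fix w
  show "u (word_map w (vtx 0)) = 0"
    using assms(1,2)
  proof (induction w arbitrary: u)
    case (Cons i w)
    have "matched u zero_fun" using Cons.prems(1) solves_iff by blast
    then have "u (contr i (vtx j)) = 0" for j
      using Cons.prems(2) by (cases "i = j") (auto simp: matched_values hnxt_def)
    then show ?case
      using Cons.IH[of "sub i u"] solves_sub[OF Cons.prems(1), of i] by (simp add: sub_def)
  qed simp
qed

lemma solves_unique:
  assumes "solves u f" "solves u' f" "\<And>i. u (vtx i) = u' (vtx i)" "x \<in> SG"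
  shows "u x = u' x"
proof -
  have "solves (\<lambda>x. 1 * u x + (- 1) * u' x) (\<lambda>x. 1 * f x + (- 1) * f x)"
    by (rule solves_lin[OF assms(1,2)])
  then have "solves (\<lambda>x. u x - u' x) zero_fun" by simp
  from solves_zero_boundary[OF this _ assms(4)] show ?thesis using assms(3) by simp
qed

text \<open>Where \<open>g\<close> is positive it is positive on a whole cell, so all its moments
  there are positive. At a junction of that cell two such moments would have to add up to zero, as
  the function itself contributes nothing.\<close>

lemma solves_source_nonpos:
  assumes "solves zero_fun g" "x \<in> SG" shows "g x \<le> 0"
proof (rule ccontr)
  assume n: "\<not> g x \<le> 0"
  have c: "continuous_on SG g" using assms(1) solves_cont by blast
  obtain e where e: "e > 0" "\<And>y. y \<in> SG \<Longrightarrow> dist y x < e \<Longrightarrow> dist (g y) (g x) < g x"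
    using c[unfolded continuous_on_iff, rule_format, OF assms(2), of "g x"] n by auto
  obtain w where w: "\<And>y. y \<in> cell w \<Longrightarrow> dist x y < e" using cell_in_ball[OF assms(2) e(1)] by metis
  have pos: "g (word_map w y) > 0" if "y \<in> SG" for y
  proof -
    have "dist (g (word_map w y)) (g x) < g x"
      using w[of "word_map w y"] that by (intro e(2)) (auto simp: cell_def dist_commute)
    then show ?thesis by (simp add: dist_real_def)
  qed
  have H: "H j (ssub i (ssubw w g)) > 0" for i j
    unfolding H_def
  proof (rule sgi_pos[of _ "vtx j"])
    show "continuous_on SG (\<lambda>x. ssub i (ssubw w g) x * hb j x)" by (intro continuous_intros c)
  qed (use pos hb_nonneg in \<open>auto simp: ssub_def ssubw_def less_imp_le\<close>)
  have "matched (subw w zero_fun) (ssubw w g)" using assms(1) solves_def by blast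
  then have "nder 1 (sub 0 (subw w zero_fun)) (ssub 0 (ssubw w g)) + nder 0 (sub 1 (subw w zero_fun)) (ssub 1 (ssubw w g)) = 0"
    by (simp add: matched_def)
  then have "H 1 (ssub 0 (ssubw w g)) + H 0 (ssub 1 (ssubw w g)) = 0" by (simp add: nder_def sub_def subw_def)
  then show False using H[of 1 0] H[of 0 1] by linarith
qed

lemma solves_source_unique:
  assumes "solves u f" "solves u' f'" "\<And>x. x \<in> SG \<Longrightarrow> u x = u' x" "x \<in> SG"
  shows "f x = f' x"
proof -
  have s: "solves (\<lambda>x. a * u x + (- a) * u' x) (\<lambda>x. a * f x + (- a) * f' x)" for a
    by (rule solves_lin[OF assms(1,2)])
  have "solves zero_fun (\<lambda>x. a * f x + (- a) * f' x)" for a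
    using s[of a] by (subst solves_cong[where u' = "\<lambda>x. a * u x + (- a) * u' x"]) (auto simp: assms(3))
  from solves_source_nonpos[OF this[of 1] assms(4)] solves_source_nonpos[OF this[of "- 1"] assms(4)]
  show ?thesis by simp
qed

subsection \<open>The weak formulation implies the matching conditions\<close>

lemma energy_hb: "energy u (hb i) = 2 * u (vtx i) - u (vtx (i + 1)) - u (vtx (i - 1))" if "continuous_on SG u"
proof -
  have "energy u (hb i) = (\<Sum>j\<in>UNIV. nder j (hb i) zero_fun * u (vtx j))"
    unfolding energy_sym[of u] Gauss_Green[OF solves_hb that] by (simp add: sgi_const)
  also have "\<dots> = 2 * u (vtx i) - u (vtx (i + 1)) - u (vtx (i - 1))"
    using exh_3[of i] by (auto simp: sum_UNIV_3 nder_def)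
  finally show ?thesis .
qed

lemma glue_dom:
  assumes "\<And>i j. i \<noteq> j \<Longrightarrow> g i (vtx j) = g j (vtx i)" "\<And>i. g i \<in> dom_energy"
  shows "glue g \<in> dom_energy"
proof (rule dom_pieces)
  show "continuous_on SG (glue g)" using assms by (intro continuous_on_glue dom_cont)
  show "sub i (glue g) \<in> dom_energy" for i
    using assms(2)[of i] by (subst dom_cong[where u' = "g i"]) (auto simp: sub_def glue_contr assms(1))
qed

lemma zero_dom: "zero_fun \<in> dom_energy"
  using dom_mult[OF hb_dom[of 0], of 0] by simp

lemma energy_zero: "u \<in> dom_energy \<Longrightarrow> energy u zero_fun = 0"
  using energy_mult2[OF zero_dom, of u 0] by simp

text \<open>The weak formulation tested with a glued function; the last condition on
  \<open>g\<close> makes it vanish on the boundary. The factor 5 is the energy factor 5/3 divided by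
  the measure factor 1/3.\<close>

lemma weak_glue:
  assumes L: "has_laplacian u f"
    and g: "\<And>i j. i \<noteq> j \<Longrightarrow> g i (vtx j) = g j (vtx i)" "\<And>i. g i \<in> dom_energy" "\<And>i. g i (vtx i) = 0"
  shows "5 * (\<Sum>i\<in>UNIV. energy (sub i u) (g i)) = - (\<Sum>i\<in>UNIV. sgi (\<lambda>x. sub i f x * g i x))"
proof -
  have u: "u \<in> dom_energy" and f: "continuous_on SG f" using L by (auto simp: has_laplacian_def)
  have gd: "glue g \<in> dom_energy" using g by (intro glue_dom) auto
  have "glue g (vtx i) = 0" for i
    using glue_contr[of g "vtx i" i] g by simp
  then have "energy u (glue g) = - sgi (\<lambda>x. f x * glue g x)"
    using L gd by (simp add: has_laplacian_def V_0 sgi_def)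
  moreover have "energy u (glue g) = 5 / 3 * (\<Sum>i\<in>UNIV. energy (sub i u) (g i))"
  proof -
    have "energy (sub i u) (sub i (glue g)) = energy (sub i u) (g i)" for i
      by (rule energy_cong) (auto simp: sub_def glue_contr g)
    then show ?thesis using energy_self_similar[OF u gd] by simp
  qed
  moreover have "sgi (\<lambda>x. f x * glue g x) = (\<Sum>i\<in>UNIV. sgi (\<lambda>x. sub i f x * g i x)) / 3"
  proof -
    have "continuous_on SG (\<lambda>x. f x * glue g x)" by (intro continuous_intros f dom_cont gd)
    moreover have "sgi (\<lambda>x. f (contr i x) * glue g (contr i x)) = sgi (\<lambda>x. sub i f x * g i x)" for i
      by (rule sgi_cong) (auto simp: sub_def glue_contr g)
    ultimately show ?thesis by (subst sgi_self_similar) auto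
  qed
  ultimately show ?thesis by simp
qed

lemma has_laplacian_sub:
  assumes L: "has_laplacian u f" shows "has_laplacian (sub i u) (ssub i f)"
  unfolding has_laplacian_def
proof (intro conjI ballI impI)
  show "sub i u \<in> dom_energy" "continuous_on SG (ssub i f)"
    using L by (auto simp: has_laplacian_def intro: dom_sub continuous_on_ssub)
  fix v assume v: "v \<in> dom_energy" "\<forall>x\<in>V 0. v x = 0"
  then have v0: "v (vtx j) = 0" for j by (auto simp: V_0)
  define g where "g j = (if j = i then v else zero_fun)" for j
  have "5 * (\<Sum>j\<in>UNIV. energy (sub j u) (g j)) = - (\<Sum>j\<in>UNIV. sgi (\<lambda>x. sub j f x * g j x))"
    by (rule weak_glue[OF L]) (auto simp: g_def v0 v zero_dom)
  moreover have "energy (sub j u) (g j) = (if j = i then energy (sub i u) v else 0)" for j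
    using energy_zero[OF dom_sub, of u j] L by (simp add: g_def has_laplacian_def)
  moreover have "sgi (\<lambda>x. sub j f x * g j x) = (if j = i then sgi (\<lambda>x. sub i f x * v x) else 0)" for j
    by (simp add: g_def sgi_const)
  ultimately have "5 * energy (sub i u) v = - sgi (\<lambda>x. sub i f x * v x)" by simp
  moreover have "sgi (\<lambda>x. ssub i f x * v x) = sgi (\<lambda>x. sub i f x * v x) / 5"
    using sgi_mult[of "1 / 5" "\<lambda>x. sub i f x * v x"] by (simp add: ssub_def sub_def)
  ultimately show "energy (sub i u) v = - (LINT x|SG_measure. ssub i f x * v x)"
    by (simp add: sgi_def[symmetric])
qed

text \<open>The test function is a tent at the junction of the cells \<open>a\<close> and
  \<open>b\<close>: harmonic on each of them, 1 at the junction, 0 at their other corners and on the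
  third cell. Testing with it isolates the two normal derivatives that meet there.\<close>

lemma has_laplacian_matched:
  assumes L: "has_laplacian u f" shows "matched u f"
  unfolding matched_def
proof (intro allI impI)
  fix a b :: 3 assume ab: "a \<noteq> b"
  have u: "u \<in> dom_energy" and f: "continuous_on SG f" using L by (auto simp: has_laplacian_def)
  define g where "g i = (if i = a then hb b else if i = b then hb a else zero_fun)" for i
  have "5 * (\<Sum>i\<in>UNIV. energy (sub i u) (g i)) = - (\<Sum>i\<in>UNIV. sgi (\<lambda>x. sub i f x * g i x))"
    by (rule weak_glue[OF L]) (use ab in \<open>auto simp: g_def hb_dom zero_dom\<close>)
  moreover have "(\<Sum>i\<in>UNIV. h i) = h a + h b + (\<Sum>i\<in>UNIV - {a, b}. h i)" for h :: "3 \<Rightarrow> real"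
    using ab sum.subset_diff[of "{a, b}" UNIV h] by simp
  moreover have "energy (sub i u) (g i) = 0 \<and> sgi (\<lambda>x. sub i f x * g i x) = 0" if "i \<in> UNIV - {a, b}" for i
    using that energy_zero[OF dom_sub[OF u], of i] by (simp add: g_def)
  ultimately have "5 * (energy (sub a u) (hb b) + energy (sub b u) (hb a))
      = - (sgi (\<lambda>x. sub a f x * hb b x) + sgi (\<lambda>x. sub b f x * hb a x))"
    using ab by (simp add: g_def)
  then show "nder b (sub a u) (ssub a f) + nder a (sub b u) (ssub b f) = 0"
    unfolding energy_hb[OF continuous_on_sub[OF dom_cont[OF u]]]
    by (simp add: nder_def H_ssub flip: H_def)
qed

lemma has_laplacian_iff: "has_laplacian u f \<longleftrightarrow> solves u f"
proof
  assume L: "has_laplacian u f"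
  have "matched (subw w u) (ssubw w f)" for w
    using L
  proof (induction w arbitrary: u f)
    case Nil then show ?case by (simp add: has_laplacian_matched)
  next
    case (Cons i w) then show ?case using has_laplacian_sub by simp
  qed
  then show "solves u f" using L by (auto simp: solves_def has_laplacian_def dom_cont)
qed (rule solves_has_laplacian)

section \<open>Reflection symmetry\<close>

definition rf :: "3 \<Rightarrow> (real ^ 2 \<Rightarrow> real) \<Rightarrow> real ^ 2 \<Rightarrow> real" where
  "rf c u = (\<lambda>x. u (reflect c x))"

lemma continuous_on_rf [continuous_intros]: "continuous_on SG u \<Longrightarrow> continuous_on SG (rf c u)"
  unfolding rf_def by (rule continuous_on_SG_reflect)

lemma sub_rf: "sub i (rf c u) = rf c (sub (c - i) u)"
  by (simp add: sub_def rf_def reflect_contr)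

lemma ssub_rf: "ssub i (rf c u) = rf c (ssub (c - i) u)"
  by (simp add: ssub_def rf_def reflect_contr)

lemma rf_rf [simp]: "rf c (rf c u) = u"
  by (simp add: rf_def)

text \<open>After \<open>m\<close> subdivisions the reflection only permutes cells, up to a
  reflection inside each, so the two integrals differ by at most the oscillation of \<open>g\<close>
  on cells of level \<open>m\<close>.\<close>

lemma sgi_rf: assumes "continuous_on SG g" shows "sgi (rf c g) = sgi g"
proof -
  have bound: "\<bar>sgi (rf c g) - sgi g\<bar> \<le> e" if "continuous_on SG g" "osc_le m g e" for m e g
    using that
  proof (induction m arbitrary: g)
    case 0
    have "sgi (rf c g) - sgi g = sgi (\<lambda>x. rf c g x - g x)"
      using 0 by (simp add: sgi_diff continuous_on_rf)
    also have "\<bar>\<dots>\<bar> \<le> e"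
    proof (rule sgi_bound)
      show "\<bar>rf c g x - g x\<bar> \<le> e" if "x \<in> SG" for x
        using 0(2)[unfolded osc_le_def, rule_format, of "[]" "reflect c x" x] that by (simp add: rf_def)
    qed (intro continuous_intros 0)
    finally show ?case .
  next
    case (Suc m)
    have "sgi (rf c g) = (\<Sum>i\<in>UNIV. sgi (rf c (sub (c - i) g))) / 3"
      unfolding sgi_sub[OF continuous_on_rf[OF Suc.prems(1)]] sub_rf ..
    also have "(\<Sum>i\<in>UNIV. sgi (rf c (sub (c - i) g))) = (\<Sum>i\<in>UNIV. sgi (rf c (sub i g)))"
      by (rule sum_reflect)
    finally have "sgi (rf c g) - sgi g = (\<Sum>i\<in>UNIV. sgi (rf c (sub i g)) - sgi (sub i g)) / 3"
      using sgi_sub[OF Suc.prems(1)] by (simp add: sum_subtractf diff_divide_distrib)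
    moreover have "\<bar>sgi (rf c (sub i g)) - sgi (sub i g)\<bar> \<le> e" for i
      using Suc by (intro Suc.IH continuous_on_sub osc_le_sub) auto
    from this[of 0] this[of 1] this[of 2]
    have "\<bar>(\<Sum>i\<in>UNIV. sgi (rf c (sub i g)) - sgi (sub i g)) / 3\<bar> \<le> e" by (simp add: sum_UNIV_3)
    ultimately show ?case by simp
  qed
  have "\<bar>sgi (rf c g) - sgi g\<bar> \<le> 0 + e" if "e > 0" for e
    using bound[OF assms] osc_le_eventually[OF assms that] by auto
  then have "\<bar>sgi (rf c g) - sgi g\<bar> \<le> 0" by (rule field_le_epsilon)
  then show ?thesis by simp
qed

lemma harm_reflect: assumes "x \<in> SG" shows "harm b (reflect c x) = harm (\<lambda>j. b (c - j)) x"
proof (rule eq_on_SG[OF _ _ _ assms])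
  show "continuous_on SG (\<lambda>x. harm b (reflect c x))" by (rule continuous_on_SG_reflect[OF continuous_on_harm])
  fix w show "harm b (reflect c (word_map w (vtx 0))) = harm (\<lambda>j. b (c - j)) (word_map w (vtx 0))"
  proof (induction w arbitrary: b)
    case (Cons i w)
    have "b (c - 0) + b (c - 1) + b (c - 2) = b 0 + b 1 + b 2" using exh_3[of c] by auto
    then have "(\<lambda>j. hnxt (\<lambda>_ _. 0) b (c - i) (c - j)) = hnxt (\<lambda>_ _. 0) (\<lambda>j. b (c - j)) i"
      by (auto simp: hnxt_def fun_eq_iff)
    then show ?case by (simp add: reflect_contr harm_contr Cons.IH)
  qed simp
qed (rule continuous_on_harm)

lemma hb_reflect: assumes "x \<in> SG" shows "hb i (reflect c x) = hb (c - i) x"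
proof -
  have "(\<lambda>j. of_bool (c - j = i)) = (\<lambda>j. of_bool (j = c - i) :: real)" by (simp add: minus_index_eq_iff)
  then show ?thesis unfolding hb_def harm_reflect[OF assms] by simp
qed

lemma H_rf: assumes "continuous_on SG f" shows "H i (rf c f) = H (c - i) f"
proof -
  have "H i (rf c f) = sgi (rf c (\<lambda>x. f x * hb (c - i) x))"
    unfolding H_def by (rule sgi_cong) (simp add: rf_def hb_reflect)
  also have "\<dots> = H (c - i) f" unfolding H_def by (intro sgi_rf continuous_intros assms)
  finally show ?thesis .
qed

lemma nder_rf: assumes "continuous_on SG f" shows "nder i (rf c u) (rf c f) = nder (c - i) u f"
  using exh_3[of i] exh_3[of c] by (elim disjE) (simp_all add: nder_def H_rf[OF assms], simp_all add: rf_def)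

lemma matched_rf: assumes "continuous_on SG f" "matched u f" shows "matched (rf c u) (rf c f)"
  unfolding matched_def
proof (intro allI impI)
  fix i j :: 3 assume "i \<noteq> j"
  then have "c - i \<noteq> c - j" by simp
  then show "nder j (sub i (rf c u)) (ssub i (rf c f)) + nder i (sub j (rf c u)) (ssub j (rf c f)) = 0"
    unfolding sub_rf ssub_rf nder_rf[OF continuous_on_ssub[OF assms(1)]] using assms(2) by (simp add: matched_def)
qed

lemma solves_rf: assumes "solves u f" shows "solves (rf c u) (rf c f)"
proof -
  have "matched (subw w (rf c u)) (ssubw w (rf c f))" for w
    using assms
  proof (induction w arbitrary: u f)
    case Nil
    have "matched u f" "continuous_on SG f" using Nil solves_iff by blast+
    then show ?case by (simp add: matched_rf)
  next
    case (Cons i w)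
    then show ?case using Cons.IH[OF solves_sub[OF Cons.prems]] by (simp add: sub_rf ssub_rf)
  qed
  then show ?thesis using solves_cont[OF assms] by (simp add: solves_def continuous_on_rf)
qed

lemma GE_rf: "GE m (rf c u) (rf c v) = GE m u v"
proof (induction m arbitrary: u v)
  case 0
  show ?case using exh_3[of c] by (elim disjE) (simp_all add: E0_eq rf_def algebra_simps)
next
  case (Suc m)
  show ?case unfolding GE.simps sub_rf Suc.IH using sum_reflect[of "\<lambda>i. GE m (sub i u) (sub i v)" c] by simp
qed

lemma energy_rf: "energy (rf c u) (rf c v) = energy u v"
  by (simp add: energy_def graph_energy_eq GE_rf)

lemma dom_rf: "u \<in> dom_energy \<Longrightarrow> rf c u \<in> dom_energy"
  by (simp add: dom_energy_iff GE_rf continuous_on_rf)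

section \<open>Jets at a vertex\<close>

lemma funpow_sub: "(sub i ^^ m) u = (\<lambda>x. u ((contr i ^^ m) x))"
  by (induction m) (auto simp: sub_def funpow_swap1 simp del: funpow.simps(2), simp add: sub_def funpow_swap1)

lemma funpow_solves: "solves u f \<Longrightarrow> solves ((sub i ^^ m) u) ((ssub i ^^ m) f)"
  by (induction m) (auto intro: solves_sub)

lemma funpow_contr_vtx: "(contr i ^^ m) (vtx i) = vtx i"
  by (induction m) auto

lemma nder_funpow:
  assumes "solves u f"
  shows "nder i u f = (5 / 3) ^ m * nder i ((sub i ^^ m) u) ((ssub i ^^ m) f)"
proof (induction m)
  case (Suc m)
  have "continuous_on SG ((ssub i ^^ m) f)" "matched ((sub i ^^ m) u) ((ssub i ^^ m) f)"
    using funpow_solves[OF assms, of m i] solves_iff by blast+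
  from nder_rec[OF this, of i] show ?case using Suc by simp
qed simp

lemma snorm_funpow_ssub: "continuous_on SG f \<Longrightarrow> snorm ((ssub i ^^ m) f) \<le> snorm f / 5 ^ m"
proof (induction m arbitrary: f)
  case (Suc m)
  have "snorm ((ssub i ^^ Suc m) f) \<le> snorm (ssub i f) / 5 ^ m"
    using Suc.IH[OF continuous_on_ssub[OF Suc.prems, of i]] by (simp add: funpow_swap1)
  also have "\<dots> \<le> snorm f / 5 / 5 ^ m" using snorm_ssub[OF Suc.prems] by (intro divide_right_mono) auto
  finally show ?case by simp
qed simp

text \<open>By the recursion the finite difference at level \<open>m\<close> misses
  \<open>nder i u f\<close> exactly by \<open>(5 / 3) ^ m\<close> times a moment of the rescaled
  source, and that moment is of order \<open>5 ^ (- m)\<close>.\<close>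

lemma solves_normal_deriv:
  assumes "solves u f" shows "has_normal_deriv u (nder i u f) i"
proof -
  have f: "continuous_on SG f" by (rule solves_cont(2)[OF assms])
  have e: "(5 / 3) ^ m * (2 * u (vtx i) - u ((contr i ^^ m) (vtx (i + 1))) - u ((contr i ^^ m) (vtx (i - 1))))
    = nder i u f - (5 / 3) ^ m * H i ((ssub i ^^ m) f)" for m
    using nder_funpow[OF assms, of i m, unfolded nder_def[of i "(sub i ^^ m) u"]]
    by (simp add: funpow_sub funpow_contr_vtx algebra_simps)
  have "(\<lambda>m. (5 / 3) ^ m * H i ((ssub i ^^ m) f)) \<longlonglongrightarrow> 0"
  proof (rule Lim_null_comparison)
    have "\<bar>(5 / 3) ^ m * H i ((ssub i ^^ m) f)\<bar> \<le> (1 / 3) ^ m * snorm f" for m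
    proof -
      have "\<bar>H i ((ssub i ^^ m) f)\<bar> \<le> snorm f / 5 ^ m"
        using H_bound[of "(ssub i ^^ m) f" i] solves_cont(2)[OF funpow_solves[OF assms]] snorm_funpow_ssub[OF f, of m i] by fastforce
      then have "(5 / 3) ^ m * \<bar>H i ((ssub i ^^ m) f)\<bar> \<le> (5 / 3) ^ m * (snorm f / 5 ^ m)" by (intro mult_left_mono) auto
      also have "\<dots> = (1 / 3) ^ m * snorm f" by (simp add: power_divide)
      finally show ?thesis by (simp add: abs_mult)
    qed
    then show "eventually (\<lambda>m. norm ((5 / 3) ^ m * H i ((ssub i ^^ m) f)) \<le> (1 / 3) ^ m * snorm f) sequentially"
      by (simp add: always_eventually)
    show "(\<lambda>m. (1 / 3) ^ m * snorm f) \<longlonglongrightarrow> 0"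
      by (intro tendsto_mult_left_zero LIMSEQ_power_zero) auto
  qed
  then show ?thesis unfolding has_normal_deriv_def e by (auto intro: tendsto_eq_intros)
qed

text \<open>If \<open>\<Delta> u = f\<close>, then five times the difference of the values of \<open>u\<close> at the two neighbours of \<open>q\<^sub>0\<close>
  changes by \<open>- kap f\<close> when passing to the next level; as \<open>kap\<close> kills constants, the resulting
  series for the tangential derivative converges for sources of finite energy.\<close>

definition kap :: "(real ^ 2 \<Rightarrow> real) \<Rightarrow> real" where
  "kap f = src f 0 1 - src f 0 2"

lemma kap_lin:
  assumes "continuous_on SG f" "continuous_on SG g"
  shows "kap (\<lambda>x. a * f x + b * g x) = a * kap f + b * kap g"
proof -
  have "ssub i (\<lambda>x. a * f x + b * g x) = (\<lambda>x. a * ssub i f x + b * ssub i g x)" for i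
    by (simp add: ssub_def add_divide_distrib)
  then show ?thesis
    unfolding kap_def src_def by (simp add: H_lin continuous_on_ssub assms algebra_simps)
qed

lemma H_const: "H i (\<lambda>x. a) = H j (\<lambda>x. a)"
  using H_rf[OF continuous_on_const, of i "i + j" a] by (simp add: rf_def)

lemma kap_const: "kap (\<lambda>x. a) = 0"
  unfolding kap_def src_def ssub_def
  using H_const[of 1 "a / 5" 2] by simp

lemma kap_bound:
  assumes f: "continuous_on SG f" and B: "\<And>x. x \<in> SG \<Longrightarrow> \<bar>f x - f (vtx 0)\<bar> \<le> B"
  shows "\<bar>kap f\<bar> \<le> B"
proof -
  define g where "g x = f x - f (vtx 0)" for x
  have g: "continuous_on SG g" unfolding g_def by (intro continuous_intros f)
  have "snorm g \<le> B" using B by (intro snorm_least) (simp add: g_def)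
  moreover have "kap g = kap f"
    using kap_lin[OF f continuous_on_const[of SG 1], of 1 "- f (vtx 0)"] kap_const[of 1] by (simp add: g_def[abs_def])
  moreover have "\<bar>kap g\<bar> \<le> 4 / 5 * snorm g"
    using src_bound[OF g, of 0 1] src_bound[OF g, of 0 2] unfolding kap_def by linarith
  ultimately show ?thesis using snorm_nonneg[OF g] by linarith
qed

lemma kap_funpow_bound:
  assumes "f \<in> dom_energy" shows "\<bar>kap ((sub 0 ^^ m) f)\<bar> \<le> 10 * enorm f * (4 / 5) ^ m"
proof (rule kap_bound)
  show "continuous_on SG ((sub 0 ^^ m) f)" by (induction m) (auto intro: continuous_on_sub dom_cont assms)
  fix x assume x: "x \<in> SG"
  have "\<bar>f ((contr 0 ^^ m) x) - f ((contr 0 ^^ m) (vtx 0))\<bar> \<le> 10 * sqrt (3 / 5) ^ m * enorm f"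
    using energy_osc_cell[OF assms x vtx_SG, of "replicate m 0" 0] by (simp add: word_map_replicate)
  also have "\<dots> \<le> 10 * (4 / 5) ^ m * enorm f"
    using enorm_nonneg[OF assms] by (intro mult_right_mono mult_left_mono power_mono real_le_lsqrt) (auto simp: power2_eq_square)
  finally show "\<bar>(sub 0 ^^ m) f x - (sub 0 ^^ m) f (vtx 0)\<bar> \<le> 10 * enorm f * (4 / 5) ^ m"
    by (simp add: funpow_sub mult_ac)
qed

definition Kap :: "(real ^ 2 \<Rightarrow> real) \<Rightarrow> real" where
  "Kap f = (\<Sum>m. kap ((sub 0 ^^ m) f))"

lemma Kap_summable: "f \<in> dom_energy \<Longrightarrow> summable (\<lambda>m. kap ((sub 0 ^^ m) f))"
  by (rule summable_comparison_test[of _ "\<lambda>m. 10 * enorm f * (4 / 5) ^ m"])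
    (auto intro!: exI[of _ 0] kap_funpow_bound summable_mult summable_geometric)

lemma Kap_bound: assumes "f \<in> dom_energy" shows "\<bar>Kap f\<bar> \<le> 50 * enorm f"
proof -
  have s: "(\<lambda>m. 10 * enorm f * (4 / 5) ^ m) sums (10 * enorm f * (1 / (1 - 4 / 5)))"
    by (intro sums_mult geometric_sums) simp
  have "norm (Kap f) \<le> (\<Sum>m. 10 * enorm f * (4 / 5) ^ m)"
    unfolding Kap_def by (rule norm_suminf_le) (use kap_funpow_bound[OF assms] s in \<open>auto simp: sums_iff\<close>)
  also have "\<dots> = 50 * enorm f" using s by (simp add: sums_iff)
  finally show ?thesis by simp
qed

text \<open>The summand \<open>0 * f (vtx 0)\<close> gives the right-hand side the shape of a linear
  combination with a constant, to which \<open>kap_lin\<close> and \<open>kap_const\<close> apply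
  directly.\<close>

lemma ssub_funpow: "(ssub i ^^ m) f = (\<lambda>x. 1 / 5 ^ m * (sub i ^^ m) f x + 0 * f (vtx 0))"
proof (induction m)
  case (Suc m)
  have "(ssub i ^^ Suc m) f = ssub i ((ssub i ^^ m) f)" by simp
  also have "\<dots> = (\<lambda>x. 1 / 5 ^ Suc m * (sub i ^^ Suc m) f x + 0 * f (vtx 0))"
    unfolding Suc by (simp add: ssub_def sub_def mult.commute)
  finally show ?case .
qed simp

lemma solves_tangential_deriv:
  assumes "solves u f" "f \<in> dom_energy"
  shows "has_tangential_deriv u (u (vtx 1) - u (vtx 2) - Kap f) 0"
proof -
  let ?t = "\<lambda>m. 5 ^ m * (u ((contr 0 ^^ m) (vtx 1)) - u ((contr 0 ^^ m) (vtx 2)))"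
  have t: "?t m = u (vtx 1) - u (vtx 2) - (\<Sum>l<m. kap ((sub 0 ^^ l) f))" for m
  proof (induction m)
    case (Suc m)
    have s: "solves ((sub 0 ^^ m) u) ((ssub 0 ^^ m) f)" by (rule funpow_solves[OF assms(1)])
    let ?u = "(sub 0 ^^ m) u" and ?f = "(ssub 0 ^^ m) f"
    have "matched ?u ?f" using s solves_iff by blast
    then have "?u (contr 0 (vtx 1)) = hnxt (src ?f) (\<lambda>i. ?u (vtx i)) 0 1"
      "?u (contr 0 (vtx 2)) = hnxt (src ?f) (\<lambda>i. ?u (vtx i)) 0 2"
      unfolding matched_values by simp_all
    then have "5 * (?u (contr 0 (vtx 1)) - ?u (contr 0 (vtx 2))) = ?u (vtx 1) - ?u (vtx 2) - kap ?f"
      by (simp add: hnxt_def kap_def field_simps)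
    moreover have "kap ?f = kap ((sub 0 ^^ m) f) / 5 ^ m"
    proof -
      have "continuous_on SG ((sub 0 ^^ m) f)" by (induction m) (auto intro: continuous_on_sub dom_cont assms)
      then show ?thesis unfolding ssub_funpow by (subst kap_lin) (auto simp: kap_const)
    qed
    ultimately have "?t (Suc m) = ?t m - kap ((sub 0 ^^ m) f)"
      by (simp add: funpow_sub funpow_swap1 field_simps)
    then show ?case using Suc by simp
  qed simp
  have "(\<lambda>m. u (vtx 1) - u (vtx 2) - (\<Sum>l<m. kap ((sub 0 ^^ l) f))) \<longlonglongrightarrow> u (vtx 1) - u (vtx 2) - Kap f"
    unfolding Kap_def by (intro tendsto_intros summable_LIMSEQ Kap_summable assms)
  then have "?t \<longlonglongrightarrow> u (vtx 1) - u (vtx 2) - Kap f" unfolding t .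
  then show ?thesis by (simp add: has_tangential_deriv_def)
qed

definition jets :: "(real ^ 2 \<Rightarrow> real) \<Rightarrow> (real ^ 2 \<Rightarrow> real) \<Rightarrow> real \<Rightarrow> real \<Rightarrow> real \<Rightarrow> bool" where
  "jets u f v d t \<longleftrightarrow> solves u f \<and> u (vtx 0) = v \<and> nder 0 u f = d \<and> has_tangential_deriv u t 0"

lemma jets_tangential:
  assumes "jets u f v d t" "f \<in> dom_energy"
  shows "t = u (vtx 1) - u (vtx 2) - Kap f"
  using assms solves_tangential_deriv[of u f] LIMSEQ_unique unfolding jets_def has_tangential_deriv_def by blast

text \<open>Value and normal derivative at \<open>vtx 0\<close> fix the sum \<open>s\<close> of the
  other two boundary values, and the tangential derivative fixes their difference \<open>e\<close>.
  The initial value problem thus becomes a Dirichlet problem; finite energy of \<open>f\<close>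
  ensures that \<open>Kap f\<close> converges.\<close>

lemma jets_ex:
  assumes f: "f \<in> dom_energy" shows "\<exists>u. jets u f v d t"
proof -
  define s where "s = 2 * v - d + H 0 f"
  define e where "e = t + Kap f"
  obtain u where u: "solves u f" "\<And>i. u (vtx i) = (if i = 0 then v else if i = 1 then (s + e) / 2 else (s - e) / 2)"
    using dirichlet_ex[OF dom_cont[OF f], of "\<lambda>i. if i = 0 then v else if i = 1 then (s + e) / 2 else (s - e) / 2"] by blast
  have "nder 0 u f = d" by (simp add: nder_def u(2) s_def field_simps)
  moreover have "u (vtx 1) - u (vtx 2) - Kap f = t" by (simp add: u(2) e_def field_simps)
  ultimately show ?thesis
    using u solves_tangential_deriv[OF u(1) f] unfolding jets_def by auto
qed

lemma jets_unique:
  assumes "jets u f v d t" "jets u' f v d t" "f \<in> dom_energy" "x \<in> SG"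
  shows "u x = u' x"
proof (rule solves_unique[OF _ _ _ assms(4)])
  show "solves u f" "solves u' f" using assms by (auto simp: jets_def)
  have 1: "u (vtx 0) = u' (vtx 0)" "nder 0 u f = nder 0 u' f" using assms by (auto simp: jets_def)
  moreover have "u (vtx 1) - u (vtx 2) = u' (vtx 1) - u' (vtx 2)"
    using jets_tangential[OF assms(1,3)] jets_tangential[OF assms(2,3)] by simp
  ultimately show "u (vtx i) = u' (vtx i)" for i using exh_3[of i] by (auto simp: nder_def)
qed

lemma has_normal_deriv_cong:
  "(\<And>x. x \<in> SG \<Longrightarrow> u x = u' x) \<Longrightarrow> has_normal_deriv u d i \<longleftrightarrow> has_normal_deriv u' d i"
  by (simp add: has_normal_deriv_def)

lemma has_tangential_deriv_cong:
  "(\<And>x. x \<in> SG \<Longrightarrow> u x = u' x) \<Longrightarrow> has_tangential_deriv u d i \<longleftrightarrow> has_tangential_deriv u' d i"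
  by (simp add: has_tangential_deriv_def)

lemma jets_cong:
  assumes "\<And>x. x \<in> SG \<Longrightarrow> u x = u' x" "\<And>x. x \<in> SG \<Longrightarrow> f x = f' x"
  shows "jets u f v d t \<longleftrightarrow> jets u' f' v d t"
proof -
  have "solves u f \<longleftrightarrow> solves u' f'" by (rule solves_cong[OF assms])
  moreover have "nder 0 u f = nder 0 u' f'" by (rule nder_cong[OF assms])
  moreover have "has_tangential_deriv u t 0 \<longleftrightarrow> has_tangential_deriv u' t 0"
    by (rule has_tangential_deriv_cong[OF assms(1)])
  moreover have "u (vtx 0) = u' (vtx 0)" using assms(1) by simp
  ultimately show ?thesis unfolding jets_def by metis
qed

subsection \<open>Existence and uniqueness of the monomials\<close>

text \<open>The monomials with the kind \<open>k\<close> as first argument, so that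
  \<open>mon k\<close> is a sequence in which each member is obtained from its predecessor by
  inverting the Laplacian with zero jets.\<close>

primrec mon :: "nat \<Rightarrow> nat \<Rightarrow> real ^ 2 \<Rightarrow> real" where
  "mon k 0 = (SOME u. jets u zero_fun (of_bool (k = 1)) (of_bool (k = 2)) (of_bool (k = 3)))"
| "mon k (Suc j) = (SOME u. jets u (mon k j) 0 0 0)"

declare mon.simps [simp del]

lemma mon_0: "jets (mon k 0) zero_fun (of_bool (k = 1)) (of_bool (k = 2)) (of_bool (k = 3))"
  unfolding mon.simps(1) by (rule someI_ex[OF jets_ex[OF zero_dom]])

lemma jets_dom: "jets u f v d t \<Longrightarrow> u \<in> dom_energy"
  using solves_dom unfolding jets_def by blast

lemma mon_dom: "mon k j \<in> dom_energy"
proof (induction j)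
  case 0 show ?case by (rule jets_dom[OF mon_0])
next
  case (Suc j)
  show ?case unfolding mon.simps(2) by (rule jets_dom[OF someI_ex[OF jets_ex[OF Suc]]])
qed

lemma mon_Suc: "jets (mon k (Suc j)) (mon k j) 0 0 0"
  unfolding mon.simps(2) by (rule someI_ex[OF jets_ex[OF mon_dom]])

definition monc :: "nat \<Rightarrow> nat \<Rightarrow> nat \<Rightarrow> real ^ 2 \<Rightarrow> real" where
  "monc k j n = (if n \<le> j then mon k (j - n) else zero_fun)"

lemma monc_jets:
  assumes "n \<le> j"
  shows "jets (monc k j n) (monc k j (Suc n)) (of_bool (n = j \<and> k = 1)) (of_bool (n = j \<and> k = 2)) (of_bool (n = j \<and> k = 3))"
proof (cases "n = j")
  case True then show ?thesis using mon_0[of k] by (simp add: monc_def)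
next
  case False
  then have "j - n = Suc (j - Suc n)" using assms by simp
  then show ?thesis using mon_Suc[of k "j - Suc n"] False assms by (simp add: monc_def)
qed

lemma monc_dom: "monc k j n \<in> dom_energy"
  by (simp add: monc_def mon_dom zero_dom)

lemma has_laplacian_pow_unique:
  assumes "(has_laplacian ^^ n) u g" "(has_laplacian ^^ n) u' g'" "\<And>x. x \<in> SG \<Longrightarrow> u x = u' x" "x \<in> SG"
  shows "g x = g' x"
  using assms(1,2,4)
proof (induction n arbitrary: g g' x)
  case 0 then show ?case using assms(3) by simp
next
  case (Suc n)
  obtain h where h: "(has_laplacian ^^ n) u h" "has_laplacian h g" using Suc.prems(1) by auto
  obtain h' where h': "(has_laplacian ^^ n) u' h'" "has_laplacian h' g'" using Suc.prems(2) by auto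
  show ?case
    using h(2) h'(2) unfolding has_laplacian_iff
    by (rule solves_source_unique) (rule Suc.IH[OF h(1) h'(1)], use Suc.prems in auto)
qed

text \<open>Descending induction along a chain of Laplacians: at the end both functions are zero,
  and the jets at \<open>vtx 0\<close> determine every earlier member from the next one. The
  defining property offers a separate witness \<open>g\<close> for each \<open>n\<close>; uniqueness
  of iterated Laplacians identifies it with the member of the chain.\<close>

lemma is_monomial_unique:
  assumes M: "is_monomial j k u" and x: "x \<in> SG"
  shows "u x = mon k j x"
proof -
  have "(has_laplacian ^^ (j + 1)) u zero_fun" using M by (simp add: is_monomial_def)
  then obtain c where c: "c 0 = u" "c (j + 1) = zero_fun" "\<And>i. i < j + 1 \<Longrightarrow> has_laplacian (c i) (c (Suc i))"
    unfolding relpowp_fun_conv by blast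
  have pow: "(has_laplacian ^^ n) u (c n)" if "n \<le> j" for n
    using that c unfolding relpowp_fun_conv by (intro exI[of _ c]) auto
  have J: "jets (c n) (c (Suc n)) (of_bool (n = j \<and> k = 1)) (of_bool (n = j \<and> k = 2)) (of_bool (n = j \<and> k = 3))" if n: "n \<le> j" for n
  proof -
    obtain g where g: "(has_laplacian ^^ n) u g" "g (vtx 0) = of_bool (n = j \<and> k = 1)"
      "has_normal_deriv g (of_bool (n = j \<and> k = 2)) 0" "has_tangential_deriv g (of_bool (n = j \<and> k = 3)) 0"
      using M n unfolding is_monomial_def by blast
    have eq: "c n y = g y" if "y \<in> SG" for y
      by (rule has_laplacian_pow_unique[OF pow[OF n] g(1) _ that]) simp
    have s: "solves (c n) (c (Suc n))" using c(3)[of n] n by (simp add: has_laplacian_iff)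
    have "has_normal_deriv (c n) (of_bool (n = j \<and> k = 2)) 0" using g(3) has_normal_deriv_cong[OF eq] by simp
    then have "nder 0 (c n) (c (Suc n)) = of_bool (n = j \<and> k = 2)"
      using solves_normal_deriv[OF s, of 0] LIMSEQ_unique unfolding has_normal_deriv_def by blast
    moreover have "has_tangential_deriv (c n) (of_bool (n = j \<and> k = 3)) 0" using g(4) has_tangential_deriv_cong[OF eq] by simp
    ultimately show ?thesis using s g(2) eq[of "vtx 0"] by (simp add: jets_def)
  qed
  have "\<forall>x\<in>SG. c n x = monc k j n x" if "n \<le> j + 1" for n
    using that
  proof (induction n rule: inc_induct)
    case base then show ?case using c(2) by (simp add: monc_def)
  next
    case (step n)
    have n: "n \<le> j" using step.hyps by simp
    show ?case
    proof
      fix x assume x: "x \<in> SG"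
      have "jets (c n) (monc k j (Suc n)) (of_bool (n = j \<and> k = 1)) (of_bool (n = j \<and> k = 2)) (of_bool (n = j \<and> k = 3))"
        using J[OF n] jets_cong[of "c n" "c n" "c (Suc n)" "monc k j (Suc n)"] step.IH by simp
      then show "c n x = monc k j n x" by (rule jets_unique[OF _ monc_jets[OF n] monc_dom x])
    qed
  qed
  from this[of 0] show ?thesis using c(1) x by (simp add: monc_def)
qed

lemma is_monomial_mon:
  assumes u: "\<And>x. x \<in> SG \<Longrightarrow> u x = mon k j x" shows "is_monomial j k u"
proof -
  \<comment> \<open>\<open>u\<close> may differ from \<open>mon k j\<close> outside
    \<open>SG\<close>, and the relational power has to start at \<open>u\<close> itself; the later
    members can be taken as they are.\<close>
  define c where "c n = (if n = 0 then u else monc k j n)" for n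
  have ceq: "c n x = monc k j n x" if "x \<in> SG" for n x using u[OF that] by (simp add: c_def monc_def)
  have J: "jets (c n) (c (Suc n)) (of_bool (n = j \<and> k = 1)) (of_bool (n = j \<and> k = 2)) (of_bool (n = j \<and> k = 3))" if "n \<le> j" for n
    using monc_jets[OF that, of k] jets_cong[OF ceq[of _ n] ceq[of _ "Suc n"]] by simp
  have pow: "(has_laplacian ^^ n) u (c n)" if "n \<le> j + 1" for n
    unfolding relpowp_fun_conv
  proof (intro exI[of _ c] conjI allI impI)
    fix i assume "i < n"
    then show "has_laplacian (c i) (c (Suc i))" using J[of i] that by (simp add: jets_def has_laplacian_iff)
  qed (auto simp: c_def)
  show ?thesis
    unfolding is_monomial_def
  proof (intro conjI allI impI)
    show "(has_laplacian ^^ (j + 1)) u (\<lambda>x. 0)" using pow[of "j + 1"] by (simp add: c_def monc_def)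
    fix n assume n: "n \<le> j"
    show "\<exists>g. (has_laplacian ^^ n) u g \<and> g (vtx 0) = of_bool (n = j \<and> k = 1) \<and>
      has_normal_deriv g (of_bool (n = j \<and> k = 2)) 0 \<and> has_tangential_deriv g (of_bool (n = j \<and> k = 3)) 0"
      using pow[of n] J[OF n] solves_normal_deriv[of "c n" "c (Suc n)" 0] n
      unfolding jets_def by (intro exI[of _ "c n"]) auto
  qed
qed

lemma monomial_eq: assumes "x \<in> SG" shows "monomial j k x = mon k j x"
proof -
  let ?M = "\<lambda>x. if x \<in> SG then mon k j x else 0"
  have "monomial j k = ?M"
    unfolding monomial_def
  proof (rule the_equality)
    show "is_monomial j k ?M \<and> (\<forall>x. x \<notin> SG \<longrightarrow> ?M x = 0)" using is_monomial_mon[of ?M] by simp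
    fix u assume "is_monomial j k u \<and> (\<forall>x. x \<notin> SG \<longrightarrow> u x = 0)"
    then show "u = ?M" using is_monomial_unique by (auto simp: fun_eq_iff)
  qed
  then show ?thesis using assms by simp
qed

section \<open>Compactness, the odd Poincare constant and Neumann eigenvalues\<close>

text \<open>There are finitely many pairs of disjoint cells of level \<open>m\<close>, all compact,
  and each pair has a positive distance. Points closer than the minimum can only lie in cells that
  meet.\<close>

lemma cells_separated:
  "\<exists>d>0. \<forall>w w' x y. length w = m \<longrightarrow> length w' = m \<longrightarrow> x \<in> cell w \<longrightarrow> y \<in> cell w' \<longrightarrow> dist x y < d \<longrightarrow> cell w \<inter> cell w' \<noteq> {}"
proof -
  define S where "S = {(w, w'). length w = m \<and> length w' = m \<and> cell w \<inter> cell w' = {}}"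
  have fW: "finite {w :: 3 list. length w = m}" using finite_lists_length_eq[of "UNIV :: 3 set" m] by simp
  have fS: "finite S" by (rule finite_subset[OF _ finite_cartesian_product[OF fW fW]]) (auto simp: S_def)
  have "\<exists>d>0. \<forall>x\<in>cell w. \<forall>y\<in>cell w'. d \<le> dist x y" if "(w, w') \<in> S" for w w'
  proof (rule separate_compact_closed)
    show "compact (cell w)" unfolding cell_def by (intro compact_continuous_image continuous_intros compact_SG)
  qed (use that in \<open>auto simp: S_def closed_cell\<close>)
  then obtain d where d: "\<And>w w'. (w, w') \<in> S \<Longrightarrow> d (w, w') > 0 \<and> (\<forall>x\<in>cell w. \<forall>y\<in>cell w'. d (w, w') \<le> dist x y)"
    by (metis (no_types, lifting) old.prod.case)
  define e where "e = Min (insert 1 (d ` S))"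
  have e: "e > 0" unfolding e_def using fS d by (subst Min_gr_iff) auto
  have le: "e \<le> d s" if "s \<in> S" for s unfolding e_def using fS that by (intro Min_le) auto
  show ?thesis
  proof (intro exI[of _ e] conjI e allI impI notI)
    fix w w' x y
    assume a: "length w = m" "length w' = m" "x \<in> cell w" "y \<in> cell w'" "dist x y < e" "cell w \<inter> cell w' = {}"
    then have s: "(w, w') \<in> S" by (simp add: S_def)
    show False using d[OF s] le[OF s] a by fastforce
  qed
qed

text \<open>Two close points lie in cells of level \<open>m\<close> with a common point. Comparing
  both with that point uses the constant 10 of \<open>energy_osc_cell\<close> twice.\<close>

lemma energy_equicontinuous:
  assumes "e > 0" "M \<ge> 0"
  shows "\<exists>d>0. \<forall>u x y. u \<in> dom_energy \<longrightarrow> enorm u \<le> M \<longrightarrow> x \<in> SG \<longrightarrow> y \<in> SG \<longrightarrow> dist x y < d \<longrightarrow> \<bar>u x - u y\<bar> < e"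
proof -
  have "sqrt (3 / 5) < 1" by simp
  then have "(\<lambda>m. 20 * M * sqrt (3 / 5) ^ m) \<longlonglongrightarrow> 0"
    by (intro tendsto_mult_right_zero LIMSEQ_power_zero) simp
  then have "eventually (\<lambda>m. 20 * M * sqrt (3 / 5) ^ m < e) sequentially"
    using assms(1) by (rule order_tendstoD(2))
  then obtain m where "20 * M * sqrt (3 / 5) ^ m < e" by (auto dest: eventually_happens)
  then have m: "20 * (sqrt (3 / 5) ^ m * M) < e" by (simp add: mult_ac)
  obtain d where d: "d > 0" "\<forall>w w' x y. length w = m \<longrightarrow> length w' = m \<longrightarrow> x \<in> cell w \<longrightarrow> y \<in> cell w' \<longrightarrow> dist x y < d \<longrightarrow> cell w \<inter> cell w' \<noteq> {}"
    using cells_separated[of m] by metis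
  show ?thesis
  proof (intro exI[of _ d] conjI d allI impI)
    fix u x y assume a: "u \<in> dom_energy" "enorm u \<le> M" "x \<in> SG" "y \<in> SG" "dist x y < d"
    obtain w x' where w: "length w = m" "x' \<in> SG" "x = word_map w x'" using SG_word[OF a(3)] by metis
    obtain v y' where v: "length v = m" "y' \<in> SG" "y = word_map v y'" using SG_word[OF a(4)] by metis
    have "cell w \<inter> cell v \<noteq> {}" using d(2) w v a(5) by (metis cell_def imageI)
    then obtain z1 z2 where z: "z1 \<in> SG" "z2 \<in> SG" "word_map w z1 = word_map v z2" by (auto simp: cell_def)
    have "\<bar>u x - u (word_map w z1)\<bar> \<le> 10 * sqrt (3 / 5) ^ m * enorm u"
      using energy_osc_cell[OF a(1) w(2) z(1), of w] w by simp
    moreover have "\<bar>u y - u (word_map v z2)\<bar> \<le> 10 * sqrt (3 / 5) ^ m * enorm u"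
      using energy_osc_cell[OF a(1) v(2) z(2), of v] v by simp
    moreover have "sqrt (3 / 5) ^ m * enorm u \<le> sqrt (3 / 5) ^ m * M" using a(2) by (intro mult_left_mono) auto
    moreover have "\<bar>u x - u y\<bar> \<le> \<bar>u x - u (word_map w z1)\<bar> + \<bar>u y - u (word_map v z2)\<bar>" using z(3) by simp
    ultimately show "\<bar>u x - u y\<bar> < e" using m unfolding mult.assoc by linarith
  qed
qed

lemma energy_compactness:
  assumes d: "\<And>n. v n \<in> dom_energy" and M: "\<And>n. enorm (v n) \<le> M" and B: "\<And>n. \<bar>v n (vtx 0)\<bar> \<le> B"
  obtains g r where "continuous_on SG g" "strict_mono (r :: nat \<Rightarrow> nat)"
    "\<And>e. e > 0 \<Longrightarrow> \<exists>N. \<forall>n\<ge>N. \<forall>x\<in>SG. \<bar>v (r n) x - g x\<bar> < e"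
proof -
  have M0: "M \<ge> 0" using M[of 0] enorm_nonneg[OF d[of 0]] by linarith
  show ?thesis
  proof (rule Arzela_Ascoli[OF compact_SG, of v "B + 5 * M"])
    show "norm (v n x) \<le> B + 5 * M" if "x \<in> SG" for n x
      using energy_osc[OF d that, of n 0] M[of n] B[of n] by simp
    fix x and e :: real assume x: "x \<in> SG" and "e > 0"
    then obtain q where q: "q > 0" "\<forall>u x y. u \<in> dom_energy \<longrightarrow> enorm u \<le> M \<longrightarrow> x \<in> SG \<longrightarrow> y \<in> SG \<longrightarrow> dist x y < q \<longrightarrow> \<bar>u x - u y\<bar> < e"
      using energy_equicontinuous[OF _ M0] by metis
    then show "\<exists>q. 0 < q \<and> (\<forall>n y. y \<in> SG \<and> norm (x - y) < q \<longrightarrow> norm (v n x - v n y) < e)"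
      using x d M by (intro exI[of _ q]) (auto simp: dist_norm)
  next
    fix g and r :: "nat \<Rightarrow> nat"
    assume "continuous_on SG g" "strict_mono r" "\<And>e. 0 < e \<Longrightarrow> \<exists>N. \<forall>n x. N \<le> n \<and> x \<in> SG \<longrightarrow> norm (v (r n) x - g x) < e"
    then show thesis using that[of g r] by (metis real_norm_def)
  qed
qed

lemma GE_tendsto:
  assumes "\<And>x. x \<in> SG \<Longrightarrow> (\<lambda>n. v n x) \<longlonglongrightarrow> g x"
  shows "(\<lambda>n. GE m (v n) (v n)) \<longlonglongrightarrow> GE m g g"
  using assms
proof (induction m arbitrary: v g)
  case 0
  then show ?case unfolding GE.simps E0_def by (intro tendsto_intros) auto
next
  case (Suc m)
  have "(\<lambda>n. GE m (sub i (v n)) (sub i (v n))) \<longlonglongrightarrow> GE m (sub i g) (sub i g)" for i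
    by (rule Suc.IH) (simp add: sub_def Suc.prems)
  then show ?case unfolding GE.simps by (intro tendsto_intros)
qed

lemma sgi_sq_tendsto:
  assumes c: "\<And>n. continuous_on SG (v n)" "continuous_on SG g"
    and u: "\<And>e. e > 0 \<Longrightarrow> \<exists>N. \<forall>n\<ge>N. \<forall>x\<in>SG. \<bar>v n x - g x\<bar> < e"
  shows "(\<lambda>n. sgi (\<lambda>x. (v n x)\<^sup>2)) \<longlonglongrightarrow> sgi (\<lambda>x. (g x)\<^sup>2)"
proof (rule LIMSEQ_I)
  fix e :: real assume e: "e > 0"
  obtain G where G: "G \<ge> 0" "\<And>x. x \<in> SG \<Longrightarrow> \<bar>g x\<bar> \<le> G" using bounded_on_SG[OF c(2)] by metis
  define q where "q = min 1 (e / (2 * (1 + 2 * G)))"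
  have q: "q > 0" "q \<le> 1" using e G by (auto simp: q_def)
  have "q * (1 + 2 * G) \<le> e / (2 * (1 + 2 * G)) * (1 + 2 * G)" using G by (intro mult_right_mono) (auto simp: q_def)
  also have "\<dots> = e / 2"
  proof -
    have "1 + 2 * G > 0" using G by simp
    then show ?thesis by (simp add: field_simps)
  qed
  finally have qe: "q * (1 + 2 * G) < e" using e by simp
  obtain N where N: "\<forall>n\<ge>N. \<forall>x\<in>SG. \<bar>v n x - g x\<bar> < q" using u[OF q(1)] by blast
  have "\<bar>sgi (\<lambda>x. (v n x)\<^sup>2) - sgi (\<lambda>x. (g x)\<^sup>2)\<bar> \<le> q * (1 + 2 * G)" if "n \<ge> N" for n
  proof -
    have "sgi (\<lambda>x. (v n x)\<^sup>2) - sgi (\<lambda>x. (g x)\<^sup>2) = sgi (\<lambda>x. (v n x)\<^sup>2 - (g x)\<^sup>2)"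
      by (intro sgi_diff[symmetric] continuous_intros c)
    also have "\<bar>\<dots>\<bar> \<le> q * (1 + 2 * G)"
    proof (rule sgi_bound)
      fix x assume x: "x \<in> SG"
      have 1: "\<bar>v n x - g x\<bar> \<le> q" using N that x by (simp add: less_imp_le)
      have "(v n x)\<^sup>2 - (g x)\<^sup>2 = (v n x - g x) * ((v n x - g x) + 2 * g x)" by (simp add: power2_eq_square algebra_simps)
      also have "\<bar>\<dots>\<bar> \<le> q * (1 + 2 * G)"
        unfolding abs_mult using 1 q G(1) G(2)[OF x] by (intro mult_mono) auto
      finally show "\<bar>(v n x)\<^sup>2 - (g x)\<^sup>2\<bar> \<le> q * (1 + 2 * G)" .
    qed (intro continuous_intros c)
    finally show ?thesis .
  qed
  then show "\<exists>no. \<forall>n\<ge>no. norm (sgi (\<lambda>x. (v n x)\<^sup>2) - sgi (\<lambda>x. (g x)\<^sup>2)) < e"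
    using qe by (intro exI[of _ N]) fastforce
qed

section \<open>The odd Poincare constant\<close>

definition odd_fun :: "(real ^ 2 \<Rightarrow> real) \<Rightarrow> bool" where
  "odd_fun u \<longleftrightarrow> (\<forall>x\<in>SG. u (reflect 0 x) = - u x)"

lemma odd_fun_vtx: "odd_fun u \<Longrightarrow> u (vtx 0) = 0" "odd_fun u \<Longrightarrow> u (vtx 2) = - u (vtx 1)"
  unfolding odd_fun_def using reflect_vtx[of 0 0] reflect_vtx[of 0 1]
  by (metis diff_zero equal_neg_zero vtx_SG, metis diff_0 three_arith(2) vtx_SG)

lemma odd_fun_lin: "odd_fun u \<Longrightarrow> odd_fun v \<Longrightarrow> odd_fun (\<lambda>x. a * u x + b * v x)"
  by (simp add: odd_fun_def)

lemma odd_fun_bound: "odd_fun u \<Longrightarrow> u \<in> dom_energy \<Longrightarrow> x \<in> SG \<Longrightarrow> \<bar>u x\<bar> \<le> 5 * enorm u"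
  using energy_osc[of u x 0] odd_fun_vtx(1)[of u] by simp

definition unit_odd :: "(real ^ 2 \<Rightarrow> real) set" where
  "unit_odd = {u \<in> dom_energy. odd_fun u \<and> sgi (\<lambda>x. (u x)\<^sup>2) = 1}"

definition pcon :: real where
  "pcon = Inf ((\<lambda>u. energy u u) ` unit_odd)"

lemma sgi_sq_pos:
  assumes "continuous_on SG u" "x \<in> SG" "u x \<noteq> 0" shows "sgi (\<lambda>x. (u x)\<^sup>2) > 0"
  using assms by (intro sgi_pos[of _ x] continuous_intros) auto

lemma sgi_sq_nonneg: "continuous_on SG u \<Longrightarrow> sgi (\<lambda>x. (u x)\<^sup>2) \<ge> 0"
  using sgi_mono[of zero_fun "\<lambda>x. (u x)\<^sup>2"] by (simp add: continuous_on_power)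

lemma sgi_sq_scale: "sgi (\<lambda>x. (c * u x)\<^sup>2) = c\<^sup>2 * sgi (\<lambda>x. (u x)\<^sup>2)"
  using sgi_mult[of "c\<^sup>2" "\<lambda>x. (u x)\<^sup>2"] by (simp add: power_mult_distrib)

lemma normalize:
  assumes "u \<in> dom_energy" "sgi (\<lambda>x. (u x)\<^sup>2) > 0"
  obtains c where "c \<noteq> 0" "sgi (\<lambda>x. (c * u x)\<^sup>2) = 1" "c\<^sup>2 * sgi (\<lambda>x. (u x)\<^sup>2) = 1"
proof -
  define c where "c = 1 / sqrt (sgi (\<lambda>x. (u x)\<^sup>2))"
  have "c\<^sup>2 * sgi (\<lambda>x. (u x)\<^sup>2) = 1" using assms(2) by (simp add: c_def power_divide)
  moreover from this have "c \<noteq> 0" by auto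
  ultimately show ?thesis using that[of c] by (simp add: sgi_sq_scale)
qed

lemma unit_odd_nonempty: "unit_odd \<noteq> {}"
proof -
  define b :: "3 \<Rightarrow> real" where "b j = (if j = 0 then 0 else if j = 1 then 1 else - 1)" for j
  have odd: "odd_fun (harm b)"
    unfolding odd_fun_def
  proof
    fix x assume "x \<in> SG"
    then show "harm b (reflect 0 x) = - harm b x" by (simp add: harm_linear hb_reflect b_def)
  qed
  have "sgi (\<lambda>x. (harm b x)\<^sup>2) > 0"
    by (rule sgi_sq_pos[of _ "vtx 1"]) (auto simp: b_def continuous_on_harm)
  then obtain c where "sgi (\<lambda>x. (c * harm b x)\<^sup>2) = 1" using normalize[OF harm_dom] by metis
  then have "(\<lambda>x. c * harm b x) \<in> unit_odd"
    using odd dom_mult[OF harm_dom] by (simp add: unit_odd_def odd_fun_def)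
  then show ?thesis by blast
qed

lemma pcon_bdd: "bdd_below ((\<lambda>u. energy u u) ` unit_odd)"
  by (rule bdd_belowI2[of _ 0]) (auto simp: unit_odd_def energy_nonneg)

text \<open>The direct method. Odd functions vanish at \<open>vtx 0\<close>, so bounded energy gives
  a uniformly convergent subsequence. The energy is lower semicontinuous because each
  \<open>GE m\<close> involves finitely many point values and increases with \<open>m\<close>; the
  constraints pass to the uniform limit.\<close>

lemma pcon_attained: "\<exists>u\<in>unit_odd. energy u u = pcon"
proof -
  have "\<exists>u\<in>unit_odd. energy u u < pcon + 1 / real (Suc n)" for n
    using cInf_lessD[of "(\<lambda>u. energy u u) ` unit_odd" "pcon + 1 / real (Suc n)"] unit_odd_nonempty
    unfolding pcon_def by auto
  then obtain v where v: "\<And>n. v n \<in> unit_odd" "\<And>n. energy (v n) (v n) < pcon + 1 / real (Suc n)" by metis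
  have d: "v n \<in> dom_energy" and o: "odd_fun (v n)" and n1: "sgi (\<lambda>x. (v n x)\<^sup>2) = 1" for n
    using v(1)[of n] by (auto simp: unit_odd_def)
  have M: "enorm (v n) \<le> sqrt (pcon + 1)" for n
  proof -
    have "1 / real (Suc n) \<le> 1" by simp
    then have "energy (v n) (v n) \<le> pcon + 1" using v(2)[of n] by linarith
    then show ?thesis by (simp add: enorm_def)
  qed
  have B: "\<bar>v n (vtx 0)\<bar> \<le> 0" for n using odd_fun_vtx(1)[OF o] by simp
  obtain g r where g: "continuous_on SG g" "strict_mono (r :: nat \<Rightarrow> nat)"
    "\<And>e. e > 0 \<Longrightarrow> \<exists>N. \<forall>n\<ge>N. \<forall>x\<in>SG. \<bar>v (r n) x - g x\<bar> < e"
    using energy_compactness[of v, OF d M B] by metis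
  have pt: "(\<lambda>n. v (r n) x) \<longlonglongrightarrow> g x" if "x \<in> SG" for x
    using g(3) that by (intro LIMSEQ_I) (simp, blast)
  have og: "odd_fun g"
    unfolding odd_fun_def
  proof
    fix x assume x: "x \<in> SG"
    have "(\<lambda>n. v (r n) (reflect 0 x)) \<longlonglongrightarrow> - g x"
      using tendsto_minus[OF pt[OF x]] o x by (simp add: odd_fun_def)
    then show "g (reflect 0 x) = - g x" using pt[of "reflect 0 x"] x LIMSEQ_unique by blast
  qed
  have GEle: "GE m g g \<le> pcon" for m
  proof (rule LIMSEQ_le[OF GE_tendsto[OF pt]])
    have "(\<lambda>n. 1 / real (Suc n)) \<longlonglongrightarrow> 0" using LIMSEQ_inverse_real_of_nat by (simp add: inverse_eq_divide)
    from LIMSEQ_subseq_LIMSEQ[OF this g(2)] have "(\<lambda>n. 1 / real (Suc (r n))) \<longlonglongrightarrow> 0" by (simp add: comp_def)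
    from tendsto_add[OF tendsto_const this] show "(\<lambda>n. pcon + 1 / real (Suc (r n))) \<longlonglongrightarrow> pcon" by simp
    show "\<exists>N. \<forall>n\<ge>N. GE m (v (r n)) (v (r n)) \<le> pcon + 1 / real (Suc (r n))"
      using v(2) GE_le_energy[OF d] by (meson less_imp_le order_trans)
  qed simp
  have gd: "g \<in> dom_energy" by (rule dom_energyI[OF g(1) GEle])
  have "(\<lambda>n. sgi (\<lambda>x. (v (r n) x)\<^sup>2)) \<longlonglongrightarrow> sgi (\<lambda>x. (g x)\<^sup>2)"
    using g(1,3) d by (intro sgi_sq_tendsto) (auto simp: dom_cont)
  then have "sgi (\<lambda>x. (g x)\<^sup>2) = 1" by (simp add: n1 LIMSEQ_const_iff)
  then have gu: "g \<in> unit_odd" using gd og by (simp add: unit_odd_def)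
  have "pcon \<le> energy g g" unfolding pcon_def using gu pcon_bdd by (intro cInf_lower) auto
  moreover have "energy g g \<le> pcon" by (rule energy_leI[OF gd GEle])
  ultimately show ?thesis using gu by force
qed

lemma poincare_odd:
  assumes "u \<in> dom_energy" "odd_fun u" shows "pcon * sgi (\<lambda>x. (u x)\<^sup>2) \<le> energy u u"
proof (cases "sgi (\<lambda>x. (u x)\<^sup>2) = 0")
  case True then show ?thesis using energy_nonneg[OF assms(1)] by simp
next
  case False
  then have pos: "sgi (\<lambda>x. (u x)\<^sup>2) > 0" using sgi_sq_nonneg[OF dom_cont[OF assms(1)]] by linarith
  then obtain c where c: "c \<noteq> 0" "sgi (\<lambda>x. (c * u x)\<^sup>2) = 1" "c\<^sup>2 * sgi (\<lambda>x. (u x)\<^sup>2) = 1"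
    using normalize[OF assms(1)] by metis
  have "(\<lambda>x. c * u x) \<in> unit_odd"
    using assms c dom_mult by (simp add: unit_odd_def odd_fun_def)
  then have "pcon \<le> energy (\<lambda>x. c * u x) (\<lambda>x. c * u x)"
    unfolding pcon_def using pcon_bdd by (intro cInf_lower) auto
  also have "\<dots> = c\<^sup>2 * energy u u"
    using assms dom_mult by (simp add: energy_mult energy_mult2 power2_eq_square)
  finally have "pcon * sgi (\<lambda>x. (u x)\<^sup>2) \<le> c\<^sup>2 * energy u u * sgi (\<lambda>x. (u x)\<^sup>2)" using pos by (intro mult_right_mono) auto
  also have "\<dots> = energy u u * (c\<^sup>2 * sgi (\<lambda>x. (u x)\<^sup>2))" by simp
  finally show ?thesis using c(3) by simp
qed

lemma pcon_pos: "pcon > 0"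
proof -
  obtain u where u: "u \<in> unit_odd" "energy u u = pcon" using pcon_attained by blast
  then have d: "u \<in> dom_energy" "odd_fun u" "sgi (\<lambda>x. (u x)\<^sup>2) = 1" by (auto simp: unit_odd_def)
  have "pcon \<ge> 0" using energy_nonneg[OF d(1)] u(2) by simp
  moreover have "pcon \<noteq> 0"
  proof
    assume "pcon = 0"
    then have "enorm u = 0" using u(2) by (simp add: enorm_def)
    then have "u x = 0" if "x \<in> SG" for x using odd_fun_bound[OF d(2,1) that] by simp
    then have "sgi (\<lambda>x. (u x)\<^sup>2) = sgi zero_fun" by (intro sgi_cong) simp
    then show False using d(3) by simp
  qed
  ultimately show ?thesis by simp
qed

lemma sgi_expand:
  assumes "continuous_on SG u" "continuous_on SG v"
  shows "sgi (\<lambda>x. (s * u x + t * v x)\<^sup>2) = s\<^sup>2 * sgi (\<lambda>x. (u x)\<^sup>2) + 2 * s * t * sgi (\<lambda>x. u x * v x) + t\<^sup>2 * sgi (\<lambda>x. (v x)\<^sup>2)"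
proof -
  have "sgi (\<lambda>x. (s * u x + t * v x)\<^sup>2) = sgi (\<lambda>x. (s\<^sup>2 * (u x)\<^sup>2 + 2 * s * t * (u x * v x)) + t\<^sup>2 * (v x)\<^sup>2)"
    by (rule sgi_cong) (simp add: power2_eq_square algebra_simps)
  also have "\<dots> = sgi (\<lambda>x. s\<^sup>2 * (u x)\<^sup>2 + 2 * s * t * (u x * v x)) + sgi (\<lambda>x. t\<^sup>2 * (v x)\<^sup>2)"
    by (intro sgi_add continuous_intros assms)
  also have "sgi (\<lambda>x. s\<^sup>2 * (u x)\<^sup>2 + 2 * s * t * (u x * v x)) = sgi (\<lambda>x. s\<^sup>2 * (u x)\<^sup>2) + sgi (\<lambda>x. 2 * s * t * (u x * v x))"
    by (intro sgi_add continuous_intros assms)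
  finally show ?thesis by (simp only: sgi_mult)
qed

text \<open>The even part of \<open>v\<close> is orthogonal to \<open>u\<close> in both forms, since
  both are invariant under the reflection. On odd functions the energy minus \<open>pcon\<close>
  times the squared norm is a nonnegative form that vanishes at \<open>u\<close>, so
  \<open>u\<close> is in its kernel. As \<open>v\<close> need not vanish on the boundary, this
  already contains the Neumann condition.\<close>

lemma odd_minimizer_weak:
  assumes u: "u \<in> unit_odd" "energy u u = pcon" and v: "v \<in> dom_energy"
  shows "energy u v = pcon * sgi (\<lambda>x. u x * v x)"
proof -
  have d: "u \<in> dom_energy" "odd_fun u" "sgi (\<lambda>x. (u x)\<^sup>2) = 1" using u by (auto simp: unit_odd_def)
  note c = dom_cont[OF d(1)]
  define w where "w x = v x / 2 - rf 0 v x / 2" for x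
  define e where "e x = v x / 2 + rf 0 v x / 2" for x
  have vd: "rf 0 v \<in> dom_energy" by (rule dom_rf[OF v])
  have wd: "w \<in> dom_energy" and ed: "e \<in> dom_energy"
    using dom_lin[OF v vd, of "1 / 2" "- 1 / 2"] dom_lin[OF v vd, of "1 / 2" "1 / 2"] by (simp_all add: w_def[abs_def] e_def[abs_def])
  have ow: "odd_fun w" by (simp add: odd_fun_def w_def rf_def)
  have ev: "rf 0 e x = e x" for x by (simp add: rf_def e_def)
  have ru: "rf 0 u x = (- 1) * u x" if "x \<in> SG" for x using d(2) that by (simp add: odd_fun_def rf_def)
  have "energy u e = energy (rf 0 u) (rf 0 e)" by (simp add: energy_rf)
  also have "\<dots> = energy (\<lambda>x. (- 1) * u x) e" by (rule energy_cong) (auto simp: ru ev)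
  also have "\<dots> = - energy u e" using energy_mult[OF d(1) ed, of "- 1"] by simp
  finally have e0: "energy u e = 0" by simp
  have "sgi (\<lambda>x. u x * e x) = sgi (rf 0 (\<lambda>x. u x * e x))"
    by (intro sgi_rf[symmetric] continuous_intros c dom_cont ed)
  also have "\<dots> = sgi (\<lambda>x. (- 1) * (u x * e x))"
  proof (rule sgi_cong)
    fix x assume "x \<in> SG"
    then show "rf 0 (\<lambda>x. u x * e x) x = (- 1) * (u x * e x)" using ru[of x] ev[of x] by (simp add: rf_def)
  qed
  also have "\<dots> = - sgi (\<lambda>x. u x * e x)" unfolding sgi_mult by simp
  finally have s0: "sgi (\<lambda>x. u x * e x) = 0" by simp
  have "(energy u w - pcon * sgi (\<lambda>x. u x * w x))\<^sup>2 \<le> 0 * (energy w w - pcon * sgi (\<lambda>x. (w x)\<^sup>2))"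
  proof (rule discriminant_le)
    fix s t
    have "pcon * sgi (\<lambda>x. (s * u x + t * w x)\<^sup>2) \<le> energy (\<lambda>x. s * u x + t * w x) (\<lambda>x. s * u x + t * w x)"
      by (intro poincare_odd dom_lin odd_fun_lin d wd ow)
    then show "0 \<le> s\<^sup>2 * 0 + 2 * s * t * (energy u w - pcon * sgi (\<lambda>x. u x * w x)) + t\<^sup>2 * (energy w w - pcon * sgi (\<lambda>x. (w x)\<^sup>2))"
      unfolding sgi_expand[OF c dom_cont[OF wd]] energy_expand[OF d(1) wd] d(3) u(2)
      by (simp add: algebra_simps)
  qed
  then have ew: "energy u w = pcon * sgi (\<lambda>x. u x * w x)" by simp
  have ve: "v = (\<lambda>x. w x + e x)" by (simp add: w_def e_def fun_eq_iff)
  have "sgi (\<lambda>x. u x * v x) = sgi (\<lambda>x. u x * w x + u x * e x)" by (rule sgi_cong) (simp add: ve algebra_simps)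
  also have "\<dots> = sgi (\<lambda>x. u x * w x) + sgi (\<lambda>x. u x * e x)"
    by (intro sgi_add continuous_on_mult c dom_cont[OF wd] dom_cont[OF ed])
  finally have "sgi (\<lambda>x. u x * v x) = sgi (\<lambda>x. u x * w x)" using s0 by simp
  moreover have "energy u v = energy u w" unfolding ve using energy_add2[OF wd ed d(1)] e0 by simp
  ultimately show ?thesis using ew by simp
qed

section \<open>Neumann eigenvalues\<close>

definition neumann :: "real \<Rightarrow> (real ^ 2 \<Rightarrow> real) \<Rightarrow> bool" where
  "neumann l u \<longleftrightarrow> solves u (\<lambda>x. - l * u x) \<and> (\<forall>i. nder i u (\<lambda>x. - l * u x) = 0)"

lemma has_normal_deriv_unique: "has_normal_deriv u d i \<Longrightarrow> has_normal_deriv u d' i \<Longrightarrow> d = d'"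
  unfolding has_normal_deriv_def by (rule LIMSEQ_unique)

lemma neumann_eigenvalue_iff: "neumann_eigenvalue l \<longleftrightarrow> (\<exists>u. (\<exists>x\<in>SG. u x \<noteq> 0) \<and> neumann l u)"
proof -
  have "has_normal_deriv u 0 i \<longleftrightarrow> nder i u (\<lambda>x. - l * u x) = 0" if "solves u (\<lambda>x. - l * u x)" for u i
    using solves_normal_deriv[OF that, of i] has_normal_deriv_unique[of u 0 i] by metis
  then show ?thesis unfolding neumann_eigenvalue_def neumann_def has_laplacian_iff
    by (intro ex_cong1 conj_cong refl) auto
qed

lemma neumann_weak:
  assumes "neumann l u" "continuous_on SG v" shows "energy u v = l * sgi (\<lambda>x. u x * v x)"
proof -
  have "energy u v = - sgi (\<lambda>x. - l * u x * v x)"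
    using Gauss_Green[of u "\<lambda>x. - l * u x" v] assms by (simp add: neumann_def)
  also have "sgi (\<lambda>x. - l * u x * v x) = sgi (\<lambda>x. - l * (u x * v x))" by (simp add: mult.assoc)
  finally show ?thesis unfolding sgi_mult by simp
qed

text \<open>Test functions vanishing on the boundary give the equation. Inserting
  \<open>hb i\<close> into the Gauss-Green formula then leaves the normal derivative at vertex
  \<open>i\<close>, which has to be zero.\<close>

lemma neumannI:
  assumes "u \<in> dom_energy" "\<And>v. v \<in> dom_energy \<Longrightarrow> energy u v = l * sgi (\<lambda>x. u x * v x)"
  shows "neumann l u"
proof -
  have e: "(LINT x|SG_measure. - l * u x * v x) = - l * sgi (\<lambda>x. u x * v x)" for v
    using sgi_mult[of "- l" "\<lambda>x. u x * v x"] by (simp add: sgi_def mult.assoc)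
  have "continuous_on SG (\<lambda>x. - l * u x)" by (intro continuous_intros dom_cont assms(1))
  then have "has_laplacian u (\<lambda>x. - l * u x)"
    unfolding has_laplacian_def using assms by (simp only: e) simp
  then have s: "solves u (\<lambda>x. - l * u x)" by (simp only: has_laplacian_iff)
  have "nder i u (\<lambda>x. - l * u x) = 0" for i
  proof -
    have "l * sgi (\<lambda>x. u x * hb i x) = (\<Sum>j\<in>UNIV. nder j u (\<lambda>x. - l * u x) * hb i (vtx j)) - - l * sgi (\<lambda>x. u x * hb i x)"
      using Gauss_Green[OF s continuous_on_hb, of i] assms(2)[OF hb_dom, of i] e[of "hb i"] by (simp add: sgi_def)
    then have "(\<Sum>j\<in>UNIV. nder j u (\<lambda>x. - l * u x) * hb i (vtx j)) = 0" by simp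
    then show ?thesis using exh_3[of i] by (auto simp: sum_UNIV_3)
  qed
  then show ?thesis using s by (simp add: neumann_def)
qed

lemma neumann_pcon: "\<exists>u. odd_fun u \<and> (\<exists>x\<in>SG. u x \<noteq> 0) \<and> neumann pcon u"
proof -
  obtain u where u: "u \<in> unit_odd" "energy u u = pcon" using pcon_attained by blast
  then have d: "u \<in> dom_energy" "odd_fun u" "sgi (\<lambda>x. (u x)\<^sup>2) = 1" by (auto simp: unit_odd_def)
  have "\<exists>x\<in>SG. u x \<noteq> 0"
  proof (rule ccontr)
    assume "\<not> ?thesis"
    then have "sgi (\<lambda>x. (u x)\<^sup>2) = sgi zero_fun" by (intro sgi_cong) simp
    then show False using d(3) by simp
  qed
  moreover have "neumann pcon u" by (rule neumannI[OF d(1) odd_minimizer_weak[OF u]])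
  ultimately show ?thesis using d by blast
qed

lemma neumann_mult: "neumann l u \<Longrightarrow> neumann l (\<lambda>x. c * u x)"
proof -
  assume n: "neumann l u"
  then have s: "solves u (\<lambda>x. - l * u x)" by (simp add: neumann_def)
  have "solves (\<lambda>x. c * u x + 0 * u x) (\<lambda>x. c * (- l * u x) + 0 * (- l * u x))" by (rule solves_lin[OF s s])
  moreover have "nder i (\<lambda>x. c * u x + 0 * u x) (\<lambda>x. c * (- l * u x) + 0 * (- l * u x)) = c * nder i u (\<lambda>x. - l * u x) + 0 * nder i u (\<lambda>x. - l * u x)" for i
    by (rule nder_lin[OF solves_cont(2)[OF s] solves_cont(2)[OF s]])
  moreover have "(\<lambda>x. c * (- l * u x) + 0 * (- l * u x)) = (\<lambda>x. - l * (c * u x))" by (simp add: fun_eq_iff)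
  ultimately show ?thesis using n by (simp add: neumann_def)
qed

text \<open>An odd Neumann eigenfunction, copied with opposite signs to the cells 1 and 2 and continued by
  zero to the cell 0, is again a Neumann eigenfunction, and its eigenvalue is five times as large.\<close>

lemma neumann_5_pcon: "neumann_eigenvalue (5 * pcon)"
proof -
  obtain u x where u: "odd_fun u" "x \<in> SG" "u x \<noteq> 0" "neumann pcon u" using neumann_pcon by blast
  define g where "g i = (\<lambda>x. (if i = 0 then 0 else if i = 1 then 1 else - 1) * u x)" for i :: 3
  have gn: "neumann pcon (g i)" for i unfolding g_def by (rule neumann_mult[OF u(4)])
  have compat: "g i (vtx j) = g j (vtx i)" for i j
    using odd_fun_vtx[OF u(1)] exh_3[of i] exh_3[of j] by (auto simp: g_def)
  have gc: "glue g (contr i x) = g i x" if "x \<in> SG" for i x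
    using glue_contr[where g = g and x = x and i = i] compat that by blast
  have cont: "continuous_on SG (g i)" for i using gn solves_cont by (auto simp: neumann_def)
  have cG: "continuous_on SG (glue g)" using continuous_on_glue[where g = g] compat cont by blast
  let ?f = "\<lambda>x. - (5 * pcon) * glue g x"
  have su: "sub i (glue g) x = g i x" and sf: "ssub i ?f x = - pcon * g i x" if "x \<in> SG" for i x
    using gc[OF that, of i] by (simp_all add: sub_def ssub_def)
  have s: "solves (sub i (glue g)) (ssub i ?f)" and n: "nder j (sub i (glue g)) (ssub i ?f) = 0" for i j
    using gn[of i] solves_cong[OF su[of _ i] sf[of _ i]] nder_cong[OF su[of _ i] sf[of _ i], where i = j] by (auto simp: neumann_def)
  have m: "matched (glue g) ?f" unfolding matched_def n by simp
  have cf: "continuous_on SG ?f" by (intro continuous_intros cG)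
  have "solves (glue g) ?f" using cG cf m s by (subst solves_iff) auto
  moreover have "nder i (glue g) ?f = 0" for i using nder_rec[OF cf m, of i] n by simp
  ultimately have "neumann (5 * pcon) (glue g)" by (simp add: neumann_def)
  moreover have "glue g (contr 1 x) \<noteq> 0" "contr 1 x \<in> SG" using gc[OF u(2), of 1] u by (auto simp: g_def)
  ultimately show ?thesis unfolding neumann_eigenvalue_iff by blast
qed

lemma neumann_dom: "neumann l u \<Longrightarrow> u \<in> dom_energy"
  using solves_dom unfolding neumann_def by blast

lemma neumann_eigenvalue_unit:
  assumes "neumann_eigenvalue l"
  shows "\<exists>u. neumann l u \<and> sgi (\<lambda>x. (u x)\<^sup>2) = 1"
proof -
  obtain u x where u: "x \<in> SG" "u x \<noteq> 0" "neumann l u" using assms unfolding neumann_eigenvalue_iff by blast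
  have "sgi (\<lambda>x. (u x)\<^sup>2) > 0" using u by (intro sgi_sq_pos[of _ x] dom_cont neumann_dom) auto
  then obtain c where "sgi (\<lambda>x. (c * u x)\<^sup>2) = 1" using normalize[OF neumann_dom[OF u(3)]] by metis
  then show ?thesis using neumann_mult[OF u(3)] by blast
qed

lemma neumann_energy:
  assumes "neumann l u" shows "energy u u = l * sgi (\<lambda>x. (u x)\<^sup>2)"
  using neumann_weak[OF assms dom_cont[OF neumann_dom[OF assms]]] by (simp add: power2_eq_square)

lemma neumann_orthogonal:
  assumes "neumann l u" "neumann l' v" "l \<noteq> l'" shows "sgi (\<lambda>x. u x * v x) = 0"
proof -
  have "l * sgi (\<lambda>x. u x * v x) = energy u v" using assms by (simp add: neumann_weak dom_cont neumann_dom)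
  also have "\<dots> = energy v u" by (rule energy_sym)
  also have "\<dots> = l' * sgi (\<lambda>x. v x * u x)" using assms by (simp add: neumann_weak dom_cont neumann_dom)
  finally show ?thesis using assms(3) by (simp add: mult.commute)
qed

text \<open>Infinitely many eigenvalues below \<open>t\<close> would give an orthonormal sequence of
  bounded energy. Compactness yields two members at uniform distance at most 1, whereas orthonormal
  functions have squared distance 2.\<close>

lemma finite_neumann: "finite {l. neumann_eigenvalue l \<and> l \<le> t}"
proof (rule ccontr)
  assume "infinite {l. neumann_eigenvalue l \<and> l \<le> t}"
  then obtain l :: "nat \<Rightarrow> real" where l: "inj l" "range l \<subseteq> {l. neumann_eigenvalue l \<and> l \<le> t}"
    using infinite_countable_subset by blast
  then have "\<exists>u. neumann (l n) u \<and> sgi (\<lambda>x. (u x)\<^sup>2) = 1" for n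
    using neumann_eigenvalue_unit by blast
  then obtain u where u: "\<And>n. neumann (l n) (u n)" "\<And>n. sgi (\<lambda>x. (u n x)\<^sup>2) = 1" by metis
  note d = neumann_dom[OF u(1)]
  have M: "enorm (u n) \<le> sqrt t" for n
    using l(2) neumann_energy[OF u(1), of n] u(2)[of n] by (auto simp: enorm_def)
  \<comment> \<open>The energy bounds the oscillation, so a larger value at \<open>vtx 0\<close>
    would keep the function above 1 in absolute value everywhere, against its norm 1.\<close>
  have B: "\<bar>u n (vtx 0)\<bar> \<le> 1 + 5 * sqrt t" for n
  proof (rule ccontr)
    assume a: "\<not> ?thesis"
    have "(u n x)\<^sup>2 \<ge> (\<bar>u n (vtx 0)\<bar> - 5 * sqrt t)\<^sup>2" if "x \<in> SG" for x
    proof -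
      have "\<bar>u n x\<bar> \<ge> \<bar>u n (vtx 0)\<bar> - 5 * sqrt t" using energy_osc[OF d that, of n 0] M[of n] by linarith
      then have "(\<bar>u n (vtx 0)\<bar> - 5 * sqrt t)\<^sup>2 \<le> \<bar>u n x\<bar>\<^sup>2" using a by (intro power_mono) auto
      then show ?thesis by simp
    qed
    then have "sgi (\<lambda>x. (\<bar>u n (vtx 0)\<bar> - 5 * sqrt t)\<^sup>2) \<le> sgi (\<lambda>x. (u n x)\<^sup>2)"
      by (intro sgi_mono continuous_intros dom_cont d) auto
    then have "(\<bar>u n (vtx 0)\<bar> - 5 * sqrt t)\<^sup>2 \<le> 1" using u(2)[of n] by (simp add: sgi_const)
    moreover have "1\<^sup>2 < (\<bar>u n (vtx 0)\<bar> - 5 * sqrt t)\<^sup>2" using a by (intro power_strict_mono) auto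
    ultimately show False by simp
  qed
  obtain g and r :: "nat \<Rightarrow> nat" where g: "strict_mono r"
    "\<And>e. e > 0 \<Longrightarrow> \<exists>N. \<forall>n\<ge>N. \<forall>x\<in>SG. \<bar>u (r n) x - g x\<bar> < e"
    using energy_compactness[of u, OF d M B] by metis
  obtain N where N: "\<And>n x. n \<ge> N \<Longrightarrow> x \<in> SG \<Longrightarrow> \<bar>u (r n) x - g x\<bar> < 1 / 2" using g(2)[of "1 / 2"] by auto
  let ?a = "u (r N)" and ?b = "u (r (Suc N))"
  have c: "continuous_on SG ?a" "continuous_on SG ?b" by (intro dom_cont d)+
  have "r N \<noteq> r (Suc N)" using strict_monoD[OF g(1), of N "Suc N"] by simp
  then have "sgi (\<lambda>x. ?a x * ?b x) = 0" using l(1) by (intro neumann_orthogonal[OF u(1) u(1)]) (auto simp: inj_eq)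
  then have "sgi (\<lambda>x. (1 * ?a x + (- 1) * ?b x)\<^sup>2) = 2" unfolding sgi_expand[OF c] u(2) by simp
  moreover have "\<bar>sgi (\<lambda>x. (1 * ?a x + (- 1) * ?b x)\<^sup>2)\<bar> \<le> 1"
  proof (rule sgi_bound)
    fix x assume "x \<in> SG"
    then have "\<bar>1 * ?a x + (- 1) * ?b x\<bar> \<le> 1" using N[of N x] N[of "Suc N" x] by linarith
    then show "\<bar>(1 * ?a x + (- 1) * ?b x)\<^sup>2\<bar> \<le> 1" by (simp add: abs_square_le_1)
  qed (intro continuous_intros c)
  ultimately show False by simp
qed

text \<open>Both \<open>pcon\<close> and \<open>5 * pcon\<close> belong to the finite set
  \<open>A\<close>, so \<open>A\<close> has a second smallest element \<open>l2\<close>. The rest of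
  the proof shows that the description in \<open>lambda2\<close> holds for \<open>l2\<close> and for
  no other number.\<close>

lemma lambda2_le: "lambda2 \<le> 5 * pcon"
proof -
  define N where "N = {l. neumann_eigenvalue l \<and> l \<noteq> 0}"
  define A where "A = {l \<in> N. l \<le> 5 * pcon}"
  have fA: "finite A" by (rule finite_subset[OF _ finite_neumann[of "5 * pcon"]]) (auto simp: A_def N_def)
  have p: "pcon \<in> A" "5 * pcon \<in> A"
    using neumann_pcon neumann_5_pcon pcon_pos by (auto simp: A_def N_def neumann_eigenvalue_iff)
  define l1 where "l1 = Min A"
  define l2 where "l2 = Min (A - {l1})"
  have l1: "l1 \<in> A" "\<And>l. l \<in> A \<Longrightarrow> l1 \<le> l" using fA p unfolding l1_def by (auto intro: Min_in)
  have ne: "A - {l1} \<noteq> {}"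
  proof
    assume "A - {l1} = {}"
    then have "pcon = l1" "5 * pcon = l1" using p by blast+
    then show False using pcon_pos by simp
  qed
  have l2: "l2 \<in> A - {l1}" unfolding l2_def by (rule Min_in[OF _ ne]) (use fA in simp)
  have l2_min: "l2 \<le> l" if "l \<in> A - {l1}" for l unfolding l2_def by (rule Min_le[OF _ that]) (use fA in simp)
  have l2p: "l2 \<le> 5 * pcon" using l2 by (simp add: A_def)
  have less: "l1 < l2" using l1(2)[of l2] l2 by auto
  have below: "{l'. neumann_eigenvalue l' \<and> l' \<noteq> 0 \<and> l' < l} = {l' \<in> N. l' < l}" for l by (auto simp: N_def)
  have b2: "{l' \<in> N. l' < l2} = {l1}"
  proof (intro subset_antisym subsetI)
    fix l assume l: "l \<in> {l' \<in> N. l' < l2}"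
    then have "l \<in> A" using l2p by (auto simp: A_def)
    then show "l \<in> {l1}" using l2_min[of l] l by auto
  qed (use l1 less in \<open>auto simp: A_def\<close>)
  have "lambda2 = l2"
    unfolding lambda2_def below
  proof (rule the_equality)
    show "neumann_eigenvalue l2 \<and> l2 \<noteq> 0 \<and> card {l' \<in> N. l' < l2} = 1" using l2 b2 by (auto simp: A_def N_def)
    fix l assume l: "neumann_eigenvalue l \<and> l \<noteq> 0 \<and> card {l' \<in> N. l' < l} = 1"
    show "l = l2"
    proof (rule ccontr)
      assume "l \<noteq> l2"
      then consider "l < l2" | "l2 < l" by linarith
      then show False
      proof cases
        case 1
        then have "l \<in> {l' \<in> N. l' < l2}" using l by (simp add: N_def)
        then have "l = l1" unfolding b2 by simp
        moreover have "l1 \<le> l'" if "l' \<in> N" for l'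
          using l1(2)[of l'] l1(1) that by (cases "l' \<le> 5 * pcon") (auto simp: A_def)
        then have "{l' \<in> N. l' < l1} = {}" by (auto simp: not_less)
        then have "card {l' \<in> N. l' < l1} = 0" by (simp only: card.empty)
        ultimately show False using l by simp
      next
        case 2
        \<comment> \<open>Infinite sets have cardinality 0, so cardinality 1 implies finiteness and
          the comparison of cardinalities is legitimate.\<close>
        have "finite {l' \<in> N. l' < l}" using l by (intro card_ge_0_finite) simp
        moreover have "{l1, l2} \<subseteq> {l' \<in> N. l' < l}" using 2 less l1(1) l2 by (auto simp: A_def)
        ultimately have "card {l1, l2} \<le> card {l' \<in> N. l' < l}" by (rule card_mono)
        then show False using l less by simp
      qed
    qed
  qed
  then show ?thesis using l2p by simp
qed

section \<open>Decay of iterated solutions\<close>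

text \<open>\<open>enorm\<close> vanishes on constants; with the value at \<open>vtx 0\<close>
  added, the result controls the supremum norm.\<close>

definition bnorm :: "(real ^ 2 \<Rightarrow> real) \<Rightarrow> real" where
  "bnorm u = \<bar>u (vtx 0)\<bar> + enorm u"

lemma bnorm_nonneg: "u \<in> dom_energy \<Longrightarrow> bnorm u \<ge> 0"
  by (simp add: bnorm_def enorm_nonneg)

lemma enorm_le_bnorm: "enorm u \<le> bnorm u"
  by (simp add: bnorm_def)

lemma bnorm_upper:
  assumes "u \<in> dom_energy" "x \<in> SG" shows "\<bar>u x\<bar> \<le> 5 * bnorm u"
proof -
  have "\<bar>u x\<bar> \<le> \<bar>u (vtx 0)\<bar> + 5 * enorm u" using energy_osc[OF assms, of 0] by linarith
  then show ?thesis by (simp add: bnorm_def)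
qed

lemma snorm_le_bnorm: "u \<in> dom_energy \<Longrightarrow> snorm u \<le> 5 * bnorm u"
  by (rule snorm_least) (rule bnorm_upper)

lemma bnorm_mult: "u \<in> dom_energy \<Longrightarrow> bnorm (\<lambda>x. c * u x) = \<bar>c\<bar> * bnorm u"
  by (simp add: bnorm_def enorm_mult abs_mult distrib_left)

lemma nder_bound:
  assumes "u \<in> dom_energy" "f \<in> dom_energy"
  shows "\<bar>nder i u f\<bar> \<le> 20 * bnorm u + 5 * bnorm f"
  using bnorm_upper[OF assms(1) vtx_SG, of i] bnorm_upper[OF assms(1) vtx_SG, of "i + 1"]
    bnorm_upper[OF assms(1) vtx_SG, of "i - 1"] H_bound[OF dom_cont[OF assms(2)], of i] snorm_le_bnorm[OF assms(2)]
  unfolding nder_def by linarith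

lemma quadratic_bound:
  assumes "X\<^sup>2 \<le> a * S\<^sup>2 + b * S * X" "a \<ge> 0" "b \<ge> 0" "S \<ge> 0" "X \<ge> (0::real)"
  shows "X \<le> (a + b + 1) * S"
proof (rule ccontr)
  assume n: "\<not> X \<le> (a + b + 1) * S"
  have "1 * S \<le> (a + b + 1) * S" using assms by (intro mult_right_mono) auto
  then have "S \<le> X" using n by simp
  then have "a * S * S \<le> a * S * X" using assms by (intro mult_left_mono) auto
  then have "X * X \<le> (a + b) * S * X" using assms(1) by (simp add: power2_eq_square algebra_simps)
  moreover have "X > 0" using n assms by (smt (verit) mult_nonneg_nonneg)
  ultimately have "X \<le> (a + b) * S" by simp
  then show False using n assms by (simp add: algebra_simps)
qed

text \<open>The jets control the boundary values and normal derivatives, and Gauss-Green with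
  \<open>u\<close> itself then gives a quadratic inequality for \<open>enorm u\<close>. The constant
  is crude because the estimate only has to start the descent in the rate.\<close>

lemma jets_bound:
  assumes J: "jets u f v d t" and f: "f \<in> dom_energy"
  shows "bnorm u \<le> 10000 * (bnorm f + \<bar>v\<bar> + \<bar>d\<bar> + \<bar>t\<bar>)"
proof -
  define S where "S = bnorm f + \<bar>v\<bar> + \<bar>d\<bar> + \<bar>t\<bar>"
  have s: "solves u f" and u0: "u (vtx 0) = v" and d: "nder 0 u f = d" using J by (auto simp: jets_def)
  have ud: "u \<in> dom_energy" by (rule solves_dom[OF s])
  have fb: "bnorm f \<ge> 0" "enorm f \<ge> 0" "enorm f \<le> bnorm f" "snorm f \<le> 5 * bnorm f"
    using f bnorm_nonneg enorm_nonneg enorm_le_bnorm snorm_le_bnorm by auto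
  have S0: "S \<ge> 0" "snorm f \<le> 5 * S" "enorm f \<le> S" "\<bar>v\<bar> \<le> S" using fb by (auto simp: S_def)
  have H: "\<bar>H i f\<bar> \<le> 5 * S" for i using H_bound[OF dom_cont[OF f], of i] S0 by linarith
  have sum: "u (vtx 1) + u (vtx 2) = 2 * v - d + H 0 f" using d u0 by (simp add: nder_def)
  have dif: "u (vtx 1) - u (vtx 2) = t + Kap f" using jets_tangential[OF J f] by simp
  have "\<bar>Kap f\<bar> \<le> 50 * bnorm f" using Kap_bound[OF f] fb by linarith
  then have 1: "\<bar>t + Kap f\<bar> \<le> \<bar>t\<bar> + 50 * bnorm f" by linarith
  have "\<bar>H 0 f\<bar> \<le> 5 * bnorm f" using H_bound[OF dom_cont[OF f], of 0] fb by linarith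
  then have 2: "\<bar>2 * v - d + H 0 f\<bar> \<le> 2 * \<bar>v\<bar> + \<bar>d\<bar> + 5 * bnorm f" by linarith
  \<comment> \<open>56 bounds the sum plus the difference of the two boundary values, hence 28
    bounds each of them. Below, 117 is \<open>4 * 28 + 5\<close>, and 9833 is
    \<open>3 * 117 * 28 + 5\<close>.\<close>
  have 3: "2 * \<bar>v\<bar> + \<bar>d\<bar> + 5 * bnorm f + (\<bar>t\<bar> + 50 * bnorm f) \<le> 56 * S" using fb(1) by (simp add: S_def)
  have b1: "\<bar>u (vtx 1)\<bar> \<le> 28 * S" using 1 2 3 unfolding sum[symmetric] dif[symmetric] by linarith
  have b2: "\<bar>u (vtx 2)\<bar> \<le> 28 * S" using 1 2 3 unfolding sum[symmetric] dif[symmetric] by linarith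
  have b: "\<bar>u (vtx i)\<bar> \<le> 28 * S" for i
    using exh_3[of i] b1 b2 u0 S0 by (elim disjE) auto
  have n: "\<bar>nder i u f\<bar> \<le> 117 * S" for i
    using b[of i] b[of "i + 1"] b[of "i - 1"] H[of i] unfolding nder_def by linarith
  define X where "X = enorm u"
  have X0: "X \<ge> 0" using enorm_nonneg[OF ud] by (simp add: X_def)
  have nb: "\<bar>nder i u f * u (vtx i)\<bar> \<le> 117 * S * (28 * S)" for i
    unfolding abs_mult using n[of i] b[of i] S0 by (intro mult_mono) auto
  have "\<bar>sgi (\<lambda>x. f x * u x)\<bar> \<le> 5 * S * (S + 5 * X)"
  proof (rule sgi_bound)
    fix x assume x: "x \<in> SG"
    have "\<bar>u x\<bar> \<le> S + 5 * X" using energy_osc[OF ud x, of 0] u0 S0 unfolding X_def by linarith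
    then show "\<bar>f x * u x\<bar> \<le> 5 * S * (S + 5 * X)"
      unfolding abs_mult using snorm_upper[OF dom_cont[OF f] x] S0 by (intro mult_mono) auto
  qed (intro continuous_intros dom_cont f ud)
  moreover have "X\<^sup>2 = (\<Sum>i\<in>UNIV. nder i u f * u (vtx i)) - sgi (\<lambda>x. f x * u x)"
    using Gauss_Green[OF s dom_cont[OF ud]] enorm_sq[OF ud] by (simp add: X_def)
  ultimately have "X\<^sup>2 \<le> 3 * (117 * S * (28 * S)) + 5 * S * (S + 5 * X)"
    using nb[of 0] nb[of 1] nb[of 2] unfolding sum_UNIV_3 by linarith
  then have "X\<^sup>2 \<le> 9833 * S\<^sup>2 + 25 * S * X" by (simp add: power2_eq_square algebra_simps)
  then have "X \<le> (9833 + 25 + 1) * S" by (rule quadratic_bound) (use S0 X0 in auto)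
  then have "X \<le> 9859 * S" by simp
  moreover have "bnorm u = \<bar>v\<bar> + X" by (simp add: bnorm_def X_def u0)
  ultimately show ?thesis using S0 unfolding S_def[symmetric] by linarith
qed

text \<open>The factor \<open>c\<close> is 1 for functions on the gasket and \<open>1/5\<close> for their restrictions to a cell.\<close>

definition jet_chain :: "real \<Rightarrow> real \<Rightarrow> real \<Rightarrow> nat \<Rightarrow> (nat \<Rightarrow> real ^ 2 \<Rightarrow> real) \<Rightarrow> bool" where
  "jet_chain c M r L v \<longleftrightarrow> v 0 \<in> dom_energy \<and> bnorm (v 0) \<le> M \<and>
    (\<forall>i<L. solves (v (Suc i)) (\<lambda>x. c * v i x) \<and> \<bar>v (Suc i) (vtx 0)\<bar> \<le> M * r ^ Suc i \<and>
       \<bar>nder 0 (v (Suc i)) (\<lambda>x. c * v i x)\<bar> \<le> M * r ^ Suc i \<and>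
       (\<exists>t. has_tangential_deriv (v (Suc i)) t 0 \<and> \<bar>t\<bar> \<le> M * r ^ Suc i))"

text \<open>The constant \<open>A\<close> serves all chains and all lengths \<open>L\<close> at
  once. This uniformity allows \<open>L\<close> to tend to infinity for fixed \<open>r\<close>
  later.\<close>

definition decays :: "real \<Rightarrow> real \<Rightarrow> real \<Rightarrow> bool" where
  "decays c A r \<longleftrightarrow> (\<forall>M L v. jet_chain c M r L v \<longrightarrow> (\<forall>i\<le>L. bnorm (v i) \<le> A * M * r ^ i))"

lemma jet_chain_dom:
  assumes "jet_chain c M r L v" "i \<le> L" shows "v i \<in> dom_energy"
proof (cases i)
  case 0 then show ?thesis using assms by (simp add: jet_chain_def)
next
  case (Suc j)
  then have "solves (v (Suc j)) (\<lambda>x. c * v j x)" using assms by (simp add: jet_chain_def)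
  then show ?thesis using solves_dom Suc by blast
qed

lemma jet_chain_nonneg: "jet_chain c M r L v \<Longrightarrow> M \<ge> 0"
  unfolding jet_chain_def using bnorm_nonneg[of "v 0"] by linarith

text \<open>The constant reproduces itself: for \<open>r\<close> at least 20000 the previous bound
  \<open>60000 * M * r ^ i\<close> is at most three times \<open>M * r ^ Suc i\<close>, the three
  jets contribute another three, and \<open>10000 * 6\<close> is 60000.\<close>

lemma decays_large:
  assumes "r \<ge> 20000" shows "decays 1 60000 r"
  unfolding decays_def
proof (intro allI impI)
  fix M L v i assume ch: "jet_chain 1 M r L v" and "i \<le> L"
  have M0: "M \<ge> 0" by (rule jet_chain_nonneg[OF ch])
  show "bnorm (v i) \<le> 60000 * M * r ^ i"
    using \<open>i \<le> L\<close>
  proof (induction i)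
    case 0
    have "bnorm (v 0) \<le> M" using ch by (simp add: jet_chain_def)
    then show ?case using M0 by simp
  next
    case (Suc i)
    then have i: "i < L" by simp
    obtain t where t: "has_tangential_deriv (v (Suc i)) t 0" "\<bar>t\<bar> \<le> M * r ^ Suc i"
      using ch i unfolding jet_chain_def by blast
    have J: "jets (v (Suc i)) (v i) (v (Suc i) (vtx 0)) (nder 0 (v (Suc i)) (v i)) t"
      using ch i t by (simp add: jet_chain_def jets_def)
    have b: "\<bar>v (Suc i) (vtx 0)\<bar> \<le> M * r ^ Suc i" "\<bar>nder 0 (v (Suc i)) (v i)\<bar> \<le> M * r ^ Suc i"
      using ch i by (auto simp: jet_chain_def)
    have "bnorm (v (Suc i)) \<le> 10000 * (bnorm (v i) + \<bar>v (Suc i) (vtx 0)\<bar> + \<bar>nder 0 (v (Suc i)) (v i)\<bar> + \<bar>t\<bar>)"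
      by (rule jets_bound[OF J jet_chain_dom[OF ch]]) (use i in simp)
    also have "\<dots> \<le> 10000 * (60000 * M * r ^ i + M * r ^ Suc i + M * r ^ Suc i + M * r ^ Suc i)"
      using Suc b t by (intro mult_left_mono add_mono) auto
    also have "60000 * M * r ^ i \<le> 3 * (M * r ^ Suc i)"
    proof -
      have "60000 * (M * r ^ i) \<le> (3 * r) * (M * r ^ i)" using assms M0 by (intro mult_right_mono) auto
      then show ?thesis by (simp add: mult_ac)
    qed
    finally show ?case by simp
  qed
qed

lemma tangential_mult: "has_tangential_deriv u t i \<Longrightarrow> has_tangential_deriv (\<lambda>x. c * u x) (c * t) i"
  unfolding has_tangential_deriv_def by (drule tendsto_mult_left[where c = c]) (simp add: right_diff_distrib mult.left_commute)

lemma solves_mult: "solves u f \<Longrightarrow> solves (\<lambda>x. c * u x) (\<lambda>x. c * f x)"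
  using solves_lin[of u f u f c 0] by simp

lemma nder_mult: "continuous_on SG f \<Longrightarrow> nder i (\<lambda>x. c * u x) (\<lambda>x. c * f x) = c * nder i u f"
  using nder_lin[of f f i c u 0 u] by simp

text \<open>Multiplying the \<open>i\<close>-th member by \<open>5 ^ i\<close> absorbs the factor
  1/5 of the equation and multiplies the rate of the jets by 5. This is the gain that drives the
  descent.\<close>

lemma decays_rescale:
  assumes D: "decays 1 A (5 * r)" shows "decays (1 / 5) A r"
  unfolding decays_def
proof (intro allI impI)
  fix M L v i assume ch: "jet_chain (1 / 5) M r L v" and i: "i \<le> L"
  define w where "w i = (\<lambda>x. 5 ^ i * v i x)" for i
  have le: "5 ^ n * y \<le> M * (5 * r) ^ n" if "y \<le> M * r ^ n" for y n
    using mult_left_mono[OF that, of "5 ^ n"] by (simp add: power_mult_distrib mult_ac)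
  have "jet_chain 1 M (5 * r) L w"
    unfolding jet_chain_def
  proof (intro conjI allI impI)
    show "w 0 \<in> dom_energy" "bnorm (w 0) \<le> M" using ch by (simp_all add: w_def jet_chain_def)
    fix i assume i: "i < L"
    have s: "solves (v (Suc i)) (\<lambda>x. 1 / 5 * v i x)" using ch i unfolding jet_chain_def by blast
    have f: "(\<lambda>x. 1 * w i x) = (\<lambda>x. 5 ^ Suc i * (1 / 5 * v i x))" by (simp add: w_def fun_eq_iff)
    show "solves (w (Suc i)) (\<lambda>x. 1 * w i x)"
      unfolding f unfolding w_def by (rule solves_mult[OF s])
    have v: "\<bar>v (Suc i) (vtx 0)\<bar> \<le> M * r ^ Suc i" "\<bar>nder 0 (v (Suc i)) (\<lambda>x. 1 / 5 * v i x)\<bar> \<le> M * r ^ Suc i"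
      using ch i unfolding jet_chain_def by blast+
    show "\<bar>w (Suc i) (vtx 0)\<bar> \<le> M * (5 * r) ^ Suc i"
      using le[OF v(1)] by (simp only: w_def abs_mult) simp
    have "nder 0 (w (Suc i)) (\<lambda>x. 1 * w i x) = 5 ^ Suc i * nder 0 (v (Suc i)) (\<lambda>x. 1 / 5 * v i x)"
      unfolding f unfolding w_def by (rule nder_mult[OF solves_cont(2)[OF s]])
    then show "\<bar>nder 0 (w (Suc i)) (\<lambda>x. 1 * w i x)\<bar> \<le> M * (5 * r) ^ Suc i"
      using le[OF v(2)] by (simp only: abs_mult) simp
    obtain t where t: "has_tangential_deriv (v (Suc i)) t 0" "\<bar>t\<bar> \<le> M * r ^ Suc i"
      using ch i unfolding jet_chain_def by blast
    have "has_tangential_deriv (w (Suc i)) (5 ^ Suc i * t) 0" unfolding w_def by (rule tangential_mult[OF t(1)])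
    moreover have "\<bar>5 ^ Suc i * t\<bar> \<le> M * (5 * r) ^ Suc i" using le[OF t(2)] by (simp only: abs_mult) simp
    ultimately show "\<exists>t. has_tangential_deriv (w (Suc i)) t 0 \<and> \<bar>t\<bar> \<le> M * (5 * r) ^ Suc i" by blast
  qed
  then have "bnorm (w i) \<le> A * M * (5 * r) ^ i" using D i unfolding decays_def by blast
  moreover have "bnorm (w i) = 5 ^ i * bnorm (v i)"
    unfolding w_def using bnorm_mult[OF jet_chain_dom[OF ch i], of "5 ^ i"] by simp
  ultimately show "bnorm (v i) \<le> A * M * r ^ i" by (simp add: power_mult_distrib)
qed

subsection \<open>Even and odd parts\<close>

definition evp :: "(real ^ 2 \<Rightarrow> real) \<Rightarrow> real ^ 2 \<Rightarrow> real" where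
  "evp u = (\<lambda>x. 1 / 2 * u x + 1 / 2 * rf 0 u x)"

definition odp :: "(real ^ 2 \<Rightarrow> real) \<Rightarrow> real ^ 2 \<Rightarrow> real" where
  "odp u = (\<lambda>x. 1 / 2 * u x + (- 1 / 2) * rf 0 u x)"

lemma evp_add_odp: "u = (\<lambda>x. evp u x + odp u x)"
  by (simp add: evp_def odp_def fun_eq_iff)

lemma evp_dom: "u \<in> dom_energy \<Longrightarrow> evp u \<in> dom_energy" and odp_dom: "u \<in> dom_energy \<Longrightarrow> odp u \<in> dom_energy"
  unfolding evp_def odp_def by (intro dom_lin dom_rf; assumption)+

lemma enorm_rf: "enorm (rf c u) = enorm u"
  by (simp add: enorm_def energy_rf)

lemma enorm_lin: assumes "u \<in> dom_energy" "v \<in> dom_energy"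
  shows "enorm (\<lambda>x. a * u x + b * v x) \<le> \<bar>a\<bar> * enorm u + \<bar>b\<bar> * enorm v"
  using enorm_add[OF dom_mult[OF assms(1), of a] dom_mult[OF assms(2), of b]] by (simp add: enorm_mult assms)

lemma enorm_evp: "u \<in> dom_energy \<Longrightarrow> enorm (evp u) \<le> enorm u"
  and enorm_odp: "u \<in> dom_energy \<Longrightarrow> enorm (odp u) \<le> enorm u"
  using enorm_lin[of u "rf 0 u" "1 / 2" "1 / 2"] enorm_lin[of u "rf 0 u" "1 / 2" "- 1 / 2"]
  by (simp_all add: evp_def odp_def dom_rf enorm_rf)

lemma rf_mult: "rf c (\<lambda>x. a * f x) = (\<lambda>x. a * rf c f x)" by (simp add: rf_def)

lemma evp_mult: "evp (\<lambda>x. a * f x) = (\<lambda>x. a * evp f x)" and odp_mult: "odp (\<lambda>x. a * f x) = (\<lambda>x. a * odp f x)"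
  unfolding evp_def odp_def rf_mult by (simp_all add: fun_eq_iff algebra_simps)

lemma solves_evp: "solves u f \<Longrightarrow> solves (evp u) (evp f)" and solves_odp: "solves u f \<Longrightarrow> solves (odp u) (odp f)"
  unfolding evp_def odp_def by (intro solves_lin solves_rf; assumption)+

lemma nder_evp:
  assumes "continuous_on SG f" shows "nder i (evp u) (evp f) = (nder i u f + nder (- i) u f) / 2"
  unfolding evp_def nder_lin[OF assms continuous_on_rf[OF assms]] nder_rf[OF assms] by simp

lemma nder_odp:
  assumes "continuous_on SG f" shows "nder i (odp u) (odp f) = (nder i u f - nder (- i) u f) / 2"
  unfolding odp_def nder_lin[OF assms continuous_on_rf[OF assms]] nder_rf[OF assms] by simp

lemma evp_vtx_0: "evp u (vtx 0) = u (vtx 0)"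
  by (simp add: evp_def rf_def)

lemma odd_fun_odp: "odd_fun (odp u)"
  by (simp add: odd_fun_def odp_def rf_def)

lemma reflect_funpow: "reflect c ((contr i ^^ m) x) = (contr (c - i) ^^ m) (reflect c x)"
  by (induction m) (auto simp: reflect_contr)

lemma evp_tangential: "has_tangential_deriv (evp u) 0 0"
proof -
  have "evp u ((contr 0 ^^ m) (vtx 1)) = evp u ((contr 0 ^^ m) (vtx 2))" for m
    by (simp add: evp_def rf_def reflect_funpow)
  then show ?thesis by (simp add: has_tangential_deriv_def)
qed

subsection \<open>Energy estimates for odd solutions\<close>

text \<open>Cauchy-Schwarz, followed by the Poincare inequality for both factors.\<close>

lemma odd_pairing_bound:
  assumes "f \<in> dom_energy" "odd_fun f" "u \<in> dom_energy" "odd_fun u"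
  shows "pcon * \<bar>sgi (\<lambda>x. f x * u x)\<bar> \<le> enorm f * enorm u"
proof -
  have "(pcon * sgi (\<lambda>x. f x * u x))\<^sup>2 \<le> pcon\<^sup>2 * (sgi (\<lambda>x. (f x)\<^sup>2) * sgi (\<lambda>x. (u x)\<^sup>2))"
    unfolding power_mult_distrib using assms by (intro mult_left_mono sgi_Cauchy_Schwarz dom_cont) auto
  also have "\<dots> = (pcon * sgi (\<lambda>x. (f x)\<^sup>2)) * (pcon * sgi (\<lambda>x. (u x)\<^sup>2))" by (simp add: power2_eq_square)
  also have "\<dots> \<le> energy f f * energy u u"
    using assms pcon_pos sgi_sq_nonneg[OF dom_cont[OF assms(3)]]
    by (intro mult_mono poincare_odd) (auto simp: energy_nonneg)
  also have "\<dots> = (enorm f * enorm u)\<^sup>2" using assms by (simp add: power_mult_distrib enorm_sq)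
  finally have "\<bar>pcon * sgi (\<lambda>x. f x * u x)\<bar> \<le> \<bar>enorm f * enorm u\<bar>" by (simp only: abs_le_square_iff)
  then show ?thesis using assms pcon_pos by (simp add: abs_mult enorm_nonneg)
qed

lemma odd_source_pairing:
  assumes "f \<in> dom_energy" "odd_fun f" "u \<in> dom_energy" "odd_fun u"
  shows "\<bar>sgi (\<lambda>x. 1 / 5 * f x * u x)\<bar> \<le> enorm f / (5 * pcon) * enorm u"
proof -
  have "sgi (\<lambda>x. 1 / 5 * f x * u x) = 1 / 5 * sgi (\<lambda>x. f x * u x)"
    using sgi_mult[of "1 / 5" "\<lambda>x. f x * u x"] by (simp only: mult.assoc)
  moreover have "\<bar>sgi (\<lambda>x. f x * u x)\<bar> \<le> enorm f * enorm u / pcon"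
    using odd_pairing_bound[OF assms] pcon_pos by (simp add: pos_le_divide_eq mult.commute)
  ultimately show ?thesis by (simp add: abs_mult)
qed

text \<open>The factor \<open>1 / (5 * pcon)\<close> joins the 1/5 of a source on a cell with the
  \<open>1 / pcon\<close> of the pairing. By oddness the boundary terms at the vertices 1 and 2 are
  equal and the one at 0 vanishes; with the bound \<open>5 * enorm u\<close> for the vertex value
  this gives \<open>10 * e\<close>.\<close>

lemma odd_neumann_estimate:
  assumes s: "solves u (\<lambda>x. 1 / 5 * f x)" and f: "f \<in> dom_energy" "odd_fun f" and u: "odd_fun u"
    and n: "\<bar>nder 2 u (\<lambda>x. 1 / 5 * f x)\<bar> \<le> e"
  shows "enorm u \<le> enorm f / (5 * pcon) + 10 * e"
proof -
  have ud: "u \<in> dom_energy" by (rule solves_dom[OF s])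
  let ?f = "\<lambda>x. 1 / 5 * f x"
  have c: "continuous_on SG ?f" by (rule solves_cont(2)[OF s])
  have "nder 1 u ?f = - nder 2 u ?f"
  proof -
    have "nder 1 u ?f = nder 2 (rf 0 u) (rf 0 ?f)" using nder_rf[OF c, of 2 0 u] by simp
    also have "\<dots> = nder 2 (\<lambda>x. (- 1) * u x) (\<lambda>x. (- 1) * ?f x)"
      by (rule nder_cong) (use u f(2) in \<open>auto simp: rf_def odd_fun_def\<close>)
    finally show ?thesis using nder_mult[OF c, of 2 "- 1" u] by simp
  qed
  then have "energy u u = 2 * nder 2 u ?f * u (vtx 2) - sgi (\<lambda>x. ?f x * u x)"
    using Gauss_Green[OF s dom_cont[OF ud]] odd_fun_vtx[OF u] by (simp add: sum_UNIV_3)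
  moreover have "\<bar>nder 2 u ?f * u (vtx 2)\<bar> \<le> e * (5 * enorm u)"
    unfolding abs_mult using n odd_fun_bound[OF u ud vtx_SG, of 2] by (intro mult_mono) auto
  moreover have "\<bar>sgi (\<lambda>x. ?f x * u x)\<bar> \<le> enorm f / (5 * pcon) * enorm u"
    by (rule odd_source_pairing[OF f ud u])
  ultimately have "energy u u \<le> 2 * (e * (5 * enorm u)) + enorm f / (5 * pcon) * enorm u" by linarith
  then have "enorm u * enorm u \<le> (enorm f / (5 * pcon) + 10 * e) * enorm u"
    using enorm_sq[OF ud] by (simp add: power2_eq_square algebra_simps)
  moreover have "enorm f / (5 * pcon) + 10 * e \<ge> 0"
    using enorm_nonneg[OF f(1)] pcon_pos n by (intro add_nonneg_nonneg divide_nonneg_nonneg) auto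
  ultimately show ?thesis using enorm_nonneg[OF ud] by (cases "enorm u = 0") auto
qed

definition oddharm :: "real ^ 2 \<Rightarrow> real" where
  "oddharm = harm (\<lambda>j. if j = 0 then 0 else if j = 1 then - 1 else 1)"

lemma odd_fun_oddharm: "odd_fun oddharm"
  unfolding odd_fun_def oddharm_def by (simp add: harm_linear hb_reflect)

text \<open>Subtracting the odd harmonic function with the same boundary values removes the boundary
  term from Gauss-Green and leaves the source unchanged.\<close>

lemma odd_dirichlet_estimate:
  assumes s: "solves u (\<lambda>x. 1 / 5 * f x)" and f: "f \<in> dom_energy" "odd_fun f" and u: "odd_fun u"
    and n: "\<bar>u (vtx 2)\<bar> \<le> e"
  shows "enorm u \<le> enorm f / (5 * pcon) + enorm oddharm * e"
proof -
  have ud: "u \<in> dom_energy" by (rule solves_dom[OF s])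
  have hd: "oddharm \<in> dom_energy" unfolding oddharm_def by (rule harm_dom)
  define z where "z = (\<lambda>x. 1 * u x + (- u (vtx 2)) * oddharm x)"
  have sz: "solves z (\<lambda>x. 1 / 5 * f x)"
    using solves_lin[OF s solves_harm, of 1 "- u (vtx 2)"] unfolding z_def oddharm_def by simp
  have zd: "z \<in> dom_energy" by (rule solves_dom[OF sz])
  have oz: "odd_fun z" unfolding z_def by (rule odd_fun_lin[OF u odd_fun_oddharm])
  have z0: "z (vtx i) = 0" for i
    using odd_fun_vtx[OF u] exh_3[of i] by (auto simp: z_def oddharm_def)
  have "energy z z = - sgi (\<lambda>x. 1 / 5 * f x * z x)"
    using Gauss_Green[OF sz dom_cont[OF zd]] by (simp add: z0)
  then have "enorm z * enorm z \<le> enorm f / (5 * pcon) * enorm z"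
    using odd_source_pairing[OF f zd oz] enorm_sq[OF zd] by (simp add: power2_eq_square)
  moreover have "enorm f / (5 * pcon) \<ge> 0" using enorm_nonneg[OF f(1)] pcon_pos by simp
  ultimately have "enorm z \<le> enorm f / (5 * pcon)"
    using enorm_nonneg[OF zd] mult_right_le_imp_le[of "enorm z" "enorm z"] by (cases "enorm z = 0") (auto simp del: times_divide_eq_left)
  moreover have "enorm u \<le> enorm z + \<bar>u (vtx 2)\<bar> * enorm oddharm"
    using enorm_lin[OF zd hd, of 1 "u (vtx 2)"] by (simp add: z_def)
  moreover have "\<bar>u (vtx 2)\<bar> * enorm oddharm \<le> e * enorm oddharm"
    using n enorm_nonneg[OF hd] by (intro mult_right_mono)
  ultimately show ?thesis by (simp add: mult.commute)
qed

text \<open>A discrete Gronwall inequality. The constant is large enough that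
  \<open>q * B + K * r\<close> is at most \<open>B * r\<close>, which needs \<open>q\<close>
  strictly below \<open>r\<close>; hence the strict bound on the rate in everything that
  follows.\<close>

lemma linear_recursion_bound:
  assumes X: "\<And>i. i < L \<Longrightarrow> X (Suc i) \<le> q * X i + K * r ^ Suc i" and X0: "X 0 \<le> K0"
    and q: "0 \<le> q" "q < (r::real)" and K: "K \<ge> 0" "K0 \<ge> 0" and i: "i \<le> L"
  shows "X i \<le> (K0 + K * r / (r - q)) * r ^ i"
  using i
proof (induction i)
  case 0
  then show ?case using X0 K q by (simp add: add_increasing2)
next
  case (Suc i)
  define B where "B = K0 + K * r / (r - q)"
  have "X (Suc i) \<le> q * X i + K * r ^ Suc i" using X Suc by simp
  also have "q * X i \<le> q * (B * r ^ i)" using Suc q by (intro mult_left_mono) (auto simp: B_def)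
  also have "q * (B * r ^ i) + K * r ^ Suc i = (q * B + K * r) * r ^ i" by (simp add: algebra_simps)
  also have "\<dots> \<le> (B * r) * r ^ i"
  proof (rule mult_right_mono)
    have "K * r = (r - q) * (K * r / (r - q))" using q by simp
    also have "\<dots> \<le> (r - q) * B" using q K by (intro mult_left_mono) (auto simp: B_def)
    finally show "q * B + K * r \<le> B * r" by (simp add: algebra_simps)
    show "0 \<le> r ^ i" using q by simp
  qed
  finally show ?case by (simp add: B_def mult_ac)
qed

lemma ssub_sub: "ssub a f = (\<lambda>x. 1 / 5 * sub a f x)"
  by (simp add: ssub_def sub_def)

lemma enorm_sub: "u \<in> dom_energy \<Longrightarrow> enorm (sub i u) \<le> enorm u"
  using enorm_sub_le[of u i] energy_nonneg[of u] unfolding enorm_def by (intro real_sqrt_le_mono) linarith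

lemma tangential_sub:
  assumes "has_tangential_deriv u t 0" shows "has_tangential_deriv (sub 0 u) (1 / 5 * t) 0"
proof -
  have "(\<lambda>m. 1 / 5 * (5 ^ Suc m * (u ((contr 0 ^^ Suc m) (vtx (0 + 1))) - u ((contr 0 ^^ Suc m) (vtx (0 - 1)))))) \<longlonglongrightarrow> 1 / 5 * t"
    using LIMSEQ_Suc[OF assms[unfolded has_tangential_deriv_def]] by (rule tendsto_mult_left)
  then show ?thesis unfolding has_tangential_deriv_def by (simp add: sub_def)
qed

lemma enorm_pieces:
  assumes "u \<in> dom_energy"
  shows "enorm u \<le> 2 * (enorm (sub 0 u) + enorm (sub 1 u) + enorm (sub 2 u))"
proof -
  define a b c where "a = enorm (sub 0 u)" and "b = enorm (sub 1 u)" and "c = enorm (sub 2 u)"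
  have n: "a \<ge> 0" "b \<ge> 0" "c \<ge> 0" unfolding a_def b_def c_def using assms by (simp_all add: enorm_nonneg dom_sub)
  have "energy u u = 5 / 3 * (a\<^sup>2 + b\<^sup>2 + c\<^sup>2)"
    using energy_self_similar[OF assms assms] unfolding a_def b_def c_def
    by (simp add: sum_UNIV_3 enorm_sq dom_sub assms)
  also have "\<dots> \<le> (2 * (a + b + c))\<^sup>2"
  proof -
    have "(2 * (a + b + c))\<^sup>2 = 5 / 3 * (a\<^sup>2 + b\<^sup>2 + c\<^sup>2) + (7 / 3 * (a\<^sup>2 + b\<^sup>2 + c\<^sup>2) + 8 * (a * b) + 8 * (b * c) + 8 * (a * c))"
      by (simp add: power2_eq_square field_simps)
    moreover have "0 \<le> 7 / 3 * (a\<^sup>2 + b\<^sup>2 + c\<^sup>2) + 8 * (a * b) + 8 * (b * c) + 8 * (a * c)" using n by simp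
    ultimately show ?thesis by linarith
  qed
  finally show ?thesis using n unfolding enorm_def[of u] a_def[symmetric] b_def[symmetric] c_def[symmetric]
    by (intro real_le_lsqrt) auto
qed

text \<open>The even parts on the cells 1 and 2 are again governed by their jets, which come from the cell 0.
  The two odd parts decouple into their difference, with small Neumann data at the junction of the
  cells 1 and 2, and their sum, with small Dirichlet data there.\<close>

locale jet_chain_step =
  fixes A r M :: real and L :: nat and u :: "nat \<Rightarrow> real ^ 2 \<Rightarrow> real"
  assumes D: "decays (1 / 5) A r" and A: "A \<ge> 0" and r: "1 / (5 * pcon) < r" and ch: "jet_chain 1 M r L u"
begin

lemma r0: "r > 0"
proof -
  have "0 < 1 / (5 * pcon)" using pcon_pos by simp
  then show ?thesis using r by linarith
qed

lemma M0: "M \<ge> 0" by (rule jet_chain_nonneg[OF ch])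

lemma udom: "i \<le> L \<Longrightarrow> u i \<in> dom_energy" by (rule jet_chain_dom[OF ch])

lemma u_solves: "i < L \<Longrightarrow> solves (u (Suc i)) (u i)"
  using ch by (simp add: jet_chain_def)

lemma sub_solves: "i < L \<Longrightarrow> solves (sub a (u (Suc i))) (\<lambda>x. 1 / 5 * sub a (u i) x)"
  using solves_sub[OF u_solves, of i a] unfolding ssub_sub .

lemma u_matched:
  assumes "i < L" "a \<noteq> b"
  shows "nder b (sub a (u (Suc i))) (\<lambda>x. 1 / 5 * sub a (u i) x) + nder a (sub b (u (Suc i))) (\<lambda>x. 1 / 5 * sub b (u i) x) = 0"
proof -
  have "matched (u (Suc i)) (u i)" using u_solves[OF assms(1)] solves_iff by blast
  then show ?thesis using assms(2) unfolding matched_def ssub_sub by simp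
qed

lemma bnorm_u0: "bnorm (u 0) \<le> M" and enorm_u0: "enorm (u 0) \<le> M"
  using ch enorm_le_bnorm[of "u 0"] unfolding jet_chain_def by linarith+

text \<open>Restriction to the cell at \<open>vtx 0\<close> keeps the value there and multiplies the
  normal derivative by 3/5 and the tangential one by 1/5, so the restricted chain obeys the same jet
  bounds.\<close>

lemma cell0: "i \<le> L \<Longrightarrow> bnorm (sub 0 (u i)) \<le> A * M * r ^ i"
proof -
  have "jet_chain (1 / 5) M r L (\<lambda>i. sub 0 (u i))"
    unfolding jet_chain_def
  proof (intro conjI allI impI)
    show "sub 0 (u 0) \<in> dom_energy" using udom[of 0] by (simp add: dom_sub)
    show "bnorm (sub 0 (u 0)) \<le> M"
      using bnorm_u0 enorm_sub[OF udom[of 0], of 0] by (simp add: bnorm_def sub_def)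
    fix i assume i: "i < L"
    show s: "solves (sub 0 (u (Suc i))) (\<lambda>x. 1 / 5 * sub 0 (u i) x)" by (rule sub_solves[OF i])
    have b: "\<bar>u (Suc i) (vtx 0)\<bar> \<le> M * r ^ Suc i" "\<bar>nder 0 (u (Suc i)) (u i)\<bar> \<le> M * r ^ Suc i"
      using ch i by (auto simp: jet_chain_def)
    show "\<bar>sub 0 (u (Suc i)) (vtx 0)\<bar> \<le> M * r ^ Suc i" using b by (simp add: sub_def)
    have "matched (u (Suc i)) (u i)" using u_solves[OF i] solves_iff by blast
    from nder_rec[OF solves_cont(2)[OF u_solves[OF i]] this, of 0]
    have "\<bar>nder 0 (sub 0 (u (Suc i))) (\<lambda>x. 1 / 5 * sub 0 (u i) x)\<bar> \<le> \<bar>nder 0 (u (Suc i)) (u i)\<bar>"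
      unfolding ssub_sub by (simp add: abs_mult)
    then show "\<bar>nder 0 (sub 0 (u (Suc i))) (\<lambda>x. 1 / 5 * sub 0 (u i) x)\<bar> \<le> M * r ^ Suc i" using b(2) by linarith
    obtain t where t: "has_tangential_deriv (u (Suc i)) t 0" "\<bar>t\<bar> \<le> M * r ^ Suc i"
      using ch i unfolding jet_chain_def by blast
    have "\<bar>1 / 5 * t\<bar> \<le> M * r ^ Suc i" using t(2) by (simp add: abs_mult)
    then show "\<exists>t. has_tangential_deriv (sub 0 (u (Suc i))) t 0 \<and> \<bar>t\<bar> \<le> M * r ^ Suc i"
      using tangential_sub[OF t(1)] by blast
  qed
  then show "i \<le> L \<Longrightarrow> bnorm (sub 0 (u i)) \<le> A * M * r ^ i" using D unfolding decays_def by blast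
qed

text \<open>Each summand covers one requirement on the even chain: 6 its first member,
  \<open>5 * A\<close> the values at the junction with the cell 0, and \<open>20 * A + A / r\<close>
  the normal derivatives there, where \<open>A / r\<close> accounts for the source having the
  previous index.\<close>

definition "C2 = 6 + 5 * A + 20 * A + A / r"

lemma C2_pos: "C2 \<ge> 0" unfolding C2_def using A r0 by simp

definition "C3 = A * C2"

lemma C3_pos: "C3 \<ge> 0" unfolding C3_def using A C2_pos by simp

text \<open>On the cell \<open>a\<close> the vertex 0 is the junction with the cell 0. Value and
  normal derivative there are known from \<open>cell0\<close> by continuity and matching, also for
  the even part, and the tangential derivative of an even function is zero.\<close>

lemma even_part: "a \<noteq> 0 \<Longrightarrow> i \<le> L \<Longrightarrow> bnorm (evp (sub a (u i))) \<le> C3 * M * r ^ i"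
proof -
  assume a: "a \<noteq> 0"
  have "jet_chain (1 / 5) (C2 * M) r L (\<lambda>i. evp (sub a (u i)))"
    unfolding jet_chain_def
  proof (intro conjI allI impI)
    have d: "sub a (u 0) \<in> dom_energy" using udom[of 0] by (simp add: dom_sub)
    show "evp (sub a (u 0)) \<in> dom_energy" by (rule evp_dom[OF d])
    have "\<bar>sub a (u 0) (vtx 0)\<bar> \<le> 5 * M"
      using bnorm_upper[OF udom[of 0], of "contr a (vtx 0)"] bnorm_u0 by (simp add: sub_def)
    moreover have "enorm (evp (sub a (u 0))) \<le> M"
      using enorm_evp[OF d] enorm_sub[OF udom[of 0], of a] enorm_u0 by simp
    ultimately have "bnorm (evp (sub a (u 0))) \<le> 6 * M" by (simp add: bnorm_def evp_vtx_0)
    also have "\<dots> \<le> C2 * M" using M0 A r0 by (intro mult_right_mono) (auto simp: C2_def)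
    finally show "bnorm (evp (sub a (u 0))) \<le> C2 * M" .
    fix i assume i: "i < L"
    have s: "solves (evp (sub a (u (Suc i)))) (evp (\<lambda>x. 1 / 5 * sub a (u i) x))" by (rule solves_evp[OF sub_solves[OF i]])
    then show "solves (evp (sub a (u (Suc i)))) (\<lambda>x. 1 / 5 * evp (sub a (u i)) x)" by (simp only: evp_mult)
    have MR: "M * r ^ Suc i \<ge> 0" using M0 r0 by simp
    have d0: "sub 0 (u (Suc i)) \<in> dom_energy" "sub 0 (u i) \<in> dom_energy" using udom i by (simp_all add: dom_sub)
    have c0: "bnorm (sub 0 (u (Suc i))) \<le> A * M * r ^ Suc i" "bnorm (sub 0 (u i)) \<le> A * M * r ^ i"
      using cell0[of "Suc i"] cell0[of i] i by simp_all
    have "\<bar>evp (sub a (u (Suc i))) (vtx 0)\<bar> = \<bar>sub 0 (u (Suc i)) (vtx a)\<bar>"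
      by (simp add: evp_vtx_0 sub_def contr_vtx_comm)
    also have "\<dots> \<le> 5 * (A * M * r ^ Suc i)" using bnorm_upper[OF d0(1) vtx_SG, of a] c0(1) by linarith
    also have "\<dots> = (5 * A) * (M * r ^ Suc i)" by simp
    also have "\<dots> \<le> C2 * (M * r ^ Suc i)" using MR A r0 by (intro mult_right_mono) (auto simp: C2_def)
    finally show "\<bar>evp (sub a (u (Suc i))) (vtx 0)\<bar> \<le> C2 * M * r ^ Suc i" by (simp only: mult.assoc)
    have c: "continuous_on SG (\<lambda>x. 1 / 5 * sub a (u i) x)" by (rule solves_cont(2)[OF sub_solves[OF i]])
    have "nder 0 (evp (sub a (u (Suc i)))) (\<lambda>x. 1 / 5 * evp (sub a (u i)) x) = nder 0 (sub a (u (Suc i))) (\<lambda>x. 1 / 5 * sub a (u i) x)"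
      unfolding evp_mult[symmetric] nder_evp[OF c] by simp
    also have "\<dots> = - nder a (sub 0 (u (Suc i))) (\<lambda>x. 1 / 5 * sub 0 (u i) x)"
      using u_matched[OF i a] by simp
    also have "\<bar>\<dots>\<bar> \<le> 20 * bnorm (sub 0 (u (Suc i))) + 5 * bnorm (\<lambda>x. 1 / 5 * sub 0 (u i) x)"
      unfolding abs_minus_cancel by (rule nder_bound[OF d0(1) dom_mult[OF d0(2)]])
    also have "5 * bnorm (\<lambda>x. 1 / 5 * sub 0 (u i) x) = bnorm (sub 0 (u i))" unfolding bnorm_mult[OF d0(2)] by simp
    also have "20 * bnorm (sub 0 (u (Suc i))) + bnorm (sub 0 (u i)) \<le> 20 * (A * M * r ^ Suc i) + A * M * r ^ i"
      using c0 by linarith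
    also have "\<dots> = (20 * A + A / r) * (M * r ^ Suc i)" using r0 by (simp add: field_simps)
    also have "\<dots> \<le> C2 * (M * r ^ Suc i)" using MR A by (intro mult_right_mono) (auto simp: C2_def)
    finally show "\<bar>nder 0 (evp (sub a (u (Suc i)))) (\<lambda>x. 1 / 5 * evp (sub a (u i)) x)\<bar> \<le> C2 * M * r ^ Suc i"
      by (simp only: mult.assoc)
    show "\<exists>t. has_tangential_deriv (evp (sub a (u (Suc i)))) t 0 \<and> \<bar>t\<bar> \<le> C2 * M * r ^ Suc i"
      using evp_tangential C2_pos MR by (intro exI[of _ 0]) (simp add: mult.assoc)
  qed
  then have "i \<le> L \<Longrightarrow> bnorm (evp (sub a (u i))) \<le> A * (C2 * M) * r ^ i" using D unfolding decays_def by blast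
  then show "i \<le> L \<Longrightarrow> bnorm (evp (sub a (u i))) \<le> C3 * M * r ^ i" by (simp add: C3_def mult.assoc)
qed

definition "dif i = (\<lambda>x. 1 * odp (sub 1 (u i)) x + (- 1) * odp (sub 2 (u i)) x)"

definition "tot i = (\<lambda>x. 1 * odp (sub 1 (u i)) x + 1 * odp (sub 2 (u i)) x)"

lemma odp_sub_dom: "i \<le> L \<Longrightarrow> odp (sub a (u i)) \<in> dom_energy"
  by (intro odp_dom dom_sub udom)

lemma dif_dom: "i \<le> L \<Longrightarrow> dif i \<in> dom_energy" and tot_dom: "i \<le> L \<Longrightarrow> tot i \<in> dom_energy"
  unfolding dif_def tot_def by (intro dom_lin odp_sub_dom; assumption)+

lemma odd_dif: "odd_fun (dif i)" and odd_tot: "odd_fun (tot i)"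
  unfolding dif_def tot_def by (intro odd_fun_lin odd_fun_odp)+

lemma odp_sub_solves: "i < L \<Longrightarrow> solves (odp (sub a (u (Suc i)))) (\<lambda>x. 1 / 5 * odp (sub a (u i)) x)"
  using solves_odp[OF sub_solves, of i a] unfolding odp_mult .

lemma dif_source: "(\<lambda>x. 1 / 5 * dif i x) = (\<lambda>x. 1 * (1 / 5 * odp (sub 1 (u i)) x) + (- 1) * (1 / 5 * odp (sub 2 (u i)) x))"
  and tot_source: "(\<lambda>x. 1 / 5 * tot i x) = (\<lambda>x. 1 * (1 / 5 * odp (sub 1 (u i)) x) + 1 * (1 / 5 * odp (sub 2 (u i)) x))"
  by (simp_all add: dif_def tot_def fun_eq_iff)

lemma dif_solves: "i < L \<Longrightarrow> solves (dif (Suc i)) (\<lambda>x. 1 / 5 * dif i x)"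
  unfolding dif_source unfolding dif_def by (intro solves_lin odp_sub_solves)

lemma tot_solves: "i < L \<Longrightarrow> solves (tot (Suc i)) (\<lambda>x. 1 / 5 * tot i x)"
  unfolding tot_source unfolding tot_def by (intro solves_lin odp_sub_solves)

text \<open>Matching at the junction of the cells 1 and 2 involves the vertex 2 of one cell and the
  vertex 1 of the other. Splitting both normal derivatives into even and odd parts and using oddness
  expresses that of the difference through the even parts alone.\<close>

lemma dif_neumann:
  assumes i: "i < L"
  shows "\<bar>nder 2 (dif (Suc i)) (\<lambda>x. 1 / 5 * dif i x)\<bar> \<le> (40 * C3 + 2 * C3 / r) * M * r ^ Suc i"
proof -
  let ?h = "\<lambda>a. sub a (u (Suc i))" and ?f = "\<lambda>a x. 1 / 5 * sub a (u i) x"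
  have c: "continuous_on SG (?f a)" for a by (rule solves_cont(2)[OF sub_solves[OF i]])
  have co: "continuous_on SG (\<lambda>x. 1 / 5 * odp (sub a (u i)) x)" for a by (rule solves_cont(2)[OF odp_sub_solves[OF i]])
  have e: "\<bar>nder 2 (evp (?h 1)) (evp (?f 1))\<bar> \<le> (20 * C3 + C3 / r) * M * r ^ Suc i"
    "\<bar>nder 1 (evp (?h 2)) (evp (?f 2))\<bar> \<le> (20 * C3 + C3 / r) * M * r ^ Suc i"
  proof -
    have "\<bar>nder b (evp (?h a)) (evp (?f a))\<bar> \<le> (20 * C3 + C3 / r) * M * r ^ Suc i" if a: "a \<noteq> 0" for a b
    proof -
      have d: "evp (?h a) \<in> dom_energy" "evp (sub a (u i)) \<in> dom_energy" using udom i by (auto intro!: evp_dom dom_sub)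
      have "\<bar>nder b (evp (?h a)) (evp (?f a))\<bar> \<le> 20 * bnorm (evp (?h a)) + 5 * bnorm (\<lambda>x. 1 / 5 * evp (sub a (u i)) x)"
        unfolding evp_mult by (rule nder_bound[OF d(1) dom_mult[OF d(2)]])
      also have "5 * bnorm (\<lambda>x. 1 / 5 * evp (sub a (u i)) x) = bnorm (evp (sub a (u i)))" unfolding bnorm_mult[OF d(2)] by simp
      also have "20 * bnorm (evp (?h a)) + bnorm (evp (sub a (u i))) \<le> 20 * (C3 * M * r ^ Suc i) + C3 * M * r ^ i"
        using even_part[OF a, of "Suc i"] even_part[OF a, of i] i by simp
      also have "\<dots> = (20 * C3 + C3 / r) * M * r ^ Suc i" using r0 by (simp add: field_simps)
      finally show ?thesis .
    qed
    then show "\<bar>nder 2 (evp (?h 1)) (evp (?f 1))\<bar> \<le> (20 * C3 + C3 / r) * M * r ^ Suc i"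
      "\<bar>nder 1 (evp (?h 2)) (evp (?f 2))\<bar> \<le> (20 * C3 + C3 / r) * M * r ^ Suc i" by simp_all
  qed
  have "nder 2 (dif (Suc i)) (\<lambda>x. 1 / 5 * dif i x)
      = 1 * nder 2 (odp (?h 1)) (odp (?f 1)) + (- 1) * nder 2 (odp (?h 2)) (odp (?f 2))"
    unfolding dif_source odp_mult unfolding dif_def by (rule nder_lin[OF co co])
  also have "\<dots> = - (nder 2 (evp (?h 1)) (evp (?f 1)) + nder 1 (evp (?h 2)) (evp (?f 2)))"
  proof -
    \<comment> \<open>Here \<open>x\<close> and \<open>y\<close> are the normal derivatives at the
      vertices 2 and 1 of the cell 1, \<open>z\<close> and \<open>w\<close> those of the cell 2;
      \<open>x + w = 0\<close> is the matching condition.\<close>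
    have "1 * ((x - y) / 2) + (- 1) * ((z - w) / 2) = - ((x + y) / 2 + (w + z) / 2)" if "x + w = 0" for x y z w :: real
    proof -
      have "w = - x" using that by simp
      then show ?thesis by (simp add: field_simps)
    qed
    then show ?thesis
      using u_matched[OF i, of 1 2] unfolding nder_odp[OF c] nder_evp[OF c] three_arith by simp
  qed
  also have "\<bar>\<dots>\<bar> \<le> 2 * ((20 * C3 + C3 / r) * M * r ^ Suc i)" using e by linarith
  also have "\<dots> = (40 * C3 + 2 * C3 / r) * M * r ^ Suc i"
  proof -
    have "40 * C3 + 2 * C3 / r = 2 * (20 * C3 + C3 / r)" by simp
    then show ?thesis by (simp only: mult.assoc)
  qed
  finally show ?thesis .
qed

text \<open>The values of \<open>u i\<close> on both sides of the junction of the cells 1 and 2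
  agree. By oddness they cancel in the sum and leave a difference of values of the even
  parts.\<close>

lemma tot_dirichlet:
  assumes i: "i \<le> L" shows "\<bar>tot i (vtx 2)\<bar> \<le> 10 * C3 * M * r ^ i"
proof -
  have d: "evp (sub a (u i)) \<in> dom_energy" for a using udom[OF i] by (auto intro!: evp_dom dom_sub)
  have "tot i (vtx 2) = evp (sub 2 (u i)) (vtx 2) - evp (sub 1 (u i)) (vtx 2)"
    by (simp add: tot_def odp_def evp_def rf_def sub_def junctions)
  moreover have "\<bar>evp (sub a (u i)) (vtx 2)\<bar> \<le> 5 * (C3 * M * r ^ i)" if "a \<noteq> 0" for a
    using bnorm_upper[OF d[of a] vtx_SG, of 2] even_part[OF that i] by linarith
  from this[of 1, simplified] this[of 2, simplified] have "\<bar>evp (sub 1 (u i)) (vtx 2)\<bar> \<le> 5 * (C3 * M * r ^ i)"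
    "\<bar>evp (sub 2 (u i)) (vtx 2)\<bar> \<le> 5 * (C3 * M * r ^ i)" by (simp_all add: mult.assoc)
  then have "\<bar>evp (sub 2 (u i)) (vtx 2) - evp (sub 1 (u i)) (vtx 2)\<bar> \<le> 5 * (C3 * M * r ^ i) + 5 * (C3 * M * r ^ i)"
    by linarith
  moreover have "5 * (C3 * M * r ^ i) + 5 * (C3 * M * r ^ i) = 10 * C3 * M * r ^ i" by simp
  ultimately show ?thesis by (simp only:)
qed

definition "Cd = 2 + 10 * (40 * C3 + 2 * C3 / r) * r / (r - 1 / (5 * pcon))"

definition "Ct = 2 + enorm oddharm * (10 * C3) * r / (r - 1 / (5 * pcon))"

lemma enorm_odd_0: "enorm (dif 0) \<le> 2 * M" "enorm (tot 0) \<le> 2 * M"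
proof -
  have "enorm (odp (sub a (u 0))) \<le> M" for a
    using enorm_odp[OF dom_sub[OF udom[of 0]], of a] enorm_sub[OF udom[of 0], of a] enorm_u0 by simp
  from this[of 1] this[of 2] show "enorm (dif 0) \<le> 2 * M" "enorm (tot 0) \<le> 2 * M"
    using enorm_lin[OF odp_sub_dom[of 0 1] odp_sub_dom[of 0 2], of 1 "- 1"]
      enorm_lin[OF odp_sub_dom[of 0 1] odp_sub_dom[of 0 2], of 1 1]
    unfolding dif_def tot_def by simp_all
qed

lemma q0: "0 \<le> 1 / (5 * pcon)" using pcon_pos by simp

lemma dif_bound: assumes "i \<le> L" shows "enorm (dif i) \<le> Cd * M * r ^ i"
proof -
  have "enorm (dif i) \<le> (2 * M + 10 * (40 * C3 + 2 * C3 / r) * M * r / (r - 1 / (5 * pcon))) * r ^ i"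
  proof (rule linear_recursion_bound[where X = "\<lambda>i. enorm (dif i)" and L = L, OF _ enorm_odd_0(1) q0 r])
    fix i assume i: "i < L"
    show "enorm (dif (Suc i)) \<le> 1 / (5 * pcon) * enorm (dif i) + 10 * (40 * C3 + 2 * C3 / r) * M * r ^ Suc i"
      using odd_neumann_estimate[OF dif_solves[OF i] dif_dom odd_dif odd_dif dif_neumann[OF i]] i
      by (simp only: mult.assoc times_divide_eq_left mult_1_left less_imp_le_nat)
  qed (use C3_pos r0 M0 assms in auto)
  also have "2 * M + 10 * (40 * C3 + 2 * C3 / r) * M * r / (r - 1 / (5 * pcon)) = Cd * M"
  proof -
    have "x * M * r / z = x * r / z * M" for x z :: real by simp
    then show ?thesis by (simp only: Cd_def distrib_right)
  qed
  finally show ?thesis .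
qed

lemma tot_bound: assumes "i \<le> L" shows "enorm (tot i) \<le> Ct * M * r ^ i"
proof -
  have hd: "enorm oddharm \<ge> 0" unfolding oddharm_def by (rule enorm_nonneg[OF harm_dom])
  have "enorm (tot i) \<le> (2 * M + enorm oddharm * (10 * C3) * M * r / (r - 1 / (5 * pcon))) * r ^ i"
  proof (rule linear_recursion_bound[where X = "\<lambda>i. enorm (tot i)" and L = L, OF _ enorm_odd_0(2) q0 r])
    fix i assume i: "i < L"
    show "enorm (tot (Suc i)) \<le> 1 / (5 * pcon) * enorm (tot i) + enorm oddharm * (10 * C3) * M * r ^ Suc i"
      using odd_dirichlet_estimate[OF tot_solves[OF i] tot_dom odd_tot odd_tot tot_dirichlet[of "Suc i"]] i
      by (simp add: mult_ac)
  qed (use C3_pos r0 M0 assms hd in auto)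
  also have "2 * M + enorm oddharm * (10 * C3) * M * r / (r - 1 / (5 * pcon)) = Ct * M"
  proof -
    have "x * M * r / z = x * r / z * M" for x z :: real by simp
    then show ?thesis by (simp only: Ct_def distrib_right)
  qed
  finally show ?thesis .
qed

lemma step_bound:
  assumes i: "i \<le> L" shows "bnorm (u i) \<le> (3 * A + 4 * (C3 + Cd + Ct)) * M * r ^ i"
proof -
  define Q where "Q = M * r ^ i"
  have o: "enorm (odp (sub a (u i))) \<le> (Cd + Ct) * Q" if "a = 1 \<or> a = 2" for a
  proof -
    have "odp (sub 1 (u i)) = (\<lambda>x. 1 / 2 * dif i x + 1 / 2 * tot i x)"
      "odp (sub 2 (u i)) = (\<lambda>x. (- 1 / 2) * dif i x + 1 / 2 * tot i x)"
      by (simp_all add: dif_def tot_def fun_eq_iff field_simps)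
    then have "enorm (odp (sub a (u i))) \<le> 1 / 2 * enorm (dif i) + 1 / 2 * enorm (tot i)"
      using that enorm_lin[OF dif_dom[OF i] tot_dom[OF i], of "1 / 2" "1 / 2"]
        enorm_lin[OF dif_dom[OF i] tot_dom[OF i], of "- 1 / 2" "1 / 2"] by auto
    also have "\<dots> \<le> enorm (dif i) + enorm (tot i)"
      using enorm_nonneg[OF dif_dom[OF i]] enorm_nonneg[OF tot_dom[OF i]] by simp
    also have "\<dots> \<le> (Cd + Ct) * Q" using dif_bound[OF i] tot_bound[OF i] by (simp add: Q_def algebra_simps)
    finally show ?thesis .
  qed
  have s: "enorm (sub a (u i)) \<le> (C3 + Cd + Ct) * Q" if a: "a = 1 \<or> a = 2" for a
  proof -
    have d: "sub a (u i) \<in> dom_energy" by (rule dom_sub[OF udom[OF i]])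
    have "enorm (sub a (u i)) \<le> enorm (evp (sub a (u i))) + enorm (odp (sub a (u i)))"
      using enorm_add[OF evp_dom[OF d] odp_dom[OF d]] by (simp flip: evp_add_odp)
    also have "enorm (evp (sub a (u i))) \<le> C3 * Q"
      using even_part[of a i] enorm_le_bnorm[of "evp (sub a (u i))"] a i by (auto simp: Q_def mult.assoc)
    finally show ?thesis using o[OF a] by (simp add: algebra_simps)
  qed
  have c0: "bnorm (sub 0 (u i)) \<le> A * Q" using cell0[OF i] by (simp add: Q_def mult.assoc)
  have e0: "enorm (sub 0 (u i)) \<le> A * Q" using c0 enorm_le_bnorm[of "sub 0 (u i)"] by linarith
  have v0: "\<bar>u i (vtx 0)\<bar> \<le> A * Q"
    using c0 enorm_nonneg[OF dom_sub[OF udom[OF i]], of 0] by (simp add: bnorm_def sub_def)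
  have "enorm (u i) \<le> 2 * enorm (sub 0 (u i)) + 2 * enorm (sub 1 (u i)) + 2 * enorm (sub 2 (u i))"
    using enorm_pieces[OF udom[OF i]] by simp
  then have "bnorm (u i) \<le> 3 * (A * Q) + 4 * ((C3 + Cd + Ct) * Q)"
    using v0 e0 s[of 1] s[of 2] unfolding bnorm_def by simp
  also have "\<dots> = (3 * A + 4 * (C3 + Cd + Ct)) * M * r ^ i" by (simp add: Q_def algebra_simps)
  finally show ?thesis .
qed

end

lemma decays_step:
  assumes D: "decays (1 / 5) A r" and A: "A \<ge> 0" and r: "1 / (5 * pcon) < r"
  shows "\<exists>A'. decays 1 A' r"
proof -
  \<comment> \<open>The new constant has to be fixed before any chain is given, so the constants of
    the locale are written out in terms of \<open>A\<close> and \<open>r\<close>.\<close>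
  define c2 where "c2 = 6 + 5 * A + 20 * A + A / r"
  define cd where "cd = 2 + 10 * (40 * (A * c2) + 2 * (A * c2) / r) * r / (r - 1 / (5 * pcon))"
  define ct where "ct = 2 + enorm oddharm * (10 * (A * c2)) * r / (r - 1 / (5 * pcon))"
  have "decays 1 (3 * A + 4 * (A * c2 + cd + ct)) r"
    unfolding decays_def
  proof (intro allI impI)
    fix M L u i assume ch: "jet_chain 1 M r L u" and i: "i \<le> L"
    interpret jet_chain_step A r M L u by unfold_locales (rule D A r ch)+
    show "bnorm (u i) \<le> (3 * A + 4 * (A * c2 + cd + ct)) * M * r ^ i"
      using step_bound[OF i] unfolding Cd_def Ct_def C3_def C2_def cd_def ct_def c2_def .
  qed
  then show ?thesis by blast
qed

lemma decays_nonneg: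
  assumes "decays c A r" "r \<ge> 0" shows "decays c \<bar>A\<bar> r"
  unfolding decays_def
proof (intro allI impI)
  fix M L v i assume ch: "jet_chain c M r L v" and i: "i \<le> L"
  have "bnorm (v i) \<le> A * (M * r ^ i)" using assms(1) ch i unfolding decays_def by (simp add: mult.assoc)
  also have "\<dots> \<le> \<bar>A\<bar> * (M * r ^ i)" using jet_chain_nonneg[OF ch] assms(2) by (intro mult_right_mono) auto
  finally show "bnorm (v i) \<le> \<bar>A\<bar> * M * r ^ i" by (simp add: mult.assoc)
qed

text \<open>Some \<open>r * 5 ^ n\<close> is beyond 20000, where \<open>decays_large\<close>
  applies. Each descent from \<open>r * 5 ^ Suc k\<close> to \<open>r * 5 ^ k\<close> rescales to a
  cell and returns to the gasket by \<open>decays_step\<close>, whose hypothesis holds as all these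
  rates are at least \<open>r\<close>.\<close>

lemma decays_all:
  assumes r: "1 / (5 * pcon) < r" shows "\<exists>A. decays 1 A r"
proof -
  have r0: "r > 0" using r pcon_pos by (meson divide_pos_pos less_trans mult_pos_pos zero_less_numeral zero_less_one)
  have le: "r \<le> r * 5 ^ k" for k :: nat using r0 by simp
  obtain n :: nat where n: "20000 / r < 5 ^ n" using real_arch_pow[of 5 "20000 / r"] by auto
  have base: "decays 1 60000 (r * 5 ^ n)" using n r0 by (intro decays_large) (simp add: pos_divide_less_eq mult.commute)
  have "\<exists>A. decays 1 A (r * 5 ^ k)" if "k \<le> n" for k
    using that
  proof (induction k rule: inc_induct)
    case base then show ?case using \<open>decays 1 60000 (r * 5 ^ n)\<close> by blast
  next
    case (step k)
    then obtain A where A: "decays 1 A (r * 5 ^ Suc k)" by blast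
    have "decays 1 \<bar>A\<bar> (5 * (r * 5 ^ k))" using decays_nonneg[OF A] r0 by (simp add: mult_ac)
    then have "decays (1 / 5) \<bar>A\<bar> (r * 5 ^ k)" by (rule decays_rescale)
    then show ?case using r le[of k] by (intro decays_step) auto
  qed
  from this[of 0] show ?thesis by simp
qed

section \<open>Functions of controlled growth are determined by their values on a cell\<close>

lemma nder_sup_bound:
  assumes "continuous_on SG f" "\<And>x. x \<in> SG \<Longrightarrow> \<bar>u x\<bar> \<le> a" "\<And>x. x \<in> SG \<Longrightarrow> \<bar>f x\<bar> \<le> b"
  shows "\<bar>nder i u f\<bar> \<le> 4 * a + b"
proof -
  have "\<bar>H i f\<bar> \<le> b" using H_bound[OF assms(1), of i] snorm_least[of f b, OF assms(3)] by linarith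
  then show ?thesis
    using assms(2)[OF vtx_SG, of i] assms(2)[OF vtx_SG, of "i + 1"] assms(2)[OF vtx_SG, of "i - 1"]
    unfolding nder_def by linarith
qed

text \<open>Iterated Laplacians come with supremum bounds only, while the decay estimate measures
  the start of a chain by \<open>bnorm\<close>. Gauss-Green with \<open>u\<close> itself converts
  one into the other, since the source is bounded as well.\<close>

lemma enorm_sup_bound:
  assumes s: "solves u f" and u: "\<And>x. x \<in> SG \<Longrightarrow> \<bar>u x\<bar> \<le> a" and f: "\<And>x. x \<in> SG \<Longrightarrow> \<bar>f x\<bar> \<le> R * a" and R: "R \<ge> 0"
  shows "enorm u \<le> (4 + R) * a"
proof -
  have a0: "a \<ge> 0" using u[OF vtx_SG[of 0]] by linarith
  have c: "continuous_on SG u" "continuous_on SG f" using solves_cont[OF s] by auto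
  have n: "\<bar>nder i u f\<bar> \<le> 4 * a + R * a" for i by (rule nder_sup_bound[OF c(2) u f])
  have "\<bar>nder i u f * u (vtx i)\<bar> \<le> (4 * a + R * a) * a" for i
    unfolding abs_mult by (rule mult_mono[OF n u[OF vtx_SG]]) (use a0 R in auto)
  from this[of 0] this[of 1] this[of 2]
  have "(\<Sum>i\<in>UNIV. nder i u f * u (vtx i)) \<le> 3 * ((4 * a + R * a) * a)" unfolding sum_UNIV_3 by linarith
  moreover have "\<bar>sgi (\<lambda>x. f x * u x)\<bar> \<le> (R * a) * a"
    by (rule sgi_bound) (auto intro!: continuous_intros c mult_mono u f simp: abs_mult R a0)
  ultimately have "energy u u \<le> 3 * ((4 * a + R * a) * a) + (R * a) * a"
    using Gauss_Green[OF s c(1)] by linarith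
  also have "\<dots> \<le> ((4 + R) * a)\<^sup>2"
  proof -
    have "((4 + R) * a)\<^sup>2 = 3 * ((4 * a + R * a) * a) + (R * a) * a + (4 * (R * a * a) + 4 * (a * a) + (R * a) * (R * a))"
      by (simp add: power2_eq_square algebra_simps)
    moreover have "0 \<le> 4 * (R * a * a) + 4 * (a * a) + (R * a) * (R * a)" using R a0 by simp
    ultimately show ?thesis by linarith
  qed
  finally show ?thesis unfolding enorm_def using R a0 by (intro real_le_lsqrt) auto
qed

text \<open>Here \<open>g n\<close> plays the role of \<open>\<Delta>\<^sup>n (g 0)\<close>.\<close>

definition iterated :: "real \<Rightarrow> real \<Rightarrow> (nat \<Rightarrow> real ^ 2 \<Rightarrow> real) \<Rightarrow> bool" where
  "iterated R K g \<longleftrightarrow> (\<forall>n. solves (g n) (g (Suc n)) \<and> (\<forall>x\<in>SG. \<bar>g n x\<bar> \<le> K * R ^ n))"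

text \<open>The iterates are read backwards: \<open>g L\<close>, ..., \<open>g 0\<close> is a chain
  with zero jets whose start is of order \<open>R ^ L\<close>. It decays by \<open>r ^ L\<close>,
  and since \<open>R * r\<close> is below 1, letting \<open>L\<close> grow forces \<open>g 0\<close>
  to vanish.\<close>

lemma iterated_vanish_0:
  assumes g: "iterated R K g" and R: "0 < R" "R < 5 * pcon" and z: "\<And>x. x \<in> SG \<Longrightarrow> g 0 (contr 0 x) = 0"
    and x: "x \<in> SG"
  shows "g 0 x = 0"
proof -
  have s: "solves (g n) (g (Suc n))" and bd: "\<And>x. x \<in> SG \<Longrightarrow> \<bar>g n x\<bar> \<le> K * R ^ n" for n
    using g by (auto simp: iterated_def)
  have zero: "\<forall>x\<in>SG. g n (contr 0 x) = 0" for n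
  proof (induction n)
    case (Suc n)
    have "solves zero_fun zero_fun" using solves_mult[OF solves_hb[of 0], of 0] by simp
    then have "ssub 0 (g (Suc n)) x = zero_fun x" if "x \<in> SG" for x
      using solves_source_unique[OF solves_sub[OF s[of n], of 0], of zero_fun zero_fun x] Suc that by (simp add: sub_def)
    then show ?case by (simp add: ssub_def)
  qed (simp add: z)
  have v0: "g n (vtx 0) = 0" for n using zero[of n] contr_vtx[of 0] vtx_SG[of 0] by metis
  have n0: "nder 0 (g n) (g (Suc n)) = 0" for n
  proof -
    have "nder 0 (sub 0 (g n)) (ssub 0 (g (Suc n))) = nder 0 zero_fun zero_fun"
      by (rule nder_cong) (use zero in \<open>auto simp: sub_def ssub_def\<close>)
    moreover have "nder 0 zero_fun zero_fun = 0" by (simp add: nder_def)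
    moreover have "matched (g n) (g (Suc n))" using s[of n] solves_iff by blast
    ultimately show ?thesis using nder_rec[OF solves_cont(2)[OF s[of n]], of "g n" 0] by simp
  qed
  have t0: "has_tangential_deriv (g n) 0 0" for n
    unfolding has_tangential_deriv_def
  proof (rule LIMSEQ_imp_Suc)
    have "g n ((contr 0 ^^ Suc m) (vtx j)) = 0" for m j using zero[of n] by simp
    then show "(\<lambda>m. 5 ^ Suc m * (g n ((contr 0 ^^ Suc m) (vtx (0 + 1))) - g n ((contr 0 ^^ Suc m) (vtx (0 - 1))))) \<longlonglongrightarrow> 0"
      by (simp del: funpow.simps)
  qed
  \<comment> \<open>The midpoint of \<open>1 / (5 * pcon)\<close> and \<open>1 / R\<close>: above
    the first, so that \<open>decays_all\<close> applies, and below the second, so that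
    \<open>R * r < 1\<close>.\<close>
  define r where "r = (1 / (5 * pcon) + 1 / R) / 2"
  have "1 / (5 * pcon) < 1 / R" using R by (intro divide_strict_left_mono) auto
  then have r: "1 / (5 * pcon) < r" "r < 1 / R" by (simp_all add: r_def field_simps)
  have rp: "r > 0" using r(1) pcon_pos by (meson divide_pos_pos less_trans mult_pos_pos zero_less_numeral zero_less_one)
  have rR: "0 \<le> R * r" "R * r < 1" using r(2) R rp by (simp_all add: field_simps)
  obtain A where A: "decays 1 A r" using decays_all[OF r(1)] by blast
  have K0: "K \<ge> 0" using bd[OF vtx_SG[of 0], of 0] by simp
  have gb: "bnorm (g n) \<le> (5 + R) * K * R ^ n" for n
  proof -
    have "enorm (g n) \<le> (4 + R) * (K * R ^ n)"
    proof (rule enorm_sup_bound[OF s])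
      show "\<bar>g (Suc n) x\<bar> \<le> R * (K * R ^ n)" if "x \<in> SG" for x using bd[OF that, of "Suc n"] by (simp add: mult_ac)
    qed (use bd R in auto)
    moreover have "0 \<le> K * R ^ n" using K0 R by simp
    ultimately show ?thesis by (simp add: bnorm_def v0 algebra_simps)
  qed
  have bound: "bnorm (g 0) \<le> \<bar>A\<bar> * ((5 + R) * K) * (R * r) ^ L" for L
  proof -
    \<comment> \<open>The norm of \<open>g L\<close> can be taken as \<open>M\<close> because all
      jets are zero and impose no further demand on it.\<close>
    have "jet_chain 1 (bnorm (g L)) r L (\<lambda>i. g (L - i))"
      unfolding jet_chain_def
    proof (intro conjI allI impI)
      have b0: "bnorm (g L) \<ge> 0" by (rule bnorm_nonneg[OF solves_dom[OF s]])
      show "g (L - 0) \<in> dom_energy" using solves_dom[OF s[of L]] by simp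
      fix i assume i: "i < L"
      then have e: "L - i = Suc (L - Suc i)" by simp
      have nn: "0 \<le> bnorm (g L) * r ^ Suc i" using b0 rp by simp
      show "solves (g (L - Suc i)) (\<lambda>x. 1 * g (L - i) x)" using s[of "L - Suc i"] unfolding e by simp
      show "\<bar>g (L - Suc i) (vtx 0)\<bar> \<le> bnorm (g L) * r ^ Suc i" using nn by (simp add: v0)
      show "\<bar>nder 0 (g (L - Suc i)) (\<lambda>x. 1 * g (L - i) x)\<bar> \<le> bnorm (g L) * r ^ Suc i"
        using nn n0[of "L - Suc i"] unfolding e by simp
      show "\<exists>t. has_tangential_deriv (g (L - Suc i)) t 0 \<and> \<bar>t\<bar> \<le> bnorm (g L) * r ^ Suc i"
        using nn t0 by (intro exI[of _ 0]) simp
    qed simp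
    with A have "\<forall>i\<le>L. bnorm (g (L - i)) \<le> A * bnorm (g L) * r ^ i" unfolding decays_def by blast
    from this[rule_format, of L] have "bnorm (g 0) \<le> A * bnorm (g L) * r ^ L" by simp
    also have "\<dots> \<le> \<bar>A\<bar> * bnorm (g L) * r ^ L"
      using bnorm_nonneg[OF solves_dom[OF s]] rp by (intro mult_right_mono) auto
    also have "\<dots> \<le> \<bar>A\<bar> * ((5 + R) * K * R ^ L) * r ^ L"
      using gb[of L] rp by (intro mult_right_mono mult_left_mono) auto
    finally show ?thesis by (simp add: power_mult_distrib mult_ac)
  qed
  have "(\<lambda>L. \<bar>A\<bar> * ((5 + R) * K) * (R * r) ^ L) \<longlonglongrightarrow> 0"
    using rR by (intro tendsto_mult_right_zero LIMSEQ_power_zero) simp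
  then have "bnorm (g 0) \<le> 0" by (rule LIMSEQ_le_const) (use bound in auto)
  then show ?thesis using bnorm_upper[OF solves_dom[OF s] x, of 0] by simp
qed

lemma iterated_rf:
  assumes "iterated R K g" shows "iterated R K (\<lambda>n. rf c (g n))"
  using assms by (auto simp: iterated_def solves_rf) (simp add: rf_def)

lemma iterated_sub:
  assumes "iterated R K g" shows "iterated (R / 5) K (\<lambda>n x. 1 / 5 ^ n * sub i (g n) x)"
  unfolding iterated_def
proof (intro allI conjI ballI)
  fix n
  have "solves (sub i (g n)) (ssub i (g (Suc n)))" using assms by (simp add: iterated_def solves_sub)
  from solves_mult[OF this, of "1 / 5 ^ n"]
  show "solves (\<lambda>x. 1 / 5 ^ n * sub i (g n) x) (\<lambda>x. 1 / 5 ^ Suc n * sub i (g (Suc n)) x)" by (simp add: ssub_def sub_def mult.commute)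
  fix x assume "x \<in> SG"
  then have "\<bar>g n (contr i x)\<bar> \<le> K * R ^ n" using assms by (simp add: iterated_def)
  then have "\<bar>g n (contr i x)\<bar> / 5 ^ n \<le> K * R ^ n / 5 ^ n" by (intro divide_right_mono) auto
  then show "\<bar>1 / 5 ^ n * sub i (g n) x\<bar> \<le> K * (R / 5) ^ n" by (simp add: sub_def abs_mult power_divide)
qed

text \<open>The reflection with parameter \<open>i\<close> exchanges the vertices 0 and
  \<open>i\<close>, which reduces the claim to the cell 0.\<close>

lemma iterated_vanish:
  assumes g: "iterated R K g" and R: "0 < R" "R < 5 * pcon" and z: "\<And>x. x \<in> SG \<Longrightarrow> g 0 (contr i x) = 0"
    and x: "x \<in> SG"
  shows "g 0 x = 0"
proof -
  have "rf i (g 0) (contr 0 y) = 0" if "y \<in> SG" for y using z that by (simp add: rf_def reflect_contr)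
  from iterated_vanish_0[OF iterated_rf[OF g] R this, of "reflect i x"] show ?thesis using x by (simp add: rf_def)
qed

lemma iterated_vanish_word:
  assumes "iterated R K g" "0 < R" "R < 5 * pcon" "\<And>x. x \<in> SG \<Longrightarrow> g 0 (word_map w x) = 0" "x \<in> SG"
  shows "g 0 x = 0"
  using assms
proof (induction w arbitrary: g R x)
  case (Cons i w)
  have "1 / 5 ^ 0 * sub i (g 0) y = 0" if "y \<in> SG" for y
  proof (rule Cons.IH[OF iterated_sub[OF Cons.prems(1)] _ _ _ that])
    show "0 < R / 5" "R / 5 < 5 * pcon" using Cons.prems(2,3) by simp_all
    show "1 / 5 ^ 0 * sub i (g 0) (word_map w x) = 0" if "x \<in> SG" for x using Cons.prems(4)[OF that] by (simp add: sub_def)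
  qed
  then show ?case using Cons.prems(1-3,5) by (intro iterated_vanish[of R K g i x]) (auto simp: sub_def)
qed simp

section \<open>Entire analytic functions\<close>

lemma H_tendsto:
  assumes c: "\<And>n. continuous_on SG (F n)" "continuous_on SG f" and u: "uniform_limit SG F f sequentially"
  shows "(\<lambda>n. H i (F n)) \<longlonglongrightarrow> H i f"
proof (rule LIMSEQ_I)
  fix e :: real assume e: "e > 0"
  have "eventually (\<lambda>n. \<forall>x\<in>SG. dist (F n x) (f x) < e / 2) sequentially" using uniform_limitD[OF u, of "e / 2"] e by simp
  then obtain N where N: "\<And>n x. n \<ge> N \<Longrightarrow> x \<in> SG \<Longrightarrow> dist (F n x) (f x) < e / 2" by (auto simp: eventually_sequentially)
  have "norm (H i (F n) - H i f) < e" if "n \<ge> N" for n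
  proof -
    have "H i (F n) - H i f = H i (\<lambda>x. 1 * F n x + (- 1) * f x)" unfolding H_lin[OF c] by simp
    also have "\<bar>\<dots>\<bar> \<le> snorm (\<lambda>x. 1 * F n x + (- 1) * f x)" by (intro H_bound continuous_intros c)
    also have "\<dots> \<le> e / 2" using N[OF that] by (intro snorm_least) (auto simp: dist_real_def less_imp_le)
    finally show ?thesis using e by simp
  qed
  then show "\<exists>no. \<forall>n\<ge>no. norm (H i (F n) - H i f) < e" by blast
qed

lemma uniform_limit_sub: "uniform_limit SG F f sequentially \<Longrightarrow> uniform_limit SG (\<lambda>n. sub i (F n)) (sub i f) sequentially"
  unfolding uniform_limit_iff sub_def by (auto elim!: eventually_mono)

lemma uniform_limit_ssub: "uniform_limit SG F f sequentially \<Longrightarrow> uniform_limit SG (\<lambda>n. ssub i (F n)) (ssub i f) sequentially"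
  unfolding ssub_sub by (intro uniform_limit_intros uniform_limit_sub)

lemma matched_limit:
  assumes m: "\<And>n. matched (U n) (F n)" and c: "\<And>n. continuous_on SG (F n)" "continuous_on SG f"
    and lim: "uniform_limit SG U u sequentially" "uniform_limit SG F f sequentially"
  shows "matched u f"
  unfolding matched_def
proof (intro allI impI)
  fix i j :: 3 assume ij: "i \<noteq> j"
  have pt: "(\<lambda>n. U n x) \<longlonglongrightarrow> u x" if "x \<in> SG" for x using tendsto_uniform_limitI[OF lim(1) that] .
  have Hl: "(\<lambda>n. H k (ssub l (F n))) \<longlonglongrightarrow> H k (ssub l f)" for k l
    by (intro H_tendsto continuous_on_ssub c uniform_limit_ssub lim(2))
  have "(\<lambda>n. nder j (sub i (U n)) (ssub i (F n)) + nder i (sub j (U n)) (ssub j (F n))) \<longlonglongrightarrow>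
      nder j (sub i u) (ssub i f) + nder i (sub j u) (ssub j f)"
    unfolding nder_def sub_apply by (intro tendsto_intros pt Hl) auto
  moreover have "nder j (sub i (U n)) (ssub i (F n)) + nder i (sub j (U n)) (ssub j (F n)) = 0" for n
    using m[of n] ij unfolding matched_def by blast
  ultimately show "nder j (sub i u) (ssub i f) + nder i (sub j u) (ssub j f) = 0"
    by (simp add: LIMSEQ_const_iff)
qed

lemma solves_limit:
  assumes s: "\<And>n. solves (U n) (F n)" and lim: "uniform_limit SG U u sequentially" "uniform_limit SG F f sequentially"
  shows "solves u f"
proof -
  have c: "continuous_on SG u" "continuous_on SG f"
    using solves_cont[OF s] by (auto intro!: uniform_limit_theorem[OF _ lim(1)] uniform_limit_theorem[OF _ lim(2)] always_eventually)
  have "matched (subw w u) (ssubw w f)" for w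
    using s lim c
  proof (induction w arbitrary: U F u f)
    case Nil
    have "matched (U n) (F n)" for n using Nil(1)[of n] solves_iff by blast
    then show ?case using matched_limit[of U F f u] Nil solves_cont(2)[OF Nil(1)] by simp
  next
    case (Cons i w)
    have "matched (subw w (sub i u)) (ssubw w (ssub i f))"
      by (rule Cons.IH[of "\<lambda>n. sub i (U n)" "\<lambda>n. ssub i (F n)"])
        (use Cons.prems in \<open>auto intro: solves_sub uniform_limit_sub uniform_limit_ssub continuous_on_sub continuous_on_ssub\<close>)
    then show ?case by simp
  qed
  then show ?thesis using c by (simp add: solves_def)
qed

section \<open>Growth of the monomials and termwise Laplacians\<close>

lemma mon_solves: "solves (mon k (Suc j)) (mon k j)" and mon_0_solves: "solves (mon k 0) zero_fun"
  using mon_Suc[of k j] mon_0[of k] by (simp_all add: jets_def)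

text \<open>For fixed \<open>k\<close> the monomials form a jet chain in which all jets after the
  first member are zero, so they decay at every rate above \<open>1 / (5 * pcon)\<close>.\<close>

lemma mon_bound:
  assumes "1 / (5 * pcon) < r" shows "\<exists>A. \<forall>j. bnorm (mon k j) \<le> A * r ^ j"
proof -
  have r0: "r > 0" using assms pcon_pos by (meson divide_pos_pos less_trans mult_pos_pos zero_less_numeral zero_less_one)
  obtain A where A: "decays 1 A r" using decays_all[OF assms] by blast
  have "jet_chain 1 (bnorm (mon k 0)) r L (mon k)" for L
    unfolding jet_chain_def
  proof (intro conjI allI impI)
    fix i
    have nn: "0 \<le> bnorm (mon k 0) * r ^ Suc i" using r0 bnorm_nonneg[OF mon_dom] by simp
    have J: "solves (mon k (Suc i)) (mon k i)" "mon k (Suc i) (vtx 0) = 0" "nder 0 (mon k (Suc i)) (mon k i) = 0"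
      "has_tangential_deriv (mon k (Suc i)) 0 0" using mon_Suc[of k i] unfolding jets_def by auto
    show "solves (mon k (Suc i)) (\<lambda>x. 1 * mon k i x)" using J(1) by simp
    show "\<bar>mon k (Suc i) (vtx 0)\<bar> \<le> bnorm (mon k 0) * r ^ Suc i" using J(2) nn by (simp only: abs_zero)
    show "\<bar>nder 0 (mon k (Suc i)) (\<lambda>x. 1 * mon k i x)\<bar> \<le> bnorm (mon k 0) * r ^ Suc i"
      using J(3) nn by (simp only: mult_1_left abs_zero)
    show "\<exists>t. has_tangential_deriv (mon k (Suc i)) t 0 \<and> \<bar>t\<bar> \<le> bnorm (mon k 0) * r ^ Suc i"
      using J(4) nn by (intro exI[of _ 0]) (simp only: abs_zero)
  qed (rule mon_dom, simp)
  then have "bnorm (mon k j) \<le> A * bnorm (mon k 0) * r ^ j" for j using A unfolding decays_def by blast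
  then show ?thesis by blast
qed

lemma bigo_geometric:
  assumes "c \<in> O(\<lambda>j. R ^ j)" "R > 0" shows "\<exists>C. \<forall>j. \<bar>c j\<bar> \<le> C * (R::real) ^ j"
proof -
  obtain C where C: "eventually (\<lambda>j. norm (c j) \<le> C * norm (R ^ j)) at_top" using assms(1) by (elim landau_o.bigE)
  then obtain N where N: "\<And>j. j \<ge> N \<Longrightarrow> \<bar>c j\<bar> \<le> C * R ^ j" using assms(2) by (auto simp: eventually_at_top_linorder)
  define C' where "C' = \<bar>C\<bar> + (\<Sum>j<N. \<bar>c j\<bar> / R ^ j)"
  have "\<bar>c j\<bar> \<le> C' * R ^ j" for j
  proof (cases "j < N")
    case True
    have "\<bar>c j\<bar> / R ^ j \<le> (\<Sum>j<N. \<bar>c j\<bar> / R ^ j)" using True assms(2) by (intro member_le_sum) auto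
    then have "\<bar>c j\<bar> / R ^ j \<le> C'" by (simp add: C'_def)
    then show ?thesis using assms(2) by (simp add: pos_divide_le_eq)
  next
    case False
    have "(\<Sum>j<N. \<bar>c j\<bar> / R ^ j) \<ge> 0" using assms(2) by (intro sum_nonneg) auto
    then have "C * R ^ j \<le> C' * R ^ j" using assms(2) by (intro mult_right_mono) (auto simp: C'_def)
    then show ?thesis using N[of j] False by simp
  qed
  then show ?thesis by blast
qed

text \<open>The Laplacian shifts the coefficients by one index. With \<open>r\<close> between
  \<open>1 / (5 * pcon)\<close> and \<open>1 / R\<close> the terms are dominated by a geometric
  series of ratio \<open>R * r\<close>, and the shift by \<open>n\<close> contributes the factor
  \<open>R ^ n\<close>.\<close>

lemma power_series_iterated:
  assumes c: "c \<in> O(\<lambda>j. R ^ j)" and R: "0 < R" "R < 5 * pcon"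
  shows "\<exists>K. iterated R K (\<lambda>n x. \<Sum>j. c (j + n) * mon k j x)"
proof -
  define r where "r = (1 / (5 * pcon) + 1 / R) / 2"
  have "1 / (5 * pcon) < 1 / R" using R by (intro divide_strict_left_mono) auto
  then have r: "1 / (5 * pcon) < r" "r < 1 / R" by (simp_all add: r_def field_simps)
  have rp: "r > 0" using r(1) pcon_pos by (meson divide_pos_pos less_trans mult_pos_pos zero_less_numeral zero_less_one)
  have rR: "0 \<le> R * r" "R * r < 1" using r(2) R rp by (simp_all add: field_simps)
  obtain A where A: "\<And>j. bnorm (mon k j) \<le> A * r ^ j" using mon_bound[OF r(1)] by blast
  obtain C where C: "\<And>j. \<bar>c j\<bar> \<le> C * R ^ j" using bigo_geometric[OF c R(1)] by blast
  define B where "B n j = C * R ^ n * (5 * A) * (R * r) ^ j" for n j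
  have trm: "norm (c (j + n) * mon k j x) \<le> B n j" if "x \<in> SG" for n j x
  proof -
    have "\<bar>mon k j x\<bar> \<le> 5 * (A * r ^ j)" using bnorm_upper[OF mon_dom that, of k j] A[of j] by linarith
    then have "\<bar>c (j + n)\<bar> * \<bar>mon k j x\<bar> \<le> (C * R ^ (j + n)) * (5 * (A * r ^ j))"
      using C[of "j + n"] by (intro mult_mono) auto
    also have "\<dots> = B n j" by (simp add: B_def power_add power_mult_distrib mult_ac)
    finally show ?thesis by (simp add: abs_mult)
  qed
  have Bs: "B n sums (C * R ^ n * (5 * A) * (1 / (1 - R * r)))" for n
    unfolding B_def using rR by (intro sums_mult geometric_sums) simp
  have lim: "uniform_limit SG (\<lambda>N x. \<Sum>j<N. c (j + n) * mon k j x) (\<lambda>x. \<Sum>j. c (j + n) * mon k j x) sequentially" for n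
    using trm Bs by (intro Weierstrass_m_test[of _ _ "B n"]) (auto simp: sums_iff)
  \<comment> \<open>The left sum has one term more than the right one, since \<open>mon k 0\<close>
    is harmonic and disappears under the Laplacian.\<close>
  have part: "solves (\<lambda>x. \<Sum>j<Suc N. c (j + n) * mon k j x) (\<lambda>x. \<Sum>j<N. c (j + Suc n) * mon k j x)" for N n
  proof (induction N)
    case 0
    show ?case using solves_mult[OF mon_0_solves[of k], of "c n"] by simp
  next
    case (Suc N)
    have "solves (\<lambda>x. 1 * (\<Sum>j<Suc N. c (j + n) * mon k j x) + c (Suc N + n) * mon k (Suc N) x)
      (\<lambda>x. 1 * (\<Sum>j<N. c (j + Suc n) * mon k j x) + c (Suc N + n) * mon k N x)"
      by (rule solves_lin[OF Suc mon_solves])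
    then show ?case by simp
  qed
  have "solves (\<lambda>x. \<Sum>j. c (j + n) * mon k j x) (\<lambda>x. \<Sum>j. c (j + Suc n) * mon k j x)" for n
  proof (rule solves_limit[OF part])
    show "uniform_limit SG (\<lambda>N x. \<Sum>j<Suc N. c (j + n) * mon k j x) (\<lambda>x. \<Sum>j. c (j + n) * mon k j x) sequentially"
      using lim[of n] filterlim_compose[OF _ filterlim_Suc, of "\<lambda>N x. \<Sum>j<N. c (j + n) * mon k j x"] by simp
  qed (rule lim)
  moreover have "\<bar>\<Sum>j. c (j + n) * mon k j x\<bar> \<le> (C * (5 * A) * (1 / (1 - R * r))) * R ^ n" if "x \<in> SG" for n x
  proof -
    have "norm (\<Sum>j. c (j + n) * mon k j x) \<le> (\<Sum>j. B n j)"
      by (rule norm_suminf_le) (use trm[OF that] Bs in \<open>auto simp: sums_iff\<close>)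
    then show ?thesis using Bs[of n] by (simp add: sums_iff mult_ac)
  qed
  ultimately show ?thesis unfolding iterated_def by blast
qed

lemma iterated_add:
  assumes "iterated R K g" "iterated R K' g'" shows "iterated R (K + K') (\<lambda>n x. g n x + g' n x)"
  unfolding iterated_def
proof (intro allI conjI ballI)
  fix n
  show "solves (\<lambda>x. g n x + g' n x) (\<lambda>x. g (Suc n) x + g' (Suc n) x)"
    using solves_lin[of "g n" "g (Suc n)" "g' n" "g' (Suc n)" 1 1] assms by (simp add: iterated_def)
  fix x assume "x \<in> SG"
  then have "\<bar>g n x\<bar> \<le> K * R ^ n" "\<bar>g' n x\<bar> \<le> K' * R ^ n" using assms by (auto simp: iterated_def)
  then show "\<bar>g n x + g' n x\<bar> \<le> (K + K') * R ^ n" by (simp add: distrib_right)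
qed

theorem proposition2p2:
  fixes c :: "nat \<Rightarrow> nat \<Rightarrow> real" and f :: "real ^ 2 \<Rightarrow> real" and Z :: "(real ^ 2) set"
  assumes "entire_analytic_series c f"
    and "\<exists>x\<in>SG. f x \<noteq> 0"
    and "Z = {x \<in> SG. f x = 0}"
  shows "compact Z \<and> nowhere_dense_in (top_of_set SG) Z"
proof -
  obtain R where R: "0 < R" "R < lambda2" "\<And>k. k \<in> {1..3} \<Longrightarrow> (\<lambda>j. c j k) \<in> O(\<lambda>j. R ^ j)"
    and fs: "\<And>x. x \<in> SG \<Longrightarrow> f x = (\<Sum>k=1..3. \<Sum>j. c j k * monomial j k x)"
    using assms(1) unfolding entire_analytic_series_def by blast
  \<comment> \<open>The spectral bound enters here: growth below \<open>lambda2\<close> is growth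
    below the threshold \<open>5 * pcon\<close> of the decay estimate.\<close>
  have Rp: "R < 5 * pcon" using R(2) lambda2_le by linarith
  define G where "G k n x = (\<Sum>j. c (j + n) k * mon k j x)" for k n x
  have ex: "\<exists>K. iterated R K (G k)" if "k \<in> {1..3}" for k
    unfolding G_def by (rule power_series_iterated[OF R(3)[OF that] R(1) Rp])
  obtain K1 where "iterated R K1 (G 1)" using ex[of 1] by auto
  moreover obtain K2 where "iterated R K2 (G 2)" using ex[of 2] by auto
  moreover obtain K3 where "iterated R K3 (G 3)" using ex[of 3] by auto
  ultimately have it: "iterated R (K1 + K2 + K3) (\<lambda>n x. G 1 n x + G 2 n x + G 3 n x)" by (intro iterated_add)
  have feq: "f x = G 1 0 x + G 2 0 x + G 3 0 x" if "x \<in> SG" for x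
  proof -
    have "f x = (\<Sum>k=1..3. \<Sum>j. c j k * mon k j x)" using fs[OF that] monomial_eq[OF that] by simp
    also have "{1..3::nat} = {1, 2, 3}" by auto
    also have "(\<Sum>k\<in>{1, 2, 3}. \<Sum>j. c j k * mon k j x) = G 1 0 x + G 2 0 x + G 3 0 x" by (simp add: G_def)
    finally show ?thesis .
  qed
  have "continuous_on SG (\<lambda>x. G 1 0 x + G 2 0 x + G 3 0 x)"
    using it solves_cont unfolding iterated_def by blast
  then have cf: "continuous_on SG f" by (rule continuous_on_eq) (simp add: feq)
  have clZ: "closed Z"
    unfolding assms(3) by (rule continuous_closed_preimage_constant[OF cf closed_SG])
  have ZS: "Z \<subseteq> SG" using assms(3) by auto
  have "compact Z" using compact_Int_closed[OF compact_SG clZ] ZS by (simp add: Int_absorb1)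
  moreover have "top_of_set SG interior_of (top_of_set SG closure_of Z) = {}"
  proof (rule ccontr)
    have "closedin (top_of_set SG) Z" using clZ ZS by (simp add: closed_subset)
    then have cl: "top_of_set SG closure_of Z = Z" by (simp add: closure_of_eq)
    assume "\<not> ?thesis"
    then obtain x T where x: "x \<in> T" "openin (top_of_set SG) T" "T \<subseteq> Z"
      unfolding cl by (auto simp: interior_of_def)
    then obtain e where e: "e > 0" "ball x e \<inter> SG \<subseteq> T" unfolding openin_contains_ball by blast
    have xS: "x \<in> SG" using x ZS by blast
    \<comment> \<open>An interior point of \<open>Z\<close> puts a whole cell into \<open>Z\<close>,
      which is the situation of \<open>iterated_vanish_word\<close>.\<close>
    obtain w where w: "\<And>y. y \<in> cell w \<Longrightarrow> dist x y < e" using cell_in_ball[OF xS e(1)] by metis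
    have "G 1 0 (word_map w y) + G 2 0 (word_map w y) + G 3 0 (word_map w y) = 0" if "y \<in> SG" for y
    proof -
      have "word_map w y \<in> ball x e \<inter> SG" using w[of "word_map w y"] that by (auto simp: cell_def)
      then have "f (word_map w y) = 0" using e(2) x(3) assms(3) by auto
      then show ?thesis using feq[of "word_map w y"] that by simp
    qed
    then have "G 1 0 y + G 2 0 y + G 3 0 y = 0" if "y \<in> SG" for y
      using iterated_vanish_word[OF it R(1) Rp _ that, of w] by simp
    then show False using assms(2) feq by auto
  qed
  ultimately show ?thesis using ZS by (simp add: nowhere_dense_in_def)
qed

end
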